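(* Let $L$ be a $d'\times d$ NC analytic truly linear pencil in $g'$ variables and $f:\mathcal B_{g'}\to\mathcal B_L$ a semi-distinguished pencil ball map with $f(0)=0$. Then $h:=L\circ f$ maps $\mathcal B_{g'}\to\mathcal B_{d'\times d}$. Write $h=h^{(1)}+h^{(\infty)}$, where $h^{(1)}$ is the linear homogeneous component in the NC power series expansion of $h$ and $h^{(\infty)}=\sum_{\alpha=2}^\infty h^{(\alpha)}$. Then there is a unique contraction $M\in(\mathbb C^{d'\times d})^{g'}$ (a row of $g'$ matrices, i.e. a $d'\times dg'$ matrix) and a unique nontrivial (i.e. nonzero) subspace $\mathcal S\subseteq\mathbb C^{dg'}$ such that: (1) $h^{(1)}(x)=Mx$, $M|_{\mathcal S}$ is an isometry and $M\Pi_{\mathcal S^\perp}$ is a strict contraction. (2) Each $h^{(\alpha)}(x)$ for $\alpha\ge2$ is of the form $P_\alpha\Pi_{\mathcal S^\perp}x$ for a matrix $P_\alpha$ of NC polynomials. (3) For the formal NC power series $P^{(\infty)}:=\sum_{\alpha=2}^\infty P_\alpha$, the series $P^{(\infty)}(X)v:=\sum_{\alpha=2}^\infty P_\alpha(X)v$ converges for $v\in\mathcal S^\perp\otimes\mathbb C^N$ and $X\in(\mathbb C^{N\times N})^{g'}$ in an NC $\varepsilon$-neighborhood of $0$. Also, $h^{(\infty)}(x)=P^{(\infty)}(x)\Pi_{\mathcal S^\perp}x$. (4) For $X\in(\mathbb C^{N\times N})^{g'}$ with $\|X\|<1$, $\left\|\big(M\otimes I_N+P^{(\infty)}(X)\big)\Pi_{\mathcal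 S^\perp\otimes\mathbb C^N}\right\|\le1$, and $(M\otimes I_N)(\mathcal S\otimes\mathbb C^N)$ is orthogonal to $(M\otimes I_N)(\mathcal S^\perp\otimes\mathbb C^N)$, to $P_\alpha(X)(\mathcal S^\perp\otimes\mathbb C^N)$ for all $\alpha\ge2$, and to $P^{(\infty)}(X)(\mathcal S^\perp\otimes\mathbb C^N)$.
   Context: For $N\in\mathbb N$, $\mathcal M_{d'\times d}(N)$ is the set of $d'\times d$ block matrices with entries in $\mathbb C^{N\times N}$, regarded as $d'N\times dN$ matrices with the operator norm; $\mathcal M_{d'\times d}=\bigsqcup_N\mathcal M_{d'\times d}(N)$; $\mathcal B_{d'\times d}=\{X\in\mathcal M_{d'\times d}:\|X\|\le1\}$; $\mathcal B_{g'}=\mathcal B_{g'\times1}$ (columns $X=(X_1,\dots,X_{g'})$ of square matrices with $\sum X_j^*X_j\preceq I$), $\operatorname{int}\mathcal B_{g'}=\{\|X\|<1\}$, $\mathcal B_{g'}(n)$ = elements of size $n$. The NC $\varepsilon$-neighborhood of $0$ is $\bigsqcup_N\{X\in\mathcal M_{g'\times1}(N):\|X\|<\varepsilon\}$. NC analytic functions: let $x=(x_1,\dots,x_{g'})$ be noncommuting variables and $\langle x\rangle$ the set of words in them, with evaluations $w(X)\in\mathbb C^{N\times N}$. For $k',k\in\mathbb N$, an NC analytic function $f:\mathcal B_{g'}\to\mathcal M_{k'\times k}$ assigns to each $X\in\operatorname{int}\mathcal B_{g'}$ of size $N$ a matrix $f(X)\in\mathcal M_{k'\times k}(N)$, such that: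 (a) there are $a_w\in\mathbb C^{k'\times k}$ and $\varepsilon>0$ such that for all $N$ and all $X$ of size $N$ with $\|X\|<\varepsilon$, $f(X)=\sum_{\alpha=0}^\infty f^{(\alpha)}(X)$ (convergent), where $f^{(\alpha)}(X)=\sum_{|w|=\alpha}a_w\otimes w(X)$ is the $\alpha$-homogeneous part; (b) for every analytic $a$ from a domain $W\subseteq\mathbb C^K$ into $\operatorname{int}\mathcal B_{g'}$ (at a fixed size), $f\circ a$ is analytic on $W$, and continuous up to $\partial W$ whenever $a$ extends continuously to $\overline W$ with values in $\operatorname{int}\mathcal B_{g'}$. A $d'\times d$ truly linear pencil is $L(x)=\sum_{j=1}^{g'}A_jx_j$ with $A_j\in\mathbb C^{d'\times d}$; $L(X)=\sum A_j\otimes X_j$; $\mathcal B_L=\{X\in\mathcal M_{g'\times1}:\|L(X)\|\le1\}$, $\partial\mathcal B_L=\{X:\|L(X)\|=1\}$. The semi-distinguished boundary of $\mathcal B_{g'}$ is the union over $n$ of the sets of $X\in\mathcal B_{g'}(n)$ such that $X^*X$ is a projection of dimension $\ge\frac12n$. A semi-distinguished pencil ball map $f:\mathcal B_{g'}\to\mathcal B_L$ is an NC analytic function $f:\mathcal B_{g'}\to\mathcal M_{g'\times1}$ with values in $\mathcal B_L$, with $f(0)\notin\partial\mathcal B_L$, such that for every $X$ in the semi-distinguished boundary for which $\lim_{\delta\nearrow1}f(\delta X)$ exists, this limit lies in $\partial\mathcal B_L$. Conventions: next to a matrix with $dg'$ columns, $x$ denotes the column with blocks $x_1I_d,\dots,x_{g'}I_d$;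 thus for $M=[M_1\ \cdots\ M_{g'}]$, $Mx=\sum M_jx_j$. Correspondingly, on evaluation $M$ becomes $M\otimes I_N$ and $x$ becomes the column with blocks $I_d\otimes X_j$. $\Pi_{\mathcal T}$ is the orthogonal projection onto a subspace $\mathcal T$. Each $P_\alpha$ is a $d'\times dg'$ matrix of NC polynomials in $x$; $P_\alpha(X)$ is its evaluation, a $d'N\times dg'N$ matrix. In (4), $P^{(\infty)}(X)$ on $\mathcal S^\perp\otimes\mathbb C^N$ is given by the same series $\sum_{\alpha\ge2}P_\alpha(X)v$, whose convergence for $\|X\|<1$ is understood as part of (4). A strict contraction is a matrix of norm $<1$. *)

theory Defs
  imports
    "HOL-Complex_Analysis.Complex_Analysis"
    "Jordan_Normal_Form.DL_Rank"
    "Jordan_Normal_Form.Schur_Decomposition"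
begin

hide_const (open) Finite_Cartesian_Product.vec Finite_Cartesian_Product.mat
  Finite_Cartesian_Product.row Finite_Cartesian_Product.column
no_notation vec_nth (infixl \<open>$\<close> 90)
no_notation fps_nth (infixl \<open>$\<close> 75)
no_notation inner (infix \<open>\<bullet>\<close> 70)

definition vec_norm :: "complex vec \<Rightarrow> real" where
  "vec_norm v = L2_set (\<lambda>i. cmod (v $ i)) {..<dim_vec v}"

definition op_norm :: "nat \<Rightarrow> (complex vec \<Rightarrow> complex vec) \<Rightarrow> real" where
  "op_norm n T = Sup {vec_norm (T v) | v. v \<in> carrier_vec n \<and> vec_norm v \<le> 1}"

definition mat_norm :: "complex mat \<Rightarrow> real" where
  "mat_norm A = op_norm (dim_col A) (\<lambda>v. A *\<^sub>v v)"

abbreviation is_subspace :: "nat \<Rightarrow> complex vec set \<Rightarrow> bool" where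
  "is_subspace n S \<equiv> VectorSpace.subspace class_ring S (module_vec TYPE(complex) n)"

definition orth_compl :: "nat \<Rightarrow> complex vec set \<Rightarrow> complex vec set" where
  "orth_compl n S = {v \<in> carrier_vec n. \<forall>u\<in>S. v \<bullet>c u = 0}"

definition proj_mat :: "nat \<Rightarrow> complex vec set \<Rightarrow> complex mat" where
  "proj_mat n T = (THE P. P \<in> carrier_mat n n \<and>
     (\<forall>v\<in>carrier_vec n. P *\<^sub>v v \<in> T \<and> (\<forall>u\<in>T. (v - P *\<^sub>v v) \<bullet>c u = 0)))"

definition is_projection :: "complex mat \<Rightarrow> bool" where
  "is_projection Q \<longleftrightarrow> square_mat Q \<and> Q * Q = Q \<and> mat_adjoint Q = Q"

definition kron :: "complex mat \<Rightarrow> complex mat \<Rightarrow> complex mat" (infixl \<open>\<otimes>\<^sub>k\<close> 72) where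
  "A \<otimes>\<^sub>k B = mat (dim_row A * dim_row B) (dim_col A * dim_col B)
     (\<lambda>(i,j). A $$ (i div dim_row B, j div dim_col B) * B $$ (i mod dim_row B, j mod dim_col B))"

definition kron_vec :: "complex vec \<Rightarrow> complex vec \<Rightarrow> complex vec" where
  "kron_vec u y = vec (dim_vec u * dim_vec y) (\<lambda>i. u $ (i div dim_vec y) * y $ (i mod dim_vec y))"

definition tensor_space :: "nat \<Rightarrow> complex vec set \<Rightarrow> nat \<Rightarrow> complex vec set" where
  "tensor_space n S N = LinearCombinations.module.span class_ring (module_vec TYPE(complex) (n * N))
     {kron_vec u y | u y. u \<in> S \<and> y \<in> carrier_vec N}"

text \<open>Limits of vectors and matrices of a fixed size are entrywise (the dimension is finite).\<close>

definition vec_sums :: "nat \<Rightarrow> (nat \<Rightarrow> complex vec) \<Rightarrow> complex vec \<Rightarrow> bool" where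
  "vec_sums n u v \<longleftrightarrow> (\<forall>\<alpha>. u \<alpha> \<in> carrier_vec n) \<and> v \<in> carrier_vec n \<and>
     (\<forall>i<n. (\<lambda>\<alpha>. u \<alpha> $ i) sums (v $ i))"

definition mat_sums :: "nat \<Rightarrow> nat \<Rightarrow> (nat \<Rightarrow> complex mat) \<Rightarrow> complex mat \<Rightarrow> bool" where
  "mat_sums r c A B \<longleftrightarrow> (\<forall>\<alpha>. A \<alpha> \<in> carrier_mat r c) \<and> B \<in> carrier_mat r c \<and>
     (\<forall>i<r. \<forall>j<c. (\<lambda>\<alpha>. A \<alpha> $$ (i,j)) sums (B $$ (i,j)))"

definition mat_tendsto :: "nat \<Rightarrow> nat \<Rightarrow> ('a \<Rightarrow> complex mat) \<Rightarrow> complex mat \<Rightarrow> 'a filter \<Rightarrow> bool" where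
  "mat_tendsto r c A B F \<longleftrightarrow> (\<forall>i<r. \<forall>j<c. ((\<lambda>t. A t $$ (i,j)) \<longlongrightarrow> B $$ (i,j)) F)"

text \<open>Points of \<open>\<complex>\<^sup>K\<close> are extensional functions on \<open>{..<K}\<close>.\<close>

definition Cn :: "nat \<Rightarrow> (nat \<Rightarrow> complex) topology" where
  "Cn K = product_topology (\<lambda>_. euclidean) {..<K}"

definition is_domain :: "nat \<Rightarrow> (nat \<Rightarrow> complex) set \<Rightarrow> bool" where
  "is_domain K W \<longleftrightarrow> W \<noteq> {} \<and> openin (Cn K) W \<and> connectedin (Cn K) W"

text \<open>Local expandability into an (absolutely) convergent power series, the sum being over the
  multi-indices \<open>m\<close>.\<close>

definition analytic_Cn :: "nat \<Rightarrow> (nat \<Rightarrow> complex) set \<Rightarrow> ((nat \<Rightarrow> complex) \<Rightarrow> complex) \<Rightarrow> bool" where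
  "analytic_Cn K W F \<longleftrightarrow> (\<forall>p\<in>W. \<exists>r>0. \<exists>c :: (nat \<Rightarrow> nat) \<Rightarrow> complex.
     \<forall>z\<in>W. (\<forall>i<K. cmod (z i - p i) < r) \<longrightarrow>
       ((\<lambda>m. c m * (\<Prod>i<K. (z i - p i) ^ m i)) has_sum F z) ({..<K} \<rightarrow>\<^sub>E UNIV))"

definition mat_analytic ::
  "nat \<Rightarrow> (nat \<Rightarrow> complex) set \<Rightarrow> nat \<Rightarrow> nat \<Rightarrow> ((nat \<Rightarrow> complex) \<Rightarrow> complex mat) \<Rightarrow> bool" where
  "mat_analytic K W r c F \<longleftrightarrow> (\<forall>i<r. \<forall>j<c. analytic_Cn K W (\<lambda>z. F z $$ (i,j)))"

definition mat_continuous ::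
  "nat \<Rightarrow> (nat \<Rightarrow> complex) set \<Rightarrow> nat \<Rightarrow> nat \<Rightarrow> ((nat \<Rightarrow> complex) \<Rightarrow> complex mat) \<Rightarrow> bool" where
  "mat_continuous K V r c F \<longleftrightarrow>
     (\<forall>i<r. \<forall>j<c. continuous_map (subtopology (Cn K) V) euclidean (\<lambda>z. F z $$ (i,j)))"

text \<open>An \<open>r \<times> c\<close> block matrix with \<open>N \<times> N\<close> blocks is an ordinary \<open>rN \<times> cN\<close> matrix whose block
  \<open>(p,q)\<close> occupies the rows \<open>pN, \<dots>, pN + N - 1\<close> and the columns \<open>qN, \<dots>, qN + N - 1\<close>; this is the
  index convention of \<^const>\<open>kron\<close>. The disjoint unions over \<open>N \<ge> 1\<close> are kept as families
  indexed by \<open>N\<close>. In particular a \<open>g\<close>-tuple of \<open>N \<times> N\<close> matrices is the column of size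
  \<open>gN \<times> N\<close>, so that \<open>N\<close> is its number of columns.\<close>

definition nc_mats :: "nat \<Rightarrow> nat \<Rightarrow> nat \<Rightarrow> complex mat set" where
  "nc_mats r c N = carrier_mat (r * N) (c * N)"

definition nc_ball :: "nat \<Rightarrow> nat \<Rightarrow> nat \<Rightarrow> complex mat set" where
  "nc_ball r c N = {X \<in> nc_mats r c N. mat_norm X \<le> 1}"

definition nc_nbhd :: "nat \<Rightarrow> real \<Rightarrow> nat \<Rightarrow> complex mat set" where
  "nc_nbhd g \<epsilon> N = {X \<in> nc_mats g 1 N. mat_norm X < \<epsilon>}"

abbreviation int_ball :: "nat \<Rightarrow> nat \<Rightarrow> complex mat set" where
  "int_ball g N \<equiv> nc_nbhd g 1 N"

definition component :: "complex mat \<Rightarrow> nat \<Rightarrow> complex mat" where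
  "component X j = mat (dim_col X) (dim_col X) (\<lambda>(r,c). X $$ (j * dim_col X + r, c))"

abbreviation nc_words :: "nat \<Rightarrow> nat list set" where
  "nc_words g \<equiv> lists {..<g}"

definition word_eval :: "complex mat \<Rightarrow> nat list \<Rightarrow> complex mat" where
  "word_eval X w = foldr (\<lambda>j B. component X j * B) w (1\<^sub>m (dim_col X))"

text \<open>A formal NC series with \<open>r \<times> c\<close> matrix coefficients (equivalently, an \<open>r \<times> c\<close> matrix of NC
  series) is its coefficient function on words in the letters \<open>{..<g}\<close> (variables are counted
  from 0); an \<open>r \<times> c\<close> matrix of NC
  polynomials is one of finite support.\<close>

definition nc_poly :: "nat \<Rightarrow> nat \<Rightarrow> nat \<Rightarrow> (nat list \<Rightarrow> complex mat) \<Rightarrow> bool" where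
  "nc_poly g r c p \<longleftrightarrow> (\<forall>w\<in>nc_words g. p w \<in> carrier_mat r c) \<and>
     finite {w \<in> nc_words g. p w \<noteq> 0\<^sub>m r c}"

definition nc_poly_eval ::
  "nat \<Rightarrow> nat \<Rightarrow> nat \<Rightarrow> (nat list \<Rightarrow> complex mat) \<Rightarrow> complex mat \<Rightarrow> complex mat" where
  "nc_poly_eval g r c p X = mat (r * dim_col X) (c * dim_col X)
     (\<lambda>ij. \<Sum>w\<in>{w \<in> nc_words g. p w \<noteq> 0\<^sub>m r c}. (p w \<otimes>\<^sub>k word_eval X w) $$ ij)"

definition hom_part ::
  "nat \<Rightarrow> nat \<Rightarrow> (nat list \<Rightarrow> complex mat) \<Rightarrow> nat \<Rightarrow> nat list \<Rightarrow> complex mat" where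
  "hom_part r c a \<alpha> w = (if length w = \<alpha> then a w else 0\<^sub>m r c)"

definition nc_expansion ::
  "nat \<Rightarrow> nat \<Rightarrow> nat \<Rightarrow> (complex mat \<Rightarrow> complex mat) \<Rightarrow> (nat list \<Rightarrow> complex mat) \<Rightarrow> bool" where
  "nc_expansion g r c f a \<longleftrightarrow> (\<forall>w\<in>nc_words g. a w \<in> carrier_mat r c) \<and>
     (\<exists>\<epsilon>>0. \<forall>N\<ge>1. \<forall>X\<in>nc_nbhd g \<epsilon> N.
        mat_sums (r * N) (c * N) (\<lambda>\<alpha>. nc_poly_eval g r c (hom_part r c a \<alpha>) X) (f X))"

text \<open>In the last clause \<open>a\<close> is given on the closure of \<open>W\<close>, i.e. it is the continuous extension.\<close>

definition nc_analytic :: "nat \<Rightarrow> nat \<Rightarrow> nat \<Rightarrow> (complex mat \<Rightarrow> complex mat) \<Rightarrow> bool" where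
  "nc_analytic g r c f \<longleftrightarrow>
     (\<forall>N\<ge>1. \<forall>X\<in>int_ball g N. f X \<in> nc_mats r c N) \<and>
     (\<exists>a. nc_expansion g r c f a) \<and>
     (\<forall>N\<ge>1. \<forall>K\<ge>1. \<forall>W a. is_domain K W \<and> a ` W \<subseteq> int_ball g N \<and> mat_analytic K W (g * N) N a \<longrightarrow>
        mat_analytic K W (r * N) (c * N) (f \<circ> a) \<and>
        (a ` (Cn K closure_of W) \<subseteq> int_ball g N \<and> mat_continuous K (Cn K closure_of W) (g * N) N a \<longrightarrow>
           mat_continuous K (Cn K closure_of W) (r * N) (c * N) (f \<circ> a)))"

definition is_pencil :: "nat \<Rightarrow> nat \<Rightarrow> nat \<Rightarrow> (nat \<Rightarrow> complex mat) \<Rightarrow> bool" where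
  "is_pencil g d' d A \<longleftrightarrow> (\<forall>j<g. A j \<in> carrier_mat d' d)"

definition pencil_eval :: "nat \<Rightarrow> nat \<Rightarrow> nat \<Rightarrow> (nat \<Rightarrow> complex mat) \<Rightarrow> complex mat \<Rightarrow> complex mat" where
  "pencil_eval g d' d A X = mat (d' * dim_col X) (d * dim_col X)
     (\<lambda>ij. \<Sum>j<g. (A j \<otimes>\<^sub>k component X j) $$ ij)"

definition pencil_ball :: "nat \<Rightarrow> nat \<Rightarrow> nat \<Rightarrow> (nat \<Rightarrow> complex mat) \<Rightarrow> nat \<Rightarrow> complex mat set" where
  "pencil_ball g d' d A N = {X \<in> nc_mats g 1 N. mat_norm (pencil_eval g d' d A X) \<le> 1}"

definition pencil_bdry :: "nat \<Rightarrow> nat \<Rightarrow> nat \<Rightarrow> (nat \<Rightarrow> complex mat) \<Rightarrow> nat \<Rightarrow> complex mat set" where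
  "pencil_bdry g d' d A N = {X \<in> nc_mats g 1 N. mat_norm (pencil_eval g d' d A X) = 1}"

definition semi_dist_bdry :: "nat \<Rightarrow> nat \<Rightarrow> complex mat set" where
  "semi_dist_bdry g N = {X \<in> nc_ball g 1 N. is_projection (mat_adjoint X * X) \<and>
     real N / 2 \<le> real (vec_space.rank N (mat_adjoint X * X))}"

definition semi_dist_pencil_ball_map ::
  "nat \<Rightarrow> nat \<Rightarrow> nat \<Rightarrow> (nat \<Rightarrow> complex mat) \<Rightarrow> (complex mat \<Rightarrow> complex mat) \<Rightarrow> bool" where
  "semi_dist_pencil_ball_map g d' d A f \<longleftrightarrow>
     nc_analytic g g 1 f \<and>
     (\<forall>N\<ge>1. \<forall>X\<in>int_ball g N. f X \<in> pencil_ball g d' d A N) \<and>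
     (\<forall>N\<ge>1. f (0\<^sub>m (g * N) N) \<notin> pencil_bdry g d' d A N) \<and>
     (\<forall>N\<ge>1. \<forall>X\<in>semi_dist_bdry g N. \<forall>Y\<in>nc_mats g 1 N.
        mat_tendsto (g * N) N (\<lambda>\<delta>::real. f (complex_of_real \<delta> \<cdot>\<^sub>m X)) Y (at_left 1) \<longrightarrow>
        Y \<in> pencil_bdry g d' d A N)"

text \<open>The product \<open>C(x) x\<close> for a series \<open>C\<close> with \<open>d' \<times> dg\<close> coefficients, where \<open>x\<close> is the column
  with blocks \<open>x\<^sub>0 I\<^sub>d, \<dots>, x\<^sub>g\<^sub>-\<^sub>1 I\<^sub>d\<close>: the coefficient of \<open>w x\<^sub>j\<close> is the \<open>j\<close>-th \<open>d' \<times> d\<close> block of the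
  coefficient \<open>C w\<close>.\<close>

definition series_mult_x ::
  "nat \<Rightarrow> nat \<Rightarrow> (nat list \<Rightarrow> complex mat) \<Rightarrow> nat list \<Rightarrow> complex mat" where
  "series_mult_x d' d C w = (if w = [] then 0\<^sub>m d' d
     else mat d' d (\<lambda>(i,l). C (butlast w) $$ (i, last w * d + l)))"

definition const_series :: "nat \<Rightarrow> nat \<Rightarrow> complex mat \<Rightarrow> nat list \<Rightarrow> complex mat" where
  "const_series r c M w = (if w = [] then M else 0\<^sub>m r c)"

text \<open>The evaluation of the column \<open>x\<close>: blocks \<open>I\<^sub>d \<otimes> X\<^sub>0, \<dots>, I\<^sub>d \<otimes> X\<^sub>g\<^sub>-\<^sub>1\<close>.\<close>

definition x_eval :: "nat \<Rightarrow> nat \<Rightarrow> complex mat \<Rightarrow> complex mat" where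
  "x_eval g d X = mat (d * g * dim_col X) (d * dim_col X)
     (\<lambda>(i,c). (1\<^sub>m d \<otimes>\<^sub>k component X (i div (d * dim_col X))) $$ (i mod (d * dim_col X), c))"

definition series_eq :: "nat \<Rightarrow> (nat list \<Rightarrow> complex mat) \<Rightarrow> (nat list \<Rightarrow> complex mat) \<Rightarrow> bool" where
  "series_eq g C D \<longleftrightarrow> (\<forall>w\<in>nc_words g. C w = D w)"

text \<open>\<open>\<Sum>\<^sub>\<alpha>\<^sub>\<ge>\<^sub>2 P\<^sub>\<alpha>\<close> as a formal series. It exists when each word occurs in only finitely many
  \<open>P\<^sub>\<alpha>\<close>.\<close>

definition formally_summable ::
  "nat \<Rightarrow> nat \<Rightarrow> nat \<Rightarrow> (nat \<Rightarrow> nat list \<Rightarrow> complex mat) \<Rightarrow> bool" where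
  "formally_summable g r c P \<longleftrightarrow> (\<forall>w\<in>nc_words g. finite {\<alpha>. \<alpha> \<ge> 2 \<and> P \<alpha> w \<noteq> 0\<^sub>m r c})"

definition formal_sum ::
  "nat \<Rightarrow> nat \<Rightarrow> (nat \<Rightarrow> nat list \<Rightarrow> complex mat) \<Rightarrow> nat list \<Rightarrow> complex mat" where
  "formal_sum r c P w = mat r c (\<lambda>ij. \<Sum>\<alpha>\<in>{\<alpha>. \<alpha> \<ge> 2 \<and> P \<alpha> w \<noteq> 0\<^sub>m r c}. P \<alpha> w $$ ij)"

text \<open>\<open>P\<^sup>(\<^sup>\<infinity>\<^sup>)(X) v\<close> is the sum of the series \<open>\<Sum>\<^sub>\<alpha>\<^sub>\<ge>\<^sub>2 P\<^sub>\<alpha>(X) v\<close>; the index is shifted by 2. The value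
  of \<^term>\<open>tail_apply g r c P X v\<close> is meaningful only if \<open>tail_converges\<close> holds.\<close>

definition tail_converges ::
  "nat \<Rightarrow> nat \<Rightarrow> nat \<Rightarrow> (nat \<Rightarrow> nat list \<Rightarrow> complex mat) \<Rightarrow> complex mat \<Rightarrow> complex vec \<Rightarrow> bool" where
  "tail_converges g r c P X v \<longleftrightarrow>
     (\<exists>u. vec_sums (r * dim_col X) (\<lambda>\<alpha>. nc_poly_eval g r c (P (\<alpha> + 2)) X *\<^sub>v v) u)"

definition tail_apply ::
  "nat \<Rightarrow> nat \<Rightarrow> nat \<Rightarrow> (nat \<Rightarrow> nat list \<Rightarrow> complex mat) \<Rightarrow> complex mat \<Rightarrow> complex vec \<Rightarrow> complex vec" where
  "tail_apply g r c P X v = vec (r * dim_col X)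
     (\<lambda>i. \<Sum>\<alpha>. (nc_poly_eval g r c (P (\<alpha> + 2)) X *\<^sub>v v) $ i)"

end

theory Submission
  imports Defs "Jordan_Normal_Form.Spectral_Radius"
begin

text \<open>Write \<open>h = \<Sum>\<^sub>w b\<^sub>w w\<close>. Splitting off the last letter of each word gives \<open>h(x) = Q(x) x\<close>, where
  the coefficient \<open>Q\<^sub>w\<close> of \<open>Q\<close> is the row of the matrices \<open>b\<^bsub>w x\<^sub>j\<^esub>\<close> (there is no constant
  term because \<open>f(0) = 0\<close>). The required \<open>M\<close> is the constant coefficient of \<open>Q\<close>, and \<open>P\<^sub>\<alpha>\<close> is
  the homogeneous part of \<open>Q\<close> of degree \<open>\<alpha> - 1\<close>. All assertions are properties of \<open>Q\<close>.

  The main step is a noncommutative Schwarz lemma, \<open>contractive_series.schwarz\<close>: \<open>Q(X)\<close> is a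
  contraction whenever \<open>\<parallel>X\<parallel> < 1\<close>. For \<open>\<parallel>X\<parallel> \<le> r < 1\<close> choose \<open>E\<close> with \<open>E E\<^sup>* = r\<^sup>2 I - X X\<^sup>*\<close>, so that
  \<open>Z = [X E]\<close> satisfies \<open>Z Z\<^sup>* = r\<^sup>2 I\<close>, and let \<open>Y\<close> be the tuple with \<open>Z\<^sub>j\<close> on top and zero rows
  below. Then \<open>\<parallel>Y\<parallel> \<le> r\<close> and the top rows of \<open>h(Y)\<close> are \<open>Q(X) (I \<otimes> Z)\<close>; as \<open>h(Y)\<close> is a contraction and
  \<open>Z Z\<^sup>* = r\<^sup>2 I\<close>, it follows that \<open>\<parallel>Q(X)\<parallel> \<le> 1/r\<close>, and \<open>r\<close> may tend to 1. The same identity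
  transports the convergence of the homogeneous expansion of \<open>h\<close> to that of \<open>Q\<close>. For \<open>h\<close> the
  expansion converges on the whole open ball, not only near 0, because \<open>z \<mapsto> h(z X)\<close> is holomorphic on
  a disc of radius larger than 1 (\<open>expansion_converges_on_ball\<close>).

  Evaluating the contraction \<open>Q\<close> at nilpotent tuples of partial shifts that follow a single word \<open>w\<close>
  shows that \<open>M\<close> is a contraction and that, whenever \<open>\<parallel>M s\<parallel> = \<parallel>s\<parallel>\<close> and \<open>w\<close> is nonempty, \<open>Q\<^sub>w s = 0\<close> and
  \<open>M s\<close> is orthogonal to the range of \<open>Q\<^sub>w\<close>: there is no room left in a column, respectively a row,
  of a contraction. So \<open>S\<close> has to be the space of the vectors with \<open>\<parallel>M s\<parallel> = \<parallel>s\<parallel>\<close>, that is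
  \<open>M\<^sup>* M s = s\<close>; the spectral theorem for \<open>M\<^sup>* M\<close> shows that \<open>M\<close> is strictly contractive on the
  orthogonal complement of \<open>S\<close>. Finally the partial shift for a one-letter word lies in the
  semi-distinguished boundary, and \<open>f\<close> is affine on the segment from 0 to it, so the boundary
  hypothesis forces \<open>\<parallel>M\<parallel> \<ge> 1\<close> (\<open>contractive_series.boundary_norm\<close>); hence \<open>S \<noteq> 0\<close>.\<close>

section \<open>Inner products and norms\<close>

lemma cip_sum:
  fixes x y :: "complex vec"
  assumes "x \<in> carrier_vec n" "y \<in> carrier_vec n"
  shows "x \<bullet>c y = (\<Sum>i<n. x $ i * cnj (y $ i))"
  using assms by (simp add: scalar_prod_def lessThan_atLeast0)

lemma vec_norm_sq:
  assumes "v \<in> carrier_vec n"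
  shows "(vec_norm v)\<^sup>2 = (\<Sum>i<n. (cmod (v $ i))\<^sup>2)"
  using assms by (simp add: vec_norm_def L2_set_def sum_nonneg)

lemma vec_norm_nonneg [simp]: "0 \<le> vec_norm v"
  by (simp add: vec_norm_def)

lemma cip_self:
  fixes v :: "complex vec"
  assumes "v \<in> carrier_vec n"
  shows "v \<bullet>c v = of_real ((vec_norm v)\<^sup>2)"
  unfolding vec_norm_sq[OF assms] cip_sum[OF assms assms]
  by (simp add: complex_mult_cnj cmod_power2)

lemma vec_norm_eq_0_iff:
  assumes "v \<in> carrier_vec n"
  shows "vec_norm v = 0 \<longleftrightarrow> v = 0\<^sub>v n"
  using conjugate_square_eq_0_vec[OF assms] cip_self[OF assms] by simp

lemma vec_norm_zero [simp]: "vec_norm (0\<^sub>v n) = 0"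
  by (simp add: vec_norm_eq_0_iff[of _ n])

lemma vec_norm_smult: "vec_norm (c \<cdot>\<^sub>v v) = cmod c * vec_norm v"
proof -
  have "(vec_norm (c \<cdot>\<^sub>v v))\<^sup>2 = (cmod c * vec_norm v)\<^sup>2"
    using vec_norm_sq[of v "dim_vec v"] vec_norm_sq[of "c \<cdot>\<^sub>v v" "dim_vec v"]
    by (simp add: norm_mult power_mult_distrib sum_distrib_left)
  then show ?thesis by (simp add: power2_eq_iff_nonneg)
qed

lemma cip_cnj:
  fixes x y :: "complex vec"
  assumes "x \<in> carrier_vec n" "y \<in> carrier_vec n"
  shows "y \<bullet>c x = cnj (x \<bullet>c y)"
  using assms by (simp add: cip_sum[of _ n] mult.commute)

lemma cip_add_left:
  fixes x y z :: "complex vec"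
  assumes "x \<in> carrier_vec n" "y \<in> carrier_vec n" "z \<in> carrier_vec n"
  shows "(x + y) \<bullet>c z = x \<bullet>c z + y \<bullet>c z"
  using assms by (simp add: cip_sum[of _ n] sum.distrib algebra_simps)

lemma cip_minus_left:
  fixes x y z :: "complex vec"
  assumes "x \<in> carrier_vec n" "y \<in> carrier_vec n" "z \<in> carrier_vec n"
  shows "(x - y) \<bullet>c z = x \<bullet>c z - y \<bullet>c z"
  using assms by (simp add: cip_sum[of _ n] sum_subtractf algebra_simps)

lemma cip_smult_left:
  fixes x y :: "complex vec"
  assumes "x \<in> carrier_vec n" "y \<in> carrier_vec n"
  shows "(c \<cdot>\<^sub>v x) \<bullet>c y = c * (x \<bullet>c y)"
  using assms by (simp add: cip_sum[of _ n] sum_distrib_left algebra_simps)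

lemma cip_smult_right:
  fixes x y :: "complex vec"
  assumes "x \<in> carrier_vec n" "y \<in> carrier_vec n"
  shows "x \<bullet>c (c \<cdot>\<^sub>v y) = cnj c * (x \<bullet>c y)"
  using assms by (simp add: cip_sum[of _ n] sum_distrib_left algebra_simps)

lemma vec_norm_add_sq:
  assumes "x \<in> carrier_vec n" "y \<in> carrier_vec n"
  shows "(vec_norm (x + y))\<^sup>2 = (vec_norm x)\<^sup>2 + (vec_norm y)\<^sup>2 + 2 * Re (x \<bullet>c y)"
proof -
  have "(cmod (x $ i + y $ i))\<^sup>2 = (cmod (x $ i))\<^sup>2 + (cmod (y $ i))\<^sup>2 + 2 * Re (x $ i * cnj (y $ i))" for i
    unfolding cmod_power2 by (simp add: power2_eq_square algebra_simps)
  then show ?thesis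
    using assms by (simp add: cip_sum[of _ n] vec_norm_sq[of _ n] sum.distrib sum_distrib_left)
qed

lemma cip_cauchy_schwarz:
  assumes "x \<in> carrier_vec n" "y \<in> carrier_vec n"
  shows "cmod (x \<bullet>c y) \<le> vec_norm x * vec_norm y"
proof -
  have "cmod (x \<bullet>c y) \<le> (\<Sum>i<n. cmod (x $ i * cnj (y $ i)))"
    unfolding cip_sum[OF assms] by (rule norm_sum)
  also have "\<dots> = (\<Sum>i<n. \<bar>cmod (x $ i)\<bar> * \<bar>cmod (y $ i)\<bar>)" by (simp add: norm_mult)
  also have "\<dots> \<le> vec_norm x * vec_norm y"
    using L2_set_mult_ineq[of "\<lambda>i. cmod (x $ i)" "\<lambda>i. cmod (y $ i)" "{..<n}"] assms
    by (simp add: vec_norm_def)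
  finally show ?thesis .
qed

text \<open>The first-order condition at \<open>t = 0\<close> of the inequality \<open>|a + t b|\<^sup>2 \<le> |a|\<^sup>2 + C |t|\<^sup>2\<close>.\<close>

lemma orthogonal_if_norm_le:
  assumes a: "a \<in> carrier_vec n" and b: "b \<in> carrier_vec n"
    and le: "\<And>t::complex. (vec_norm (a + t \<cdot>\<^sub>v b))\<^sup>2 \<le> (vec_norm a)\<^sup>2 + C * (cmod t)\<^sup>2"
  shows "a \<bullet>c b = 0"
proof (rule ccontr)
  define p where "p = a \<bullet>c b"
  assume "a \<bullet>c b \<noteq> 0"
  then have p: "cmod p > 0" by (simp add: p_def)
  define s where "s = 1 / (\<bar>C\<bar> + 1)"
  have s: "s > 0" "\<bar>C\<bar> * s < 1" by (auto simp: s_def)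
  have "(vec_norm (a + (of_real s * p) \<cdot>\<^sub>v b))\<^sup>2
      = (vec_norm a)\<^sup>2 + (s * cmod p * vec_norm b)\<^sup>2 + 2 * Re (a \<bullet>c ((of_real s * p) \<cdot>\<^sub>v b))"
    using a b s by (simp add: vec_norm_add_sq[of _ n] vec_norm_smult norm_mult)
  moreover have "a \<bullet>c ((of_real s * p) \<cdot>\<^sub>v b) = of_real (s * (cmod p)\<^sup>2)"
    using a b by (simp add: cip_smult_right[of _ n] p_def[symmetric] complex_norm_square mult.commute[of "cnj p"] mult.assoc del: of_real_power)
  ultimately have "(s * cmod p * vec_norm b)\<^sup>2 + 2 * s * (cmod p)\<^sup>2 \<le> C * (s * cmod p)\<^sup>2"
    using le[of "of_real s * p"] s by (simp add: norm_mult)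
  moreover have "0 \<le> (s * cmod p * vec_norm b)\<^sup>2" by simp
  ultimately have "2 * s * (cmod p)\<^sup>2 \<le> C * (s * cmod p)\<^sup>2" by linarith
  also have "\<dots> \<le> \<bar>C\<bar> * (s * cmod p)\<^sup>2" by (intro mult_right_mono) auto
  also have "\<dots> = (\<bar>C\<bar> * s) * (s * (cmod p)\<^sup>2)" by (simp add: power2_eq_square)
  also have "\<dots> < 1 * (s * (cmod p)\<^sup>2)" using s p by (intro mult_strict_right_mono) auto
  finally show False using s p by simp
qed

lemma mat_mult_vec_index:
  fixes A :: "complex mat"
  assumes "A \<in> carrier_mat m n" "v \<in> carrier_vec n" "i < m"
  shows "(A *\<^sub>v v) $ i = (\<Sum>j<n. A $$ (i,j) * v $ j)"
  using assms by (simp add: scalar_prod_def lessThan_atLeast0)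

lemma mat_adjoint_carrier: "A \<in> carrier_mat m n \<Longrightarrow> mat_adjoint A \<in> carrier_mat n m"
  by (auto simp: mat_adjoint_def)

lemma mat_adjoint_index:
  assumes "A \<in> carrier_mat m n" "i < n" "j < m"
  shows "mat_adjoint A $$ (i,j) = cnj (A $$ (j,i))"
  using assms by (simp add: mat_adjoint_def mat_of_rows_index)

lemma cip_adjoint:
  fixes A :: "complex mat"
  assumes A: "A \<in> carrier_mat m n" and x: "x \<in> carrier_vec n" and y: "y \<in> carrier_vec m"
  shows "(A *\<^sub>v x) \<bullet>c y = x \<bullet>c (mat_adjoint A *\<^sub>v y)"
proof -
  have "(A *\<^sub>v x) \<bullet>c y = (\<Sum>i<m. \<Sum>j<n. A $$ (i,j) * x $ j * cnj (y $ i))"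
    using A x y by (subst cip_sum[of _ m]) (auto simp: mat_mult_vec_index[OF A x] sum_distrib_right
        intro!: sum.cong simp del: index_mult_mat_vec)
  also have "\<dots> = (\<Sum>j<n. \<Sum>i<m. A $$ (i,j) * x $ j * cnj (y $ i))" by (rule sum.swap)
  also have "\<dots> = x \<bullet>c (mat_adjoint A *\<^sub>v y)"
    using A x y mat_adjoint_carrier[OF A]
    by (subst cip_sum[of _ n]) (auto simp: mat_mult_vec_index[OF mat_adjoint_carrier[OF A] y] sum_distrib_left
        mat_adjoint_index[OF A] intro!: sum.cong simp del: index_mult_mat_vec)
  finally show ?thesis .
qed

lemma mat_eq_if_mult_vec_eq:
  fixes A B :: "complex mat"
  assumes A: "A \<in> carrier_mat m n" and B: "B \<in> carrier_mat m n"
    and eq: "\<And>v. v \<in> carrier_vec n \<Longrightarrow> A *\<^sub>v v = B *\<^sub>v v"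
  shows "A = B"
proof (rule eq_matI)
  fix i j assume ij: "i < dim_row B" "j < dim_col B"
  have "(A *\<^sub>v unit_vec n j) $ i = (B *\<^sub>v unit_vec n j) $ i" using eq[of "unit_vec n j"] by simp
  then show "A $$ (i,j) = B $$ (i,j)" using A B ij by simp
qed (use A B in auto)

subsection \<open>The operator norm\<close>

lemma mat_vec_bound_exists:
  fixes A :: "complex mat"
  assumes A: "A \<in> carrier_mat m n"
  shows "\<exists>C\<ge>0. \<forall>v\<in>carrier_vec n. vec_norm (A *\<^sub>v v) \<le> C * vec_norm v"
proof (intro exI conjI ballI)
  let ?C = "sqrt (\<Sum>i<m. (vec_norm (row A i))\<^sup>2)"
  show "0 \<le> ?C" by (simp add: sum_nonneg)
  fix v :: "complex vec" assume v: "v \<in> carrier_vec n"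
  have "(vec_norm (A *\<^sub>v v))\<^sup>2 = (\<Sum>i<m. (cmod (row A i \<bullet>c conjugate v))\<^sup>2)"
    using A v by (subst vec_norm_sq[of _ m]) auto
  also have "\<dots> \<le> (\<Sum>i<m. (vec_norm (row A i) * vec_norm v)\<^sup>2)"
  proof (intro sum_mono power_mono)
    fix i assume "i \<in> {..<m}"
    have "vec_norm (conjugate v) = vec_norm v" by (simp add: vec_norm_def L2_set_def)
    then show "cmod (row A i \<bullet>c conjugate v) \<le> vec_norm (row A i) * vec_norm v"
      using cip_cauchy_schwarz[of "row A i" n "conjugate v"] A v by auto
  qed auto
  also have "\<dots> = (?C * vec_norm v)\<^sup>2"
    by (simp add: power_mult_distrib sum_distrib_right sum_nonneg)
  finally show "vec_norm (A *\<^sub>v v) \<le> ?C * vec_norm v"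
    by (rule power2_le_imp_le) (simp add: sum_nonneg)
qed

lemma op_norm_le:
  assumes "\<And>v. v \<in> carrier_vec n \<Longrightarrow> vec_norm v \<le> 1 \<Longrightarrow> vec_norm (T v) \<le> c"
  shows "op_norm n T \<le> c"
  unfolding op_norm_def
proof (rule cSup_least)
  show "{vec_norm (T v) |v. v \<in> carrier_vec n \<and> vec_norm v \<le> 1} \<noteq> {}"
    by (auto intro!: exI[of _ "0\<^sub>v n"])
qed (use assms in auto)

lemma mat_norm_le:
  assumes A: "A \<in> carrier_mat m n" and c: "0 \<le> c"
    and le: "\<And>v. v \<in> carrier_vec n \<Longrightarrow> vec_norm (A *\<^sub>v v) \<le> c * vec_norm v"
  shows "mat_norm A \<le> c"
  unfolding mat_norm_def
proof (rule op_norm_le)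
  fix v assume "v \<in> carrier_vec (dim_col A)" "vec_norm v \<le> 1"
  then show "vec_norm (A *\<^sub>v v) \<le> c"
    using le[of v] A mult_left_le[OF _ c, of "vec_norm v"] by auto
qed

lemma mat_norm_bdd_above:
  "bdd_above {vec_norm (A *\<^sub>v v) |v. v \<in> carrier_vec (dim_col A) \<and> vec_norm v \<le> 1}"
proof -
  obtain C where C: "C \<ge> 0" "\<And>v. v \<in> carrier_vec (dim_col A) \<Longrightarrow> vec_norm (A *\<^sub>v v) \<le> C * vec_norm v"
    using mat_vec_bound_exists[of A "dim_row A" "dim_col A"] by auto
  show ?thesis
    by (rule bdd_aboveI[of _ C]) (use C mult_left_le[OF _ C(1)] order_trans in blast)
qed

lemma mat_norm_bound:
  assumes A: "A \<in> carrier_mat m n" and v: "v \<in> carrier_vec n"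
  shows "vec_norm (A *\<^sub>v v) \<le> mat_norm A * vec_norm v"
proof (cases "vec_norm v = 0")
  case True
  obtain C where "vec_norm (A *\<^sub>v v) \<le> C * vec_norm v" using mat_vec_bound_exists[OF A] v by auto
  then show ?thesis using True by simp
next
  case False
  then have pos: "vec_norm v > 0" using vec_norm_nonneg[of v] by linarith
  define u where "u = of_real (1 / vec_norm v) \<cdot>\<^sub>v v"
  have u: "u \<in> carrier_vec n" "vec_norm u = 1" using v pos by (auto simp: u_def vec_norm_smult norm_divide)
  have "vec_norm (A *\<^sub>v u) \<le> mat_norm A"
    unfolding mat_norm_def op_norm_def by (rule cSup_upper[OF _ mat_norm_bdd_above]) (use A u in auto)
  moreover have "vec_norm (A *\<^sub>v u) = 1 / vec_norm v * vec_norm (A *\<^sub>v v)"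
    using A v pos unfolding u_def by (simp add: mult_mat_vec vec_norm_smult norm_divide)
  ultimately show ?thesis using pos by (simp add: field_simps)
qed

lemma mat_norm_nonneg: "0 \<le> mat_norm A"
  unfolding mat_norm_def op_norm_def
proof (rule cSup_upper2[OF _ _ mat_norm_bdd_above])
  show "vec_norm (A *\<^sub>v 0\<^sub>v (dim_col A)) \<in> {vec_norm (A *\<^sub>v v) |v. v \<in> carrier_vec (dim_col A) \<and> vec_norm v \<le> 1}"
    by (auto intro!: exI[of _ "0\<^sub>v (dim_col A)"])
qed simp

lemma adjoint_bound:
  assumes A: "A \<in> carrier_mat m n" and c: "0 \<le> c"
    and le: "\<And>v. v \<in> carrier_vec n \<Longrightarrow> vec_norm (A *\<^sub>v v) \<le> c * vec_norm v"
    and u: "u \<in> carrier_vec m"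
  shows "vec_norm (mat_adjoint A *\<^sub>v u) \<le> c * vec_norm u"
proof -
  let ?w = "mat_adjoint A *\<^sub>v u"
  have w: "?w \<in> carrier_vec n" using mat_adjoint_carrier[OF A] u by auto
  have "(vec_norm ?w)\<^sup>2 = cmod (?w \<bullet>c ?w)" by (subst cip_self[OF w]) (simp add: norm_power)
  also have "?w \<bullet>c ?w = (A *\<^sub>v ?w) \<bullet>c u" using cip_adjoint[OF A w u] by simp
  also have "cmod \<dots> \<le> vec_norm (A *\<^sub>v ?w) * vec_norm u"
    using A w u by (intro cip_cauchy_schwarz) auto
  also have "\<dots> \<le> c * vec_norm ?w * vec_norm u" by (intro mult_right_mono le w) auto
  finally have "vec_norm ?w * vec_norm ?w \<le> vec_norm ?w * (c * vec_norm u)"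
    by (simp add: power2_eq_square mult_ac)
  then show ?thesis
    using c by (cases "vec_norm ?w = 0") (auto simp: mult_le_cancel_left less_le)
qed

section \<open>Orthonormal families and orthogonal projections\<close>

text \<open>Linear subspaces of \<open>\<complex>\<^sup>n\<close>, without the algebraic structure of a module; see
  \<open>is_subspace_iff\<close>.\<close>

definition lin_subspace :: "nat \<Rightarrow> complex vec set \<Rightarrow> bool" where
  "lin_subspace n T \<longleftrightarrow> T \<subseteq> carrier_vec n \<and> 0\<^sub>v n \<in> T \<and>
     (\<forall>u\<in>T. \<forall>v\<in>T. u + v \<in> T) \<and> (\<forall>c. \<forall>u\<in>T. c \<cdot>\<^sub>v u \<in> T)"

lemma is_subspace_iff: "is_subspace n T \<longleftrightarrow> lin_subspace n T"
proof -
  interpret V: vec_space "TYPE(complex)" n .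
  show ?thesis
    unfolding VectorSpace.subspace_def submodule_def lin_subspace_def
    using V.vectorspace_axioms V.module_axioms
    by (auto simp: module_vec_simps class_ring_simps)
qed

text \<open>The vector \<open>\<Sum>\<^sub>i\<^sub><\<^sub>k c\<^sub>i e\<^sub>i\<close> of \<open>\<complex>\<^sup>n\<close>.\<close>

definition lincomb_vec :: "nat \<Rightarrow> nat \<Rightarrow> (nat \<Rightarrow> complex) \<Rightarrow> (nat \<Rightarrow> complex vec) \<Rightarrow> complex vec" where
  "lincomb_vec n k c e = vec n (\<lambda>a. \<Sum>i<k. c i * e i $ a)"

lemma lincomb_vec_carrier [simp]: "lincomb_vec n k c e \<in> carrier_vec n"
  by (simp add: lincomb_vec_def)

lemma lincomb_vec_in_subspace:
  assumes T: "lin_subspace n T" and e: "\<And>i. i < k \<Longrightarrow> e i \<in> T"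
  shows "lincomb_vec n k c e \<in> T"
  using e
proof (induction k)
  case 0
  have "lincomb_vec n 0 c e = 0\<^sub>v n" by (auto simp: lincomb_vec_def)
  then show ?case using T by (simp add: lin_subspace_def)
next
  case (Suc k)
  have "e k \<in> carrier_vec n" using Suc.prems[of k] T by (auto simp: lin_subspace_def)
  then have "lincomb_vec n (Suc k) c e = lincomb_vec n k c e + c k \<cdot>\<^sub>v e k"
    by (auto simp: lincomb_vec_def)
  then show ?case using Suc T by (simp add: lin_subspace_def)
qed

lemma cip_lincomb_vec:
  assumes e: "\<And>i. i < k \<Longrightarrow> e i \<in> carrier_vec n" and y: "y \<in> carrier_vec n"
  shows "lincomb_vec n k c e \<bullet>c y = (\<Sum>i<k. c i * (e i \<bullet>c y))"
proof -
  have "lincomb_vec n k c e \<bullet>c y = (\<Sum>a<n. \<Sum>i<k. c i * e i $ a * cnj (y $ a))"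
    using y by (subst cip_sum[of _ n]) (auto simp: lincomb_vec_def sum_distrib_right)
  also have "\<dots> = (\<Sum>i<k. \<Sum>a<n. c i * e i $ a * cnj (y $ a))" by (rule sum.swap)
  also have "\<dots> = (\<Sum>i<k. c i * (e i \<bullet>c y))"
    using e y by (intro sum.cong refl) (subst cip_sum[of _ n], auto simp: sum_distrib_left mult.assoc)
  finally show ?thesis .
qed

text \<open>Orthonormality of \<open>e\<^sub>0, \<dots>, e\<^sub>k\<^sub>-\<^sub>1\<close> in \<open>\<complex>\<^sup>n\<close>; the values of \<open>e\<close> from \<open>k\<close> on do not matter.\<close>

definition orthonormal :: "nat \<Rightarrow> nat \<Rightarrow> (nat \<Rightarrow> complex vec) \<Rightarrow> bool" where
  "orthonormal n k e \<longleftrightarrow> (\<forall>i<k. e i \<in> carrier_vec n) \<and>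
     (\<forall>i<k. \<forall>j<k. e i \<bullet>c e j = (if i = j then 1 else 0))"

lemma cip_lincomb_orthonormal:
  assumes "orthonormal n k e" "j < k"
  shows "lincomb_vec n k c e \<bullet>c e j = c j"
proof -
  have "lincomb_vec n k c e \<bullet>c e j = (\<Sum>i<k. c i * (e i \<bullet>c e j))"
    using assms by (intro cip_lincomb_vec) (auto simp: orthonormal_def)
  also have "\<dots> = (\<Sum>i<k. if i = j then c i else 0)"
    using assms by (intro sum.cong) (auto simp: orthonormal_def)
  finally show ?thesis using assms by simp
qed

lemma norm_lincomb_orthonormal:
  assumes "orthonormal n k e"
  shows "(vec_norm (lincomb_vec n k c e))\<^sup>2 = (\<Sum>i<k. (cmod (c i))\<^sup>2)"
proof -
  let ?L = "lincomb_vec n k c e"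
  have e: "e i \<in> carrier_vec n" if "i < k" for i using assms that by (auto simp: orthonormal_def)
  have "?L \<bullet>c ?L = (\<Sum>i<k. c i * (e i \<bullet>c ?L))" using e by (intro cip_lincomb_vec) auto
  also have "\<dots> = (\<Sum>i<k. c i * cnj (c i))"
  proof (intro sum.cong refl)
    fix i assume i: "i \<in> {..<k}"
    have "e i \<bullet>c ?L = cnj (?L \<bullet>c e i)" using e i by (intro cip_cnj[of _ n]) auto
    then show "c i * (e i \<bullet>c ?L) = c i * cnj (c i)" using cip_lincomb_orthonormal[OF assms, of i c] i by simp
  qed
  also have "\<dots> = of_real (\<Sum>i<k. (cmod (c i))\<^sup>2)" by (simp add: complex_mult_cnj cmod_power2)
  finally show ?thesis unfolding cip_self[OF lincomb_vec_carrier] of_real_eq_iff .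
qed

lemma residual_orthogonal:
  assumes "orthonormal n k e" "v \<in> carrier_vec n" "j < k"
  shows "(v - lincomb_vec n k (\<lambda>i. v \<bullet>c e i) e) \<bullet>c e j = 0"
proof -
  have "e j \<in> carrier_vec n" using assms by (auto simp: orthonormal_def)
  then show ?thesis
    using assms cip_lincomb_orthonormal[OF assms(1,3), of "\<lambda>i. v \<bullet>c e i"]
    by (simp add: cip_minus_left[of _ n])
qed

lemma pythagoras:
  assumes v: "v \<in> carrier_vec n" and u: "u \<in> carrier_vec n" and "(v - u) \<bullet>c u = 0"
  shows "(vec_norm v)\<^sup>2 = (vec_norm (v - u))\<^sup>2 + (vec_norm u)\<^sup>2"
proof -
  have "v = (v - u) + u" using u v by auto
  then show ?thesis
    using vec_norm_add_sq[of "v - u" n u] assms by simp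
qed

lemma bessel:
  assumes o: "orthonormal n k e" and v: "v \<in> carrier_vec n"
  shows "(\<Sum>i<k. (cmod (v \<bullet>c e i))\<^sup>2) \<le> (vec_norm v)\<^sup>2"
proof -
  define u where "u = lincomb_vec n k (\<lambda>i. v \<bullet>c e i) e"
  have u: "u \<in> carrier_vec n" by (simp add: u_def)
  have "u \<bullet>c (v - u) = (\<Sum>i<k. (v \<bullet>c e i) * (e i \<bullet>c (v - u)))"
    unfolding u_def using o v by (intro cip_lincomb_vec) (auto simp: orthonormal_def)
  also have "\<dots> = 0"
  proof (rule sum.neutral, intro ballI)
    fix i assume i: "i \<in> {..<k}"
    have "e i \<in> carrier_vec n" using o i by (auto simp: orthonormal_def)
    then have "e i \<bullet>c (v - u) = cnj ((v - u) \<bullet>c e i)" using v u by (intro cip_cnj[of _ n]) auto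
    then show "v \<bullet>c e i * (e i \<bullet>c (v - u)) = 0"
      using residual_orthogonal[OF o v, of i] i by (simp add: u_def)
  qed
  finally have "(v - u) \<bullet>c u = 0" using cip_cnj[of u n "v - u"] u v by auto
  from pythagoras[OF v u this] show ?thesis
    using norm_lincomb_orthonormal[OF o, of "\<lambda>i. v \<bullet>c e i"] by (simp add: u_def[symmetric])
qed

text \<open>Sum Bessel's inequality over the standard basis.\<close>

lemma orthonormal_length:
  assumes o: "orthonormal n k e"
  shows "k \<le> n"
proof -
  have e: "e i \<in> carrier_vec n" if "i < k" for i using o that by (auto simp: orthonormal_def)
  have "real k = (\<Sum>i<k. (vec_norm (e i))\<^sup>2)"
  proof -
    have "(vec_norm (e i))\<^sup>2 = 1" if "i < k" for i
    proof -
      have "complex_of_real ((vec_norm (e i))\<^sup>2) = 1"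
        using cip_self[OF e[OF that]] o that by (simp add: orthonormal_def)
      then show ?thesis using of_real_eq_1_iff by blast
    qed
    then show ?thesis by simp
  qed
  also have "\<dots> = (\<Sum>i<k. \<Sum>a<n. (cmod (e i $ a))\<^sup>2)"
    using e by (intro sum.cong refl vec_norm_sq) auto
  also have "\<dots> = (\<Sum>a<n. \<Sum>i<k. (cmod (e i $ a))\<^sup>2)" by (rule sum.swap)
  also have "\<dots> \<le> (\<Sum>a<n. 1)"
  proof (rule sum_mono)
    fix a assume a: "a \<in> {..<n}"
    have "unit_vec n a \<bullet>c e i = cnj (e i $ a)" if "i < k" for i
      using e[OF that] a by (simp add: scalar_prod_left_unit)
    moreover have "(vec_norm (unit_vec n a))\<^sup>2 = 1"
      using a by (subst vec_norm_sq[of _ n])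
        (auto simp: unit_vec_def if_distrib[of cmod] if_distrib[of "\<lambda>x. x\<^sup>2"] cong: if_cong)
    ultimately show "(\<Sum>i<k. (cmod (e i $ a))\<^sup>2) \<le> 1"
      using bessel[OF o, of "unit_vec n a"] by simp
  qed
  finally show ?thesis by simp
qed

text \<open>Applied to the membership in a subspace this yields an orthonormal basis, applied to the
  eigenvectors of a Hermitian matrix it yields an orthonormal eigenbasis.\<close>

lemma maximal_orthonormal_family:
  "\<exists>k e. orthonormal n k e \<and> (\<forall>i<k. Q (e i)) \<and>
     (\<forall>v\<in>carrier_vec n. Q v \<longrightarrow> vec_norm v = 1 \<longrightarrow> (\<exists>i<k. v \<bullet>c e i \<noteq> 0))"
proof -
  let ?A = "\<lambda>k. \<exists>e. orthonormal n k e \<and> (\<forall>i<k. Q (e i))"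
  have "?A 0" by (simp add: orthonormal_def)
  moreover have "\<forall>k. ?A k \<longrightarrow> k \<le> n" using orthonormal_length by blast
  ultimately obtain k where k: "?A k" and max: "\<And>l. ?A l \<Longrightarrow> l \<le> k"
    using Nat.ex_has_greatest_nat[of ?A 0 n] by blast
  from k obtain e where o: "orthonormal n k e" and Q: "\<forall>i<k. Q (e i)" by blast
  have "\<exists>i<k. v \<bullet>c e i \<noteq> 0" if v: "v \<in> carrier_vec n" and Qv: "Q v" and n1: "vec_norm v = 1" for v
  proof (rule ccontr)
    assume "\<not> ?thesis"
    then have z: "v \<bullet>c e i = 0" if "i < k" for i using that by blast
    have z': "e i \<bullet>c v = 0" if "i < k" for i
      using z[OF that] cip_cnj[of v n "e i"] v o that by (auto simp: orthonormal_def)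
    have "orthonormal n (Suc k) (e(k := v))"
      using o v z z' cip_self[OF v] n1 by (auto simp: orthonormal_def less_Suc_eq)
    moreover have "\<forall>i<Suc k. Q ((e(k := v)) i)" using Q Qv by (auto simp: less_Suc_eq)
    ultimately have "Suc k \<le> k" by (intro max) blast
    then show False by simp
  qed
  then show ?thesis using o Q by blast
qed

lemma exists_unit_multiple:
  assumes "v \<in> carrier_vec n" "v \<noteq> 0\<^sub>v n"
  shows "\<exists>c. vec_norm (c \<cdot>\<^sub>v v) = 1"
proof
  have "vec_norm v \<noteq> 0" using vec_norm_eq_0_iff[OF assms(1)] assms(2) by simp
  then show "vec_norm (of_real (1 / vec_norm v) \<cdot>\<^sub>v v) = 1" by (simp add: vec_norm_smult norm_divide)
qed

lemma lin_subspace_diff: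
  assumes "lin_subspace n T" "u \<in> T" "v \<in> T"
  shows "u - v \<in> T"
proof -
  have "u \<in> carrier_vec n" "v \<in> carrier_vec n" using assms by (auto simp: lin_subspace_def)
  then have "u - v = u + (-1) \<cdot>\<^sub>v v" by auto
  then show ?thesis using assms by (simp add: lin_subspace_def)
qed

lemma vec_diff_eq_0:
  fixes u v :: "complex vec"
  assumes "u \<in> carrier_vec n" "v \<in> carrier_vec n" "u - v = 0\<^sub>v n"
  shows "u = v"
proof (rule eq_vecI)
  fix i assume "i < dim_vec v"
  then have i: "i < n" using assms by simp
  have "(u - v) $ i = 0\<^sub>v n $ i" using assms(3) by simp
  then show "u $ i = v $ i" using assms(1,2) i by simp
qed (use assms in auto)

lemma orthonormal_basis_of_subspace:
  assumes T: "lin_subspace n T"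
  shows "\<exists>k e. orthonormal n k e \<and> (\<forall>i<k. e i \<in> T) \<and>
    (\<forall>v\<in>T. v = lincomb_vec n k (\<lambda>i. v \<bullet>c e i) e)"
proof -
  obtain k e where o: "orthonormal n k e" and eT: "\<forall>i<k. e i \<in> T"
    and max: "\<And>v. v \<in> carrier_vec n \<Longrightarrow> v \<in> T \<Longrightarrow> vec_norm v = 1 \<Longrightarrow> \<exists>i<k. v \<bullet>c e i \<noteq> 0"
    using maximal_orthonormal_family[of n "\<lambda>v. v \<in> T"] by blast
  have "v = lincomb_vec n k (\<lambda>i. v \<bullet>c e i) e" if vT: "v \<in> T" for v
  proof (rule ccontr)
    let ?u = "lincomb_vec n k (\<lambda>i. v \<bullet>c e i) e"
    assume ne: "v \<noteq> ?u"
    have v: "v \<in> carrier_vec n" using T vT by (auto simp: lin_subspace_def)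
    have w: "v - ?u \<in> carrier_vec n" using v by auto
    have wT: "v - ?u \<in> T" using lin_subspace_diff[OF T vT] lincomb_vec_in_subspace[OF T, of k e] eT by auto
    have "v - ?u \<noteq> 0\<^sub>v n"
      using vec_diff_eq_0[OF v lincomb_vec_carrier] ne by blast
    then obtain c where c: "vec_norm (c \<cdot>\<^sub>v (v - ?u)) = 1" using exists_unit_multiple[OF w] by blast
    have "c \<cdot>\<^sub>v (v - ?u) \<in> T" using T wT by (simp add: lin_subspace_def)
    then obtain i where i: "i < k" "(c \<cdot>\<^sub>v (v - ?u)) \<bullet>c e i \<noteq> 0" using max[OF _ _ c] w by auto
    then show False
      using residual_orthogonal[OF o v i(1)] o w by (auto simp: cip_smult_left[of _ n] orthonormal_def)
  qed
  then show ?thesis using o eT by blast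
qed

lemma lin_subspace_orth_compl:
  assumes "T \<subseteq> carrier_vec n"
  shows "lin_subspace n (orth_compl n T)"
proof -
  have T: "u \<in> carrier_vec n" if "u \<in> T" for u using assms that by blast
  show ?thesis
    unfolding lin_subspace_def orth_compl_def
    using T by (auto simp: cip_add_left[of _ n] cip_smult_left[of _ n])
qed

lemma orthogonal_to_self:
  fixes v :: "complex vec"
  assumes "v \<in> carrier_vec n" "v \<bullet>c v = 0"
  shows "v = 0\<^sub>v n"
  using conjugate_square_eq_0_vec[OF assms(1)] assms(2) by simp

lemma proj_mat_exists1:
  assumes T: "lin_subspace n T"
  shows "\<exists>!P. P \<in> carrier_mat n n \<and>
     (\<forall>v\<in>carrier_vec n. P *\<^sub>v v \<in> T \<and> (\<forall>u\<in>T. (v - P *\<^sub>v v) \<bullet>c u = 0))"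
proof (rule ex_ex1I)
  obtain k e where o: "orthonormal n k e" and eT: "\<forall>i<k. e i \<in> T"
    and full: "\<And>v. v \<in> T \<Longrightarrow> v = lincomb_vec n k (\<lambda>i. v \<bullet>c e i) e"
    using orthonormal_basis_of_subspace[OF T] by blast
  have e: "e i \<in> carrier_vec n" if "i < k" for i using o that by (auto simp: orthonormal_def)
  define P where "P = mat n n (\<lambda>(a,b). \<Sum>i<k. cnj (e i $ b) * e i $ a)"
  have P: "P *\<^sub>v v = lincomb_vec n k (\<lambda>i. v \<bullet>c e i) e" if v: "v \<in> carrier_vec n" for v
  proof (rule eq_vecI)
    fix a assume "a < dim_vec (lincomb_vec n k (\<lambda>i. v \<bullet>c e i) e)"
    then have a: "a < n" by (simp add: lincomb_vec_def)
    have "(P *\<^sub>v v) $ a = (\<Sum>b<n. \<Sum>i<k. cnj (e i $ b) * e i $ a * v $ b)"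
      using a v by (subst mat_mult_vec_index[of _ n n]) (auto simp: P_def sum_distrib_right)
    also have "\<dots> = (\<Sum>i<k. \<Sum>b<n. cnj (e i $ b) * e i $ a * v $ b)" by (rule sum.swap)
    also have "\<dots> = lincomb_vec n k (\<lambda>i. v \<bullet>c e i) e $ a"
      using a e v unfolding lincomb_vec_def
      by (auto simp: cip_sum[of _ n] sum_distrib_left algebra_simps intro!: sum.cong)
    finally show "(P *\<^sub>v v) $ a = lincomb_vec n k (\<lambda>i. v \<bullet>c e i) e $ a" .
  qed (simp add: P_def lincomb_vec_def)
  have "P *\<^sub>v v \<in> T" if v: "v \<in> carrier_vec n" for v
    using P[OF v] lincomb_vec_in_subspace[OF T, of k e] eT by simp
  moreover have "(v - P *\<^sub>v v) \<bullet>c u = 0" if v: "v \<in> carrier_vec n" and u: "u \<in> T" for u v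
  proof -
    define w where "w = v - P *\<^sub>v v"
    have w: "w \<in> carrier_vec n" using v P[OF v] by (simp add: w_def)
    have uc: "u \<in> carrier_vec n" using u T by (auto simp: lin_subspace_def)
    have "u \<bullet>c w = (\<Sum>i<k. (u \<bullet>c e i) * (e i \<bullet>c w))"
      by (subst full[OF u], rule cip_lincomb_vec) (use e w in auto)
    also have "\<dots> = 0"
    proof (rule sum.neutral, intro ballI)
      fix i assume i: "i \<in> {..<k}"
      have "w \<bullet>c e i = 0" unfolding w_def P[OF v] using residual_orthogonal[OF o v, of i] i by simp
      then show "(u \<bullet>c e i) * (e i \<bullet>c w) = 0" using cip_cnj[of w n "e i"] w e i by simp
    qed
    finally show ?thesis using cip_cnj[OF uc w] by (simp add: w_def)
  qed
  ultimately show "\<exists>P. P \<in> carrier_mat n n \<and>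
     (\<forall>v\<in>carrier_vec n. P *\<^sub>v v \<in> T \<and> (\<forall>u\<in>T. (v - P *\<^sub>v v) \<bullet>c u = 0))"
    by (intro exI[of _ P]) (simp add: P_def)
next
  fix P Q :: "complex mat"
  assume P: "P \<in> carrier_mat n n \<and> (\<forall>v\<in>carrier_vec n. P *\<^sub>v v \<in> T \<and> (\<forall>u\<in>T. (v - P *\<^sub>v v) \<bullet>c u = 0))"
    and Q: "Q \<in> carrier_mat n n \<and> (\<forall>v\<in>carrier_vec n. Q *\<^sub>v v \<in> T \<and> (\<forall>u\<in>T. (v - Q *\<^sub>v v) \<bullet>c u = 0))"
  show "P = Q"
  proof (rule mat_eq_if_mult_vec_eq)
    fix v :: "complex vec" assume v: "v \<in> carrier_vec n"
    let ?d = "P *\<^sub>v v - Q *\<^sub>v v"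
    have c: "P *\<^sub>v v \<in> carrier_vec n" "Q *\<^sub>v v \<in> carrier_vec n" "?d \<in> carrier_vec n"
      using P Q v by auto
    have dT: "?d \<in> T" using P Q v lin_subspace_diff[OF T] by auto
    have "x - y = (v - y) - (v - x)" if "x \<in> carrier_vec n" "y \<in> carrier_vec n" for x y
      using that v by (intro eq_vecI) auto
    then have "?d = (v - Q *\<^sub>v v) - (v - P *\<^sub>v v)" using c by blast
    also have "(\<dots>) \<bullet>c ?d = 0" using P Q v dT c by (subst cip_minus_left[of _ n]) auto
    finally have "?d = 0\<^sub>v n" using orthogonal_to_self[OF c(3)] by simp
    then show "P *\<^sub>v v = Q *\<^sub>v v" using vec_diff_eq_0 c by blast
  qed (use P Q in auto)
qed

context
  fixes n T assumes T: "lin_subspace n T"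
begin

lemma proj_mat_carrier: "proj_mat n T \<in> carrier_mat n n"
  using theI'[OF proj_mat_exists1[OF T]] by (simp add: proj_mat_def)

lemma proj_mat_in: "v \<in> carrier_vec n \<Longrightarrow> proj_mat n T *\<^sub>v v \<in> T"
  using theI'[OF proj_mat_exists1[OF T]] by (simp add: proj_mat_def)

lemma proj_mat_residual:
  "v \<in> carrier_vec n \<Longrightarrow> u \<in> T \<Longrightarrow> (v - proj_mat n T *\<^sub>v v) \<bullet>c u = 0"
  using theI'[OF proj_mat_exists1[OF T]] by (simp add: proj_mat_def)

lemma proj_mat_fixes:
  assumes "v \<in> T"
  shows "proj_mat n T *\<^sub>v v = v"
proof -
  have v: "v \<in> carrier_vec n" using assms T by (auto simp: lin_subspace_def)
  have c: "proj_mat n T *\<^sub>v v \<in> carrier_vec n" using proj_mat_carrier v by auto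
  have "v - proj_mat n T *\<^sub>v v \<in> T" using lin_subspace_diff[OF T assms proj_mat_in[OF v]] .
  then have "v - proj_mat n T *\<^sub>v v = 0\<^sub>v n"
    using proj_mat_residual[OF v] c v by (intro orthogonal_to_self) auto
  then show ?thesis using vec_diff_eq_0[OF v c] by simp
qed

lemma proj_mat_contraction:
  assumes v: "v \<in> carrier_vec n"
  shows "vec_norm (proj_mat n T *\<^sub>v v) \<le> vec_norm v"
proof -
  have c: "proj_mat n T *\<^sub>v v \<in> carrier_vec n" using proj_mat_carrier v by auto
  have "(vec_norm (proj_mat n T *\<^sub>v v))\<^sup>2 \<le> (vec_norm v)\<^sup>2"
    using pythagoras[OF v c proj_mat_residual[OF v proj_mat_in[OF v]]] by simp
  then show ?thesis by (rule power2_le_imp_le) simp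
qed

lemma residual_in_orth_compl:
  assumes v: "v \<in> carrier_vec n"
  shows "v - proj_mat n T *\<^sub>v v \<in> orth_compl n T"
  using proj_mat_residual[OF v] proj_mat_carrier v by (auto simp: orth_compl_def)

lemma orth_compl_orth_compl_subset: "orth_compl n (orth_compl n T) \<subseteq> T"
proof
  fix w assume w: "w \<in> orth_compl n (orth_compl n T)"
  then have wc: "w \<in> carrier_vec n" by (simp add: orth_compl_def)
  let ?p = "proj_mat n T *\<^sub>v w"
  have p: "?p \<in> carrier_vec n" "?p \<in> T" using proj_mat_in wc proj_mat_carrier by auto
  have r: "w - ?p \<in> orth_compl n T" using residual_in_orth_compl[OF wc] .
  have rc: "w - ?p \<in> carrier_vec n" using wc p by auto
  have "?p \<bullet>c (w - ?p) = 0" using proj_mat_residual[OF wc p(2)] cip_cnj[OF rc p(1)] by simp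
  moreover have "w \<bullet>c (w - ?p) = 0" using w r by (simp add: orth_compl_def)
  ultimately have "(w - ?p) \<bullet>c (w - ?p) = 0" using cip_minus_left[OF wc p(1) rc] by simp
  then have "w = ?p" using vec_diff_eq_0[OF wc p(1)] orthogonal_to_self[OF rc] by simp
  then show "w \<in> T" using p(2) by simp
qed

end

lemma residual_orth_compl_in:
  assumes T: "lin_subspace n T" and v: "v \<in> carrier_vec n"
  shows "v - proj_mat n (orth_compl n T) *\<^sub>v v \<in> T"
proof -
  have "lin_subspace n (orth_compl n T)"
    using T by (intro lin_subspace_orth_compl) (auto simp: lin_subspace_def)
  from residual_in_orth_compl[OF this v] show ?thesis using orth_compl_orth_compl_subset[OF T] by blast
qed

section \<open>Hermitian matrices\<close>

text \<open>In an orthonormal basis of the invariant subspace the operator is given by a square matrix,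
  which has an eigenvector.\<close>

lemma hermitian_eigenvector_in_invariant_subspace:
  assumes A: "A \<in> carrier_mat n n"
    and herm: "\<And>x y. x \<in> carrier_vec n \<Longrightarrow> y \<in> carrier_vec n \<Longrightarrow> (A *\<^sub>v x) \<bullet>c y = x \<bullet>c (A *\<^sub>v y)"
    and T: "lin_subspace n T" and inv: "\<And>v. v \<in> T \<Longrightarrow> A *\<^sub>v v \<in> T"
    and ne: "u \<in> T" "u \<noteq> 0\<^sub>v n"
  shows "\<exists>x\<in>T. x \<noteq> 0\<^sub>v n \<and> (\<exists>\<mu>. A *\<^sub>v x = \<mu> \<cdot>\<^sub>v x)"
proof -
  obtain k f where o: "orthonormal n k f" and fT: "\<And>i. i < k \<Longrightarrow> f i \<in> T"
    and full: "\<And>v. v \<in> T \<Longrightarrow> v = lincomb_vec n k (\<lambda>i. v \<bullet>c f i) f"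
    using orthonormal_basis_of_subspace[OF T] by blast
  have f: "f i \<in> carrier_vec n" if "i < k" for i using o that by (auto simp: orthonormal_def)
  have Af: "A *\<^sub>v f i \<in> carrier_vec n" if "i < k" for i using A f[OF that] by auto
  have "k > 0"
  proof (rule ccontr)
    assume "\<not> k > 0"
    then have "u = 0\<^sub>v n" using full[OF ne(1)] by (auto simp: lincomb_vec_def)
    then show False using ne by simp
  qed
  define B where "B = mat k k (\<lambda>(i,j). (A *\<^sub>v f j) \<bullet>c f i)"
  have B: "B \<in> carrier_mat k k" by (simp add: B_def)
  from spectrum_non_empty[OF B \<open>k > 0\<close>] obtain \<mu> y where
    y: "y \<in> carrier_vec k" "y \<noteq> 0\<^sub>v k" "B *\<^sub>v y = \<mu> \<cdot>\<^sub>v y"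
    using B unfolding spectrum_def eigenvalue_def eigenvector_def by auto
  define x where "x = lincomb_vec n k (\<lambda>i. y $ i) f"
  have x: "x \<in> carrier_vec n" by (simp add: x_def)
  have xT: "x \<in> T" unfolding x_def by (rule lincomb_vec_in_subspace[OF T fT])
  have coeff: "(A *\<^sub>v x) \<bullet>c f i = \<mu> * y $ i" if i: "i < k" for i
  proof -
    have "(A *\<^sub>v x) \<bullet>c f i = x \<bullet>c (A *\<^sub>v f i)" using herm[OF x f[OF i]] .
    also have "\<dots> = (\<Sum>j<k. y $ j * (f j \<bullet>c (A *\<^sub>v f i)))"
      unfolding x_def using f Af[OF i] by (intro cip_lincomb_vec) auto
    also have "\<dots> = (\<Sum>j<k. B $$ (i,j) * y $ j)"
      using i herm f by (intro sum.cong) (auto simp: B_def)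
    also have "\<dots> = (B *\<^sub>v y) $ i" using mat_mult_vec_index[OF B y(1) i] by simp
    finally show ?thesis using y i by simp
  qed
  have "A *\<^sub>v x = lincomb_vec n k (\<lambda>i. (A *\<^sub>v x) \<bullet>c f i) f" by (rule full[OF inv[OF xT]])
  also have "\<dots> = lincomb_vec n k (\<lambda>i. \<mu> * y $ i) f"
    using coeff by (auto simp: lincomb_vec_def intro!: eq_vecI sum.cong)
  also have "\<dots> = \<mu> \<cdot>\<^sub>v x" by (auto simp: lincomb_vec_def x_def sum_distrib_left mult.assoc)
  finally have eig: "A *\<^sub>v x = \<mu> \<cdot>\<^sub>v x" .
  have "x \<noteq> 0\<^sub>v n"
  proof
    assume "x = 0\<^sub>v n"
    then have "y $ i = 0" if "i < k" for i
      using cip_lincomb_orthonormal[OF o that, of "\<lambda>i. y $ i"] f[OF that] by (simp add: x_def)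
    then show False using y by (auto intro!: eq_vecI)
  qed
  then show ?thesis using xT eig by blast
qed

lemma spectral_theorem:
  assumes A: "A \<in> carrier_mat n n"
    and herm: "\<And>x y. x \<in> carrier_vec n \<Longrightarrow> y \<in> carrier_vec n \<Longrightarrow> (A *\<^sub>v x) \<bullet>c y = x \<bullet>c (A *\<^sub>v y)"
  shows "\<exists>k e (ev::nat \<Rightarrow> real). orthonormal n k e \<and> (\<forall>i<k. A *\<^sub>v e i = of_real (ev i) \<cdot>\<^sub>v e i) \<and>
     (\<forall>v\<in>carrier_vec n. v = lincomb_vec n k (\<lambda>i. v \<bullet>c e i) e)"
proof -
  obtain k e where o: "orthonormal n k e" and "\<forall>i<k. \<exists>\<mu>. A *\<^sub>v e i = \<mu> \<cdot>\<^sub>v e i"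
    and max: "\<And>v. v \<in> carrier_vec n \<Longrightarrow> \<exists>\<mu>. A *\<^sub>v v = \<mu> \<cdot>\<^sub>v v \<Longrightarrow> vec_norm v = 1 \<Longrightarrow> \<exists>i<k. v \<bullet>c e i \<noteq> 0"
    using maximal_orthonormal_family[of n "\<lambda>v. \<exists>\<mu>. A *\<^sub>v v = \<mu> \<cdot>\<^sub>v v"] by blast
  then obtain \<mu> where \<mu>: "\<And>i. i < k \<Longrightarrow> A *\<^sub>v e i = \<mu> i \<cdot>\<^sub>v e i" by metis
  have e: "e i \<in> carrier_vec n" if "i < k" for i using o that by (auto simp: orthonormal_def)
  have real: "\<mu> i = of_real (Re (\<mu> i))" if i: "i < k" for i
  proof -
    have "(A *\<^sub>v e i) \<bullet>c e i = e i \<bullet>c (A *\<^sub>v e i)" using herm e[OF i] by blast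
    moreover have "e i \<bullet>c e i = 1" using o i by (simp add: orthonormal_def)
    ultimately have "\<mu> i = cnj (\<mu> i)"
      using e[OF i] \<mu>[OF i] by (simp add: cip_smult_left[of _ n] cip_smult_right[of _ n])
    then show ?thesis by (simp add: complex_eq_iff)
  qed
  define C where "C = {v \<in> carrier_vec n. \<forall>i<k. v \<bullet>c e i = 0}"
  have C: "lin_subspace n C"
    using e by (auto simp: lin_subspace_def C_def cip_add_left[of _ n] cip_smult_left[of _ n])
  have Cinv: "A *\<^sub>v v \<in> C" if "v \<in> C" for v
    using that A e by (auto simp: C_def herm \<mu> cip_smult_right[of _ n])
  have C0: "v = 0\<^sub>v n" if v: "v \<in> C" for v
  proof (rule ccontr)
    assume "v \<noteq> 0\<^sub>v n"
    then obtain x \<nu> where x: "x \<in> C" "x \<noteq> 0\<^sub>v n" "A *\<^sub>v x = \<nu> \<cdot>\<^sub>v x"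
      using hermitian_eigenvector_in_invariant_subspace[OF A herm C Cinv v] by blast
    have xc: "x \<in> carrier_vec n" using x by (simp add: C_def)
    obtain c where c: "vec_norm (c \<cdot>\<^sub>v x) = 1" using exists_unit_multiple[OF xc x(2)] by blast
    have "A *\<^sub>v (c \<cdot>\<^sub>v x) = \<nu> \<cdot>\<^sub>v (c \<cdot>\<^sub>v x)"
      using A xc x(3) by (simp add: mult_mat_vec smult_smult_assoc mult.commute)
    then have "\<exists>i<k. (c \<cdot>\<^sub>v x) \<bullet>c e i \<noteq> 0" by (intro max[OF _ _ c]) (use xc in auto)
    then obtain i where "i < k" "(c \<cdot>\<^sub>v x) \<bullet>c e i \<noteq> 0" by blast
    then show False using x(1) e by (simp add: C_def cip_smult_left[of _ n])
  qed
  have "v = lincomb_vec n k (\<lambda>i. v \<bullet>c e i) e" if v: "v \<in> carrier_vec n" for v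
  proof -
    have "v - lincomb_vec n k (\<lambda>i. v \<bullet>c e i) e \<in> C"
      using v residual_orthogonal[OF o v] by (simp add: C_def)
    then show ?thesis using C0 vec_diff_eq_0[OF v lincomb_vec_carrier] by blast
  qed
  then show ?thesis using o \<mu> real by (intro exI[of _ k] exI[of _ e] exI[of _ "\<lambda>i. Re (\<mu> i)"]) auto
qed

lemma spectral_action:
  fixes ev :: "nat \<Rightarrow> real"
  assumes A: "A \<in> carrier_mat n n"
    and herm: "\<And>x y. x \<in> carrier_vec n \<Longrightarrow> y \<in> carrier_vec n \<Longrightarrow> (A *\<^sub>v x) \<bullet>c y = x \<bullet>c (A *\<^sub>v y)"
    and o: "orthonormal n k e" and eig: "\<And>i. i < k \<Longrightarrow> A *\<^sub>v e i = of_real (ev i) \<cdot>\<^sub>v e i"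
    and full: "\<And>v. v \<in> carrier_vec n \<Longrightarrow> v = lincomb_vec n k (\<lambda>i. v \<bullet>c e i) e"
    and v: "v \<in> carrier_vec n"
  shows "A *\<^sub>v v = lincomb_vec n k (\<lambda>i. of_real (ev i) * (v \<bullet>c e i)) e"
    and "(A *\<^sub>v v) \<bullet>c v = of_real (\<Sum>i<k. ev i * (cmod (v \<bullet>c e i))\<^sup>2)"
proof -
  have e: "e i \<in> carrier_vec n" if "i < k" for i using o that by (auto simp: orthonormal_def)
  have "A *\<^sub>v v = lincomb_vec n k (\<lambda>i. (A *\<^sub>v v) \<bullet>c e i) e" using full[of "A *\<^sub>v v"] A v by auto
  also have "\<dots> = lincomb_vec n k (\<lambda>i. of_real (ev i) * (v \<bullet>c e i)) e"
    using herm[OF v] e v eig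
    by (auto simp: lincomb_vec_def cip_smult_right[of _ n] intro!: eq_vecI sum.cong)
  finally show *: "A *\<^sub>v v = lincomb_vec n k (\<lambda>i. of_real (ev i) * (v \<bullet>c e i)) e" .
  have "(A *\<^sub>v v) \<bullet>c v = (\<Sum>i<k. of_real (ev i) * (v \<bullet>c e i) * (e i \<bullet>c v))"
    unfolding * using e v by (intro cip_lincomb_vec) auto
  also have "\<dots> = (\<Sum>i<k. of_real (ev i * (cmod (v \<bullet>c e i))\<^sup>2))"
  proof (intro sum.cong refl)
    fix i assume "i \<in> {..<k}"
    then have "e i \<bullet>c v = cnj (v \<bullet>c e i)" using e v by (intro cip_cnj[of _ n]) auto
    then show "of_real (ev i) * (v \<bullet>c e i) * (e i \<bullet>c v) = of_real (ev i * (cmod (v \<bullet>c e i))\<^sup>2)"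
      by (simp add: complex_norm_square mult.assoc del: of_real_power)
  qed
  finally show "(A *\<^sub>v v) \<bullet>c v = of_real (\<Sum>i<k. ev i * (cmod (v \<bullet>c e i))\<^sup>2)" by simp
qed

lemma psd_factorization:
  assumes A: "A \<in> carrier_mat n n"
    and herm: "\<And>x y. x \<in> carrier_vec n \<Longrightarrow> y \<in> carrier_vec n \<Longrightarrow> (A *\<^sub>v x) \<bullet>c y = x \<bullet>c (A *\<^sub>v y)"
    and psd: "\<And>v. v \<in> carrier_vec n \<Longrightarrow> 0 \<le> Re ((A *\<^sub>v v) \<bullet>c v)"
  shows "\<exists>k E. E \<in> carrier_mat n k \<and> (\<forall>a<n. \<forall>b<n. A $$ (a,b) = (\<Sum>c<k. E $$ (a,c) * cnj (E $$ (b,c))))"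
proof -
  obtain k e and ev :: "nat \<Rightarrow> real" where o: "orthonormal n k e"
    and eig: "\<And>i. i < k \<Longrightarrow> A *\<^sub>v e i = of_real (ev i) \<cdot>\<^sub>v e i"
    and full: "\<And>v. v \<in> carrier_vec n \<Longrightarrow> v = lincomb_vec n k (\<lambda>i. v \<bullet>c e i) e"
    using spectral_theorem[OF A herm] by blast
  have e: "e i \<in> carrier_vec n" if "i < k" for i using o that by (auto simp: orthonormal_def)
  have pos: "0 \<le> ev i" if i: "i < k" for i
  proof -
    have "(A *\<^sub>v e i) \<bullet>c e i = of_real (ev i)"
      using eig[OF i] e[OF i] o i by (simp add: cip_smult_left[of _ n] orthonormal_def)
    then show ?thesis using psd[OF e[OF i]] by simp
  qed
  define E where "E = mat n k (\<lambda>(a,i). of_real (sqrt (ev i)) * e i $ a)"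
  have "A $$ (a,b) = (\<Sum>i<k. E $$ (a,i) * cnj (E $$ (b,i)))" if ab: "a < n" "b < n" for a b
  proof -
    have "A $$ (a,b) = (A *\<^sub>v unit_vec n b) $ a" using A ab by simp
    also have "A *\<^sub>v unit_vec n b = lincomb_vec n k (\<lambda>i. of_real (ev i) * (unit_vec n b \<bullet>c e i)) e"
      by (rule spectral_action(1)[OF A herm o eig full]) auto
    also have "\<dots> $ a = (\<Sum>i<k. of_real (ev i) * (unit_vec n b \<bullet>c e i) * e i $ a)"
      using ab by (simp add: lincomb_vec_def)
    also have "\<dots> = (\<Sum>i<k. E $$ (a,i) * cnj (E $$ (b,i)))"
    proof (intro sum.cong refl)
      fix i assume i: "i \<in> {..<k}"
      have "unit_vec n b \<bullet>c e i = cnj (e i $ b)" using e[of i] i ab by (simp add: scalar_prod_left_unit)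
      moreover have "complex_of_real (sqrt (ev i)) * of_real (sqrt (ev i)) = of_real (ev i)"
        using pos[of i] i by (simp flip: of_real_mult)
      ultimately show "of_real (ev i) * (unit_vec n b \<bullet>c e i) * e i $ a = E $$ (a,i) * cnj (E $$ (b,i))"
        using i ab by (simp add: E_def mult_ac)
    qed
    finally show ?thesis .
  qed
  then show ?thesis by (intro exI[of _ k] exI[of _ E]) (simp add: E_def)
qed

section \<open>The isometric subspace of a contraction\<close>

lemma mat_mult_vec_zero:
  fixes M :: "complex mat"
  assumes "M \<in> carrier_mat m n"
  shows "M *\<^sub>v 0\<^sub>v n = 0\<^sub>v m"
  using assms by (intro eq_vecI) auto

text \<open>For a contraction \<open>M\<close> this is the largest subspace on which \<open>M\<close> is isometric.\<close>

definition iso_space :: "complex mat \<Rightarrow> complex vec set" where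
  "iso_space M = {v \<in> carrier_vec (dim_col M). mat_adjoint M *\<^sub>v (M *\<^sub>v v) = v}"

context
  fixes M :: "complex mat" and m n :: nat
  assumes M: "M \<in> carrier_mat m n"
begin

lemma iso_space_lin_subspace: "lin_subspace n (iso_space M)"
  using M mat_adjoint_carrier[OF M] mat_mult_vec_zero[OF M] mat_mult_vec_zero[OF mat_adjoint_carrier[OF M]]
  by (auto simp: lin_subspace_def iso_space_def mult_add_distrib_mat_vec[of _ m n]
      mult_add_distrib_mat_vec[of _ n m] mult_mat_vec[of _ m n] mult_mat_vec[of _ n m])

lemma iso_space_cip:
  assumes s: "s \<in> iso_space M" and v: "v \<in> carrier_vec n"
  shows "(M *\<^sub>v s) \<bullet>c (M *\<^sub>v v) = s \<bullet>c v"
proof -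
  have sc: "s \<in> carrier_vec n" using s M by (auto simp: iso_space_def)
  have c: "M *\<^sub>v s \<in> carrier_vec m" "M *\<^sub>v v \<in> carrier_vec m" using M sc v by auto
  have "(M *\<^sub>v s) \<bullet>c (M *\<^sub>v v) = cnj ((M *\<^sub>v v) \<bullet>c (M *\<^sub>v s))" using c by (intro cip_cnj) auto
  also have "(M *\<^sub>v v) \<bullet>c (M *\<^sub>v s) = v \<bullet>c s"
    using s cip_adjoint[OF M v c(1)] by (simp add: iso_space_def)
  finally show ?thesis using cip_cnj[OF v sc] by simp
qed

lemma iso_space_norm:
  assumes "s \<in> iso_space M"
  shows "vec_norm (M *\<^sub>v s) = vec_norm s"
proof -
  have s: "s \<in> carrier_vec n" using assms M by (auto simp: iso_space_def)
  have "complex_of_real ((vec_norm (M *\<^sub>v s))\<^sup>2) = of_real ((vec_norm s)\<^sup>2)"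
    using iso_space_cip[OF assms s] cip_self[OF s] cip_self[of "M *\<^sub>v s" m] M s by simp
  then show ?thesis unfolding of_real_eq_iff by (simp add: power2_eq_iff_nonneg)
qed

lemma gram_spectral:
  assumes contr: "\<And>v. v \<in> carrier_vec n \<Longrightarrow> vec_norm (M *\<^sub>v v) \<le> vec_norm v"
  obtains k e and ev :: "nat \<Rightarrow> real" where "orthonormal n k e" "\<And>i. i < k \<Longrightarrow> 0 \<le> ev i \<and> ev i \<le> 1"
    "\<And>v. v \<in> carrier_vec n \<Longrightarrow> v = lincomb_vec n k (\<lambda>i. v \<bullet>c e i) e"
    "\<And>v. v \<in> carrier_vec n \<Longrightarrow>
       mat_adjoint M *\<^sub>v (M *\<^sub>v v) = lincomb_vec n k (\<lambda>i. of_real (ev i) * (v \<bullet>c e i)) e"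
    "\<And>v. v \<in> carrier_vec n \<Longrightarrow> (vec_norm (M *\<^sub>v v))\<^sup>2 = (\<Sum>i<k. ev i * (cmod (v \<bullet>c e i))\<^sup>2)"
    "\<And>v. v \<in> carrier_vec n \<Longrightarrow> (vec_norm v)\<^sup>2 = (\<Sum>i<k. (cmod (v \<bullet>c e i))\<^sup>2)"
    "\<And>i. i < k \<Longrightarrow> ev i = 1 \<Longrightarrow> e i \<in> iso_space M"
proof -
  note M' = mat_adjoint_carrier[OF M]
  define A where "A = mat_adjoint M * M"
  have A: "A \<in> carrier_mat n n" using M M' by (simp add: A_def)
  have Av: "A *\<^sub>v v = mat_adjoint M *\<^sub>v (M *\<^sub>v v)" if "v \<in> carrier_vec n" for v
    unfolding A_def using M M' that by (intro assoc_mult_mat_vec) auto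
  have quad: "x \<bullet>c (A *\<^sub>v y) = (M *\<^sub>v x) \<bullet>c (M *\<^sub>v y)" if "x \<in> carrier_vec n" "y \<in> carrier_vec n" for x y
    using cip_adjoint[OF M that(1), of "M *\<^sub>v y"] Av[OF that(2)] M that by simp
  have herm: "(A *\<^sub>v x) \<bullet>c y = x \<bullet>c (A *\<^sub>v y)" if xy: "x \<in> carrier_vec n" "y \<in> carrier_vec n" for x y
  proof -
    have "(A *\<^sub>v x) \<bullet>c y = cnj (y \<bullet>c (A *\<^sub>v x))" using A xy by (intro cip_cnj[of _ n]) auto
    also have "\<dots> = cnj ((M *\<^sub>v y) \<bullet>c (M *\<^sub>v x))" using quad xy by simp
    also have "\<dots> = (M *\<^sub>v x) \<bullet>c (M *\<^sub>v y)" using cip_cnj[of "M *\<^sub>v y" m "M *\<^sub>v x"] M xy by simp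
    finally show ?thesis using quad xy by simp
  qed
  obtain k e and ev :: "nat \<Rightarrow> real" where o: "orthonormal n k e"
    and eig: "\<And>i. i < k \<Longrightarrow> A *\<^sub>v e i = of_real (ev i) \<cdot>\<^sub>v e i"
    and full: "\<And>v. v \<in> carrier_vec n \<Longrightarrow> v = lincomb_vec n k (\<lambda>i. v \<bullet>c e i) e"
    using spectral_theorem[OF A herm] by blast
  have e: "e i \<in> carrier_vec n" if "i < k" for i using o that by (auto simp: orthonormal_def)
  have act1: "A *\<^sub>v v = lincomb_vec n k (\<lambda>i. of_real (ev i) * (v \<bullet>c e i)) e"
    and act2: "(A *\<^sub>v v) \<bullet>c v = of_real (\<Sum>i<k. ev i * (cmod (v \<bullet>c e i))\<^sup>2)"
    if "v \<in> carrier_vec n" for v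
    using spectral_action[OF A herm o eig full that] by blast+
  have Mn: "(vec_norm (M *\<^sub>v v))\<^sup>2 = (\<Sum>i<k. ev i * (cmod (v \<bullet>c e i))\<^sup>2)" if v: "v \<in> carrier_vec n" for v
  proof -
    have "of_real ((vec_norm (M *\<^sub>v v))\<^sup>2) = (M *\<^sub>v v) \<bullet>c (M *\<^sub>v v)"
      using cip_self[of "M *\<^sub>v v" m] M v by simp
    also have "\<dots> = (A *\<^sub>v v) \<bullet>c v" using quad herm v by simp
    also have "\<dots> = of_real (\<Sum>i<k. ev i * (cmod (v \<bullet>c e i))\<^sup>2)" by (rule act2[OF v])
    finally show ?thesis unfolding of_real_eq_iff .
  qed
  have vn: "(vec_norm v)\<^sup>2 = (\<Sum>i<k. (cmod (v \<bullet>c e i))\<^sup>2)" if v: "v \<in> carrier_vec n" for v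
    using norm_lincomb_orthonormal[OF o, of "\<lambda>i. v \<bullet>c e i"] full[OF v] by simp
  have bounds: "0 \<le> ev i \<and> ev i \<le> 1" if i: "i < k" for i
  proof -
    have *: "(cmod (e i \<bullet>c e j))\<^sup>2 = (if i = j then 1 else 0)" if "j < k" for j
      using o i that by (auto simp: orthonormal_def)
    have "(vec_norm (M *\<^sub>v e i))\<^sup>2 = (\<Sum>j<k. if i = j then ev j else 0)"
      unfolding Mn[OF e[OF i]] by (intro sum.cong) (auto simp: *)
    moreover have "(vec_norm (e i))\<^sup>2 = (\<Sum>j<k. if i = j then 1 else 0)"
      unfolding vn[OF e[OF i]] by (intro sum.cong) (auto simp: *)
    ultimately have "(vec_norm (M *\<^sub>v e i))\<^sup>2 = ev i" "(vec_norm (e i))\<^sup>2 = 1"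
      using i by simp_all
    moreover have "(vec_norm (M *\<^sub>v e i))\<^sup>2 \<le> (vec_norm (e i))\<^sup>2"
      using contr[OF e[OF i]] by (intro power_mono) auto
    ultimately show ?thesis by (metis zero_le_power2)
  qed
  show thesis
  proof (rule that[OF o bounds full _ Mn vn])
    show "mat_adjoint M *\<^sub>v (M *\<^sub>v v) = lincomb_vec n k (\<lambda>i. of_real (ev i) * (v \<bullet>c e i)) e"
      if "v \<in> carrier_vec n" for v
      using act1[OF that] Av[OF that] by simp
    show "e i \<in> iso_space M" if "i < k" "ev i = 1" for i
      using eig[OF that(1)] Av[OF e[OF that(1)]] e[OF that(1)] that(2) M by (simp add: iso_space_def)
  qed
qed

lemma iso_space_if_norm_eq:
  assumes contr: "\<And>v. v \<in> carrier_vec n \<Longrightarrow> vec_norm (M *\<^sub>v v) \<le> vec_norm v"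
    and v: "v \<in> carrier_vec n" and eq: "vec_norm (M *\<^sub>v v) = vec_norm v"
  shows "v \<in> iso_space M"
proof -
  obtain k e and ev :: "nat \<Rightarrow> real" where b: "\<And>i. i < k \<Longrightarrow> 0 \<le> ev i \<and> ev i \<le> 1"
    and full: "v = lincomb_vec n k (\<lambda>i. v \<bullet>c e i) e"
    and act: "mat_adjoint M *\<^sub>v (M *\<^sub>v v) = lincomb_vec n k (\<lambda>i. of_real (ev i) * (v \<bullet>c e i)) e"
    and n1: "(vec_norm (M *\<^sub>v v))\<^sup>2 = (\<Sum>i<k. ev i * (cmod (v \<bullet>c e i))\<^sup>2)"
    and n2: "(vec_norm v)\<^sup>2 = (\<Sum>i<k. (cmod (v \<bullet>c e i))\<^sup>2)"
    by (rule gram_spectral[OF contr]) (use v in blast)+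
  have "(\<Sum>i<k. (1 - ev i) * (cmod (v \<bullet>c e i))\<^sup>2) = 0"
    using n1 n2 eq by (simp add: left_diff_distrib sum_subtractf)
  then have "\<forall>i\<in>{..<k}. (1 - ev i) * (cmod (v \<bullet>c e i))\<^sup>2 = 0"
    using b by (subst (asm) sum_nonneg_eq_0_iff) auto
  then have "of_real (ev i) * (v \<bullet>c e i) = v \<bullet>c e i" if "i < k" for i using that by auto
  then have "mat_adjoint M *\<^sub>v (M *\<^sub>v v) = lincomb_vec n k (\<lambda>i. v \<bullet>c e i) e"
    unfolding act by (auto simp: lincomb_vec_def intro!: eq_vecI sum.cong)
  then show ?thesis using full v M by (simp add: iso_space_def)
qed

lemma strict_contraction_off_iso_space:
  assumes contr: "\<And>v. v \<in> carrier_vec n \<Longrightarrow> vec_norm (M *\<^sub>v v) \<le> vec_norm v"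
  shows "\<exists>c\<ge>0. c < 1 \<and> (\<forall>v\<in>orth_compl n (iso_space M). vec_norm (M *\<^sub>v v) \<le> c * vec_norm v)"
proof -
  obtain k e and ev :: "nat \<Rightarrow> real" where o: "orthonormal n k e"
    and b: "\<And>i. i < k \<Longrightarrow> 0 \<le> ev i \<and> ev i \<le> 1"
    and "\<And>v. v \<in> carrier_vec n \<Longrightarrow> v = lincomb_vec n k (\<lambda>i. v \<bullet>c e i) e"
    and "\<And>v. v \<in> carrier_vec n \<Longrightarrow>
       mat_adjoint M *\<^sub>v (M *\<^sub>v v) = lincomb_vec n k (\<lambda>i. of_real (ev i) * (v \<bullet>c e i)) e"
    and n1: "\<And>v. v \<in> carrier_vec n \<Longrightarrow> (vec_norm (M *\<^sub>v v))\<^sup>2 = (\<Sum>i<k. ev i * (cmod (v \<bullet>c e i))\<^sup>2)"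
    and n2: "\<And>v. v \<in> carrier_vec n \<Longrightarrow> (vec_norm v)\<^sup>2 = (\<Sum>i<k. (cmod (v \<bullet>c e i))\<^sup>2)"
    and iso: "\<And>i. i < k \<Longrightarrow> ev i = 1 \<Longrightarrow> e i \<in> iso_space M"
    by (rule gram_spectral, erule contr, (rule that; assumption))
  define c where "c = Max (insert 0 (ev ` {i \<in> {..<k}. ev i < 1}))"
  have fin: "finite (insert 0 (ev ` {i \<in> {..<k}. ev i < 1}))" by simp
  have c0: "0 \<le> c" unfolding c_def by (rule Max_ge) auto
  have c1: "c < 1" unfolding c_def by (subst Max_less_iff) auto
  have cmax: "ev i \<le> c" if "i < k" "ev i < 1" for i unfolding c_def using that by (intro Max_ge) auto
  have "vec_norm (M *\<^sub>v v) \<le> sqrt c * vec_norm v" if vO: "v \<in> orth_compl n (iso_space M)" for v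
  proof -
    have v: "v \<in> carrier_vec n" using vO by (simp add: orth_compl_def)
    have "(vec_norm (M *\<^sub>v v))\<^sup>2 \<le> (\<Sum>i<k. c * (cmod (v \<bullet>c e i))\<^sup>2)"
      unfolding n1[OF v]
    proof (rule sum_mono)
      fix i assume i: "i \<in> {..<k}"
      show "ev i * (cmod (v \<bullet>c e i))\<^sup>2 \<le> c * (cmod (v \<bullet>c e i))\<^sup>2"
      proof (cases "ev i = 1")
        case True
        then have "v \<bullet>c e i = 0" using vO iso[of i] i by (simp add: orth_compl_def)
        then show ?thesis by simp
      next
        case False
        then have "ev i \<le> c" using b[of i] i by (intro cmax) auto
        then show ?thesis by (intro mult_right_mono) auto
      qed
    qed
    also have "\<dots> = (sqrt c * vec_norm v)\<^sup>2"
      using c0 by (simp add: power_mult_distrib n2[OF v] sum_distrib_left)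
    finally show ?thesis by (rule power2_le_imp_le) (simp add: c0)
  qed
  then show ?thesis using c0 c1 by (intro exI[of _ "sqrt c"]) auto
qed

end

section \<open>Tensor products and slices\<close>

lemma sum_blocks:
  fixes F :: "nat \<Rightarrow> 'a::comm_monoid_add"
  shows "(\<Sum>k<a * N. F k) = (\<Sum>p<a. \<Sum>m<N. F (p * N + m))"
proof (induction a)
  case (Suc a)
  have "(\<Sum>k<Suc a * N. F k) = (\<Sum>k<a * N. F k) + (\<Sum>k=a * N..<a * N + N. F k)"
    by (simp add: lessThan_atLeast0 sum.atLeastLessThan_concat add.commute)
  also have "(\<Sum>k=a * N..<a * N + N. F k) = (\<Sum>m<N. F (a * N + m))"
    using sum.shift_bounds_nat_ivl[of F 0 "a * N" N] by (simp add: lessThan_atLeast0 add.commute)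
  finally show ?case using Suc by simp
qed simp

lemma block_index_less:
  assumes "p < a" "m < (N::nat)"
  shows "p * N + m < a * N"
proof -
  have "p * N + m < Suc p * N" using assms by simp
  also have "\<dots> \<le> a * N" using assms by (intro mult_right_mono) auto
  finally show ?thesis .
qed

lemma block_index_cases:
  assumes "k < a * (N::nat)"
  obtains p m where "k = p * N + m" "p < a" "m < N"
proof
  have "N > 0" using assms by (cases N) auto
  then show "k mod N < N" by simp
  show "k = k div N * N + k mod N" by simp
  show "k div N < a" using assms by (simp add: less_mult_imp_div_less)
qed

text \<open>A vector of \<open>\<complex>\<^sup>n \<otimes> \<complex>\<^sup>N\<close> is \<open>\<Sum>\<^sub>m v\<^sub>m \<otimes> e\<^sub>m\<close> for unique \<open>v\<^sub>m \<in> \<complex>\<^sup>n\<close>, its slices.\<close>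

definition slice :: "nat \<Rightarrow> nat \<Rightarrow> complex vec \<Rightarrow> nat \<Rightarrow> complex vec" where
  "slice n N v m = vec n (\<lambda>p. v $ (p * N + m))"

lemma slice_carrier [simp]: "slice n N v m \<in> carrier_vec n"
  by (simp add: slice_def)

lemma slice_index [simp]: "p < n \<Longrightarrow> slice n N v m $ p = v $ (p * N + m)"
  by (simp add: slice_def)

lemma slice_add:
  assumes "x \<in> carrier_vec (n * N)" "y \<in> carrier_vec (n * N)" "m < N"
  shows "slice n N (x + y) m = slice n N x m + slice n N y m"
  using assms by (intro eq_vecI) (auto simp: slice_def block_index_less)

lemma slice_smult:
  assumes "x \<in> carrier_vec (n * N)" "m < N"
  shows "slice n N (c \<cdot>\<^sub>v x) m = c \<cdot>\<^sub>v slice n N x m"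
  using assms by (intro eq_vecI) (auto simp: slice_def block_index_less)

lemma slice_zero:
  assumes "m < N"
  shows "slice n N (0\<^sub>v (n * N)) m = 0\<^sub>v n"
  using assms by (intro eq_vecI) (auto simp: slice_def block_index_less)

lemma cip_slices:
  assumes "x \<in> carrier_vec (n * N)" "y \<in> carrier_vec (n * N)"
  shows "x \<bullet>c y = (\<Sum>m<N. slice n N x m \<bullet>c slice n N y m)"
proof -
  have "x \<bullet>c y = (\<Sum>p<n. \<Sum>m<N. x $ (p * N + m) * cnj (y $ (p * N + m)))"
    unfolding cip_sum[OF assms] by (rule sum_blocks)
  also have "\<dots> = (\<Sum>m<N. \<Sum>p<n. x $ (p * N + m) * cnj (y $ (p * N + m)))" by (rule sum.swap)
  also have "\<dots> = (\<Sum>m<N. slice n N x m \<bullet>c slice n N y m)"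
    by (intro sum.cong refl) (subst cip_sum[OF slice_carrier slice_carrier], simp)
  finally show ?thesis .
qed

lemma norm_slices:
  assumes "x \<in> carrier_vec (n * N)"
  shows "(vec_norm x)\<^sup>2 = (\<Sum>m<N. (vec_norm (slice n N x m))\<^sup>2)"
proof -
  have "complex_of_real ((vec_norm x)\<^sup>2) = of_real (\<Sum>m<N. (vec_norm (slice n N x m))\<^sup>2)"
    unfolding cip_self[OF assms, symmetric] cip_slices[OF assms assms]
      of_real_sum cip_self[OF slice_carrier, symmetric] ..
  then show ?thesis unfolding of_real_eq_iff .
qed

lemma kron_carrier: "A \<in> carrier_mat r n \<Longrightarrow> B \<in> carrier_mat N K \<Longrightarrow> A \<otimes>\<^sub>k B \<in> carrier_mat (r * N) (n * K)"
  by (auto simp: kron_def)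

lemma kron_index:
  assumes "A \<in> carrier_mat r n" "B \<in> carrier_mat N K" "p < r" "q < n" "m < N" "l < K"
  shows "(A \<otimes>\<^sub>k B) $$ (p * N + m, q * K + l) = A $$ (p,q) * B $$ (m,l)"
  using assms by (simp add: kron_def block_index_less)

lemma kron_mult_vec_index:
  assumes A: "A \<in> carrier_mat r n" and B: "B \<in> carrier_mat N K" and v: "v \<in> carrier_vec (n * K)"
    and p: "p < r" and m: "m < N"
  shows "((A \<otimes>\<^sub>k B) *\<^sub>v v) $ (p * N + m) = (\<Sum>l<K. B $$ (m,l) * (A *\<^sub>v slice n K v l) $ p)"
proof -
  have "((A \<otimes>\<^sub>k B) *\<^sub>v v) $ (p * N + m) = (\<Sum>q<n. \<Sum>l<K. (A \<otimes>\<^sub>k B) $$ (p * N + m, q * K + l) * v $ (q * K + l))"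
    unfolding mat_mult_vec_index[OF kron_carrier[OF A B] v block_index_less[OF p m]] by (rule sum_blocks)
  also have "\<dots> = (\<Sum>l<K. \<Sum>q<n. (A \<otimes>\<^sub>k B) $$ (p * N + m, q * K + l) * v $ (q * K + l))"
    by (rule sum.swap)
  also have "\<dots> = (\<Sum>l<K. B $$ (m,l) * (A *\<^sub>v slice n K v l) $ p)"
  proof (intro sum.cong refl)
    fix l assume l: "l \<in> {..<K}"
    have "(\<Sum>q<n. (A \<otimes>\<^sub>k B) $$ (p * N + m, q * K + l) * v $ (q * K + l))
        = (\<Sum>q<n. B $$ (m,l) * (A $$ (p,q) * slice n K v l $ q))"
    proof (intro sum.cong refl)
      fix q assume q: "q \<in> {..<n}"
      have "(A \<otimes>\<^sub>k B) $$ (p * N + m, q * K + l) = A $$ (p,q) * B $$ (m,l)"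
        using p m l q by (intro kron_index[OF A B]) auto
      then show "(A \<otimes>\<^sub>k B) $$ (p * N + m, q * K + l) * v $ (q * K + l)
          = B $$ (m,l) * (A $$ (p,q) * slice n K v l $ q)" using q by (simp add: mult_ac)
    qed
    then show "(\<Sum>q<n. (A \<otimes>\<^sub>k B) $$ (p * N + m, q * K + l) * v $ (q * K + l))
        = B $$ (m,l) * (A *\<^sub>v slice n K v l) $ p"
      unfolding mat_mult_vec_index[OF A slice_carrier p] by (simp add: sum_distrib_left)
  qed
  finally show ?thesis .
qed

lemma kron_one_slice:
  assumes A: "A \<in> carrier_mat r n" and v: "v \<in> carrier_vec (n * N)" and m: "m < N"
  shows "slice r N ((A \<otimes>\<^sub>k 1\<^sub>m N) *\<^sub>v v) m = A *\<^sub>v slice n N v m"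
proof (rule eq_vecI)
  fix p assume "p < dim_vec (A *\<^sub>v slice n N v m)"
  then have p: "p < r" using A by simp
  have "(1\<^sub>m N $$ (m,l) * (A *\<^sub>v slice n N v l) $ p) = (if l = m then (A *\<^sub>v slice n N v l) $ p else 0)"
    if "l < N" for l using m that by simp
  then show "slice r N ((A \<otimes>\<^sub>k 1\<^sub>m N) *\<^sub>v v) m $ p = (A *\<^sub>v slice n N v m) $ p"
    using kron_mult_vec_index[OF A one_carrier_mat v p m] p m
    by (simp del: index_mult_mat_vec index_one_mat)
qed (use A in simp)

text \<open>\<open>T \<otimes> \<complex>\<^sup>N\<close> consists of the vectors all of whose slices lie in \<open>T\<close>.\<close>

lemma tensor_space_eq:
  assumes T: "lin_subspace n T"
  shows "tensor_space n T N = {v \<in> carrier_vec (n * N). \<forall>m<N. slice n N v m \<in> T}" (is "_ = ?W")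
proof
  interpret V: vec_space "TYPE(complex)" "n * N" .
  let ?G = "{kron_vec u y | u y. u \<in> T \<and> y \<in> carrier_vec N}"
  have Tc: "u \<in> carrier_vec n" if "u \<in> T" for u using T that by (auto simp: lin_subspace_def)
  have W: "lin_subspace (n * N) ?W"
    using T by (auto simp: lin_subspace_def slice_add slice_smult slice_zero)
  then have "submodule class_ring ?W V.V"
    using is_subspace_iff[where n="n * N" and T="?W"] by (simp add: VectorSpace.subspace_def)
  moreover have slice_kron: "slice n N (kron_vec u y) m = y $ m \<cdot>\<^sub>v u"
    if "u \<in> T" "y \<in> carrier_vec N" "m < N" for u y m
    using that Tc[OF that(1)] by (intro eq_vecI) (auto simp: slice_def kron_vec_def block_index_less)
  moreover have kc: "kron_vec u y \<in> carrier_vec (n * N)" if "u \<in> T" "y \<in> carrier_vec N" for u y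
    using that Tc[OF that(1)] by (auto simp: kron_vec_def)
  ultimately have "?G \<subseteq> ?W" using T by (auto simp: lin_subspace_def)
  then show "tensor_space n T N \<subseteq> ?W"
    unfolding tensor_space_def using \<open>submodule class_ring ?W V.V\<close> by (rule V.span_is_subset)
  show "?W \<subseteq> tensor_space n T N"
  proof
    fix v assume v: "v \<in> ?W"
    have G: "?G \<subseteq> carrier_vec (n * N)" using kc by auto
    have span: "lin_subspace (n * N) (V.span ?G)"
      using V.span_is_subspace[of ?G] G is_subspace_iff by simp
    have gen: "kron_vec (slice n N v m) (unit_vec N m) \<in> V.span ?G" if "m < N" for m
    proof -
      have "kron_vec (slice n N v m) (unit_vec N m) \<in> ?G" using v that unit_vec_carrier[of N m] by blast
      then show ?thesis using V.in_own_span G by blast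
    qed
    have "v = lincomb_vec (n * N) N (\<lambda>m. 1) (\<lambda>m. kron_vec (slice n N v m) (unit_vec N m))"
    proof (rule eq_vecI)
      fix k assume "k < dim_vec (lincomb_vec (n * N) N (\<lambda>m. 1) (\<lambda>m. kron_vec (slice n N v m) (unit_vec N m)))"
      then have k: "k < n * N" by (simp add: lincomb_vec_def)
      then obtain p l where pl: "k = p * N + l" "p < n" "l < N" by (rule block_index_cases)
      have "(\<Sum>m<N. kron_vec (slice n N v m) (unit_vec N m) $ k) = (\<Sum>m<N. if m = l then v $ k else 0)"
        using pl k by (intro sum.cong) (auto simp: kron_vec_def slice_def)
      then show "v $ k = lincomb_vec (n * N) N (\<lambda>m. 1) (\<lambda>m. kron_vec (slice n N v m) (unit_vec N m)) $ k"
        using k pl by (simp add: lincomb_vec_def)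
    qed (use v in \<open>auto simp: lincomb_vec_def\<close>)
    moreover have "lincomb_vec (n * N) N (\<lambda>m. 1) (\<lambda>m. kron_vec (slice n N v m) (unit_vec N m)) \<in> V.span ?G"
      by (rule lincomb_vec_in_subspace[OF span gen])
    ultimately show "v \<in> tensor_space n T N" by (simp add: tensor_space_def)
  qed
qed

lemma tensor_space_lin_subspace:
  assumes T: "lin_subspace n T"
  shows "lin_subspace (n * N) (tensor_space n T N)"
  using T unfolding tensor_space_eq[OF T]
  by (auto simp: lin_subspace_def slice_add slice_smult slice_zero)

section \<open>Evaluation of noncommutative series\<close>

lemma component_carrier: "X \<in> carrier_mat R N \<Longrightarrow> component X j \<in> carrier_mat N N"
  by (auto simp: component_def)

lemma component_index:
  "X \<in> carrier_mat R N \<Longrightarrow> m < N \<Longrightarrow> l < N \<Longrightarrow> component X j $$ (m,l) = X $$ (j * N + m, l)"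
  by (auto simp: component_def)

lemma word_eval_carrier:
  assumes "X \<in> carrier_mat R N"
  shows "word_eval X w \<in> carrier_mat N N"
  using assms by (induction w) (auto simp: word_eval_def component_def)

lemma word_eval_Nil: "X \<in> carrier_mat R N \<Longrightarrow> word_eval X [] = 1\<^sub>m N"
  by (simp add: word_eval_def)

lemma word_eval_Cons_index:
  assumes X: "X \<in> carrier_mat R N" and "m < N" "l < N"
  shows "word_eval X (j # w) $$ (m,l) = (\<Sum>k<N. X $$ (j * N + m, k) * word_eval X w $$ (k,l))"
proof -
  have "word_eval X (j # w) = component X j * word_eval X w" by (simp add: word_eval_def)
  then show ?thesis
    using assms word_eval_carrier[OF X, of w] component_carrier[OF X, of j]
    by (auto simp: scalar_prod_def lessThan_atLeast0 component_index[OF X] intro!: sum.cong)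
qed

lemma word_eval_smult_index:
  assumes X: "X \<in> carrier_mat (g * N) N" and "m < N" "l < N" "w \<in> nc_words g"
  shows "word_eval (c \<cdot>\<^sub>m X) w $$ (m,l) = c ^ length w * word_eval X w $$ (m,l)"
  using assms(2,4)
proof (induction w arbitrary: m)
  case Nil
  then show ?case using X by (simp add: word_eval_def)
next
  case (Cons j w)
  have cX: "c \<cdot>\<^sub>m X \<in> carrier_mat (g * N) N" using X by simp
  have j: "j * N + m < g * N" using Cons.prems by (intro block_index_less) auto
  have "word_eval (c \<cdot>\<^sub>m X) (j # w) $$ (m,l) = (\<Sum>k<N. c * X $$ (j * N + m, k) * (c ^ length w * word_eval X w $$ (k,l)))"
    unfolding word_eval_Cons_index[OF cX Cons.prems(1) assms(3)]
    using Cons X j by (intro sum.cong) auto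
  then show ?case
    unfolding word_eval_Cons_index[OF X Cons.prems(1) assms(3)]
    by (simp add: sum_distrib_left mult_ac)
qed

text \<open>The words of length \<open>\<alpha>\<close>.\<close>

definition words :: "nat \<Rightarrow> nat \<Rightarrow> nat list set" where
  "words g \<alpha> = {w \<in> nc_words g. length w = \<alpha>}"

lemma finite_words [simp]: "finite (words g \<alpha>)"
proof -
  have "words g \<alpha> = {w. set w \<subseteq> {..<g} \<and> length w = \<alpha>}" by (auto simp: words_def)
  then show ?thesis using finite_lists_length_eq[of "{..<g}" \<alpha>] by simp
qed

text \<open>The series with coefficients \<open>p\<close> is homogeneous of degree \<open>\<alpha>\<close>; so it is a polynomial.\<close>

definition homogeneous :: "nat \<Rightarrow> nat \<Rightarrow> nat \<Rightarrow> nat \<Rightarrow> (nat list \<Rightarrow> complex mat) \<Rightarrow> bool" where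
  "homogeneous g r c \<alpha> p \<longleftrightarrow> (\<forall>w\<in>nc_words g. p w \<in> carrier_mat r c \<and> (length w \<noteq> \<alpha> \<longrightarrow> p w = 0\<^sub>m r c))"

lemma homogeneous_nc_poly:
  assumes "homogeneous g r c \<alpha> p"
  shows "nc_poly g r c p"
  unfolding nc_poly_def
proof
  show "\<forall>w\<in>nc_words g. p w \<in> carrier_mat r c" using assms by (auto simp: homogeneous_def)
  show "finite {w \<in> nc_words g. p w \<noteq> 0\<^sub>m r c}"
    by (rule finite_subset[OF _ finite_words[of g \<alpha>]]) (use assms in \<open>auto simp: homogeneous_def words_def\<close>)
qed

lemma nc_poly_eval_carrier:
  "X \<in> carrier_mat R N \<Longrightarrow> nc_poly_eval g r c p X \<in> carrier_mat (r * N) (c * N)"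
  by (auto simp: nc_poly_eval_def)

lemma nc_poly_eval_index:
  assumes p: "homogeneous g r c \<alpha> p" and X: "X \<in> carrier_mat R N"
    and ij: "i < r" "j < c" "m < N" "l < N"
  shows "nc_poly_eval g r c p X $$ (i * N + m, j * N + l) = (\<Sum>w\<in>words g \<alpha>. p w $$ (i,j) * word_eval X w $$ (m,l))"
proof -
  let ?F = "\<lambda>w. (p w \<otimes>\<^sub>k word_eval X w) $$ (i * N + m, j * N + l)"
  have F: "?F w = p w $$ (i,j) * word_eval X w $$ (m,l)" if "w \<in> nc_words g" for w
    using p that ij word_eval_carrier[OF X] by (intro kron_index) (auto simp: homogeneous_def)
  have "nc_poly_eval g r c p X $$ (i * N + m, j * N + l) = (\<Sum>w\<in>{w \<in> nc_words g. p w \<noteq> 0\<^sub>m r c}. ?F w)"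
    using X ij by (simp add: nc_poly_eval_def block_index_less)
  also have "\<dots> = (\<Sum>w\<in>words g \<alpha>. ?F w)"
  proof (rule sum.mono_neutral_left)
    show "{w \<in> nc_words g. p w \<noteq> 0\<^sub>m r c} \<subseteq> words g \<alpha>" using p by (auto simp: homogeneous_def words_def)
    show "\<forall>w\<in>words g \<alpha> - {w \<in> nc_words g. p w \<noteq> 0\<^sub>m r c}. ?F w = 0"
    proof
      fix w assume w: "w \<in> words g \<alpha> - {w \<in> nc_words g. p w \<noteq> 0\<^sub>m r c}"
      then have "w \<in> nc_words g" "p w = 0\<^sub>m r c" by (auto simp: words_def)
      then show "?F w = 0" using F[of w] ij by simp
    qed
  qed simp
  also have "\<dots> = (\<Sum>w\<in>words g \<alpha>. p w $$ (i,j) * word_eval X w $$ (m,l))"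
    by (intro sum.cong refl F) (simp add: words_def)
  finally show ?thesis .
qed

lemma nc_poly_eval_smult:
  assumes p: "homogeneous g r c \<alpha> p" and X: "X \<in> carrier_mat (g * N) N"
  shows "nc_poly_eval g r c p (z \<cdot>\<^sub>m X) = z ^ \<alpha> \<cdot>\<^sub>m nc_poly_eval g r c p X"
proof (rule eq_matI)
  note C = nc_poly_eval_carrier[OF X, of g r c p]
  have zX: "z \<cdot>\<^sub>m X \<in> carrier_mat (g * N) N" using X by simp
  note Cz = nc_poly_eval_carrier[OF zX, of g r c p]
  fix i' j' assume "i' < dim_row (z ^ \<alpha> \<cdot>\<^sub>m nc_poly_eval g r c p X)" "j' < dim_col (z ^ \<alpha> \<cdot>\<^sub>m nc_poly_eval g r c p X)"
  then have "i' < r * N" "j' < c * N" using C by auto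
  then obtain i m j l where ij: "i' = i * N + m" "i < r" "m < N" "j' = j * N + l" "j < c" "l < N"
    by (metis block_index_cases)
  have "nc_poly_eval g r c p (z \<cdot>\<^sub>m X) $$ (i', j') = (\<Sum>w\<in>words g \<alpha>. p w $$ (i,j) * (z ^ \<alpha> * word_eval X w $$ (m,l)))"
    unfolding ij nc_poly_eval_index[OF p zX ij(2,5,3,6)]
    by (intro sum.cong refl) (use word_eval_smult_index[OF X ij(3,6)] in \<open>auto simp: words_def\<close>)
  also have "\<dots> = z ^ \<alpha> * nc_poly_eval g r c p X $$ (i', j')"
    unfolding ij nc_poly_eval_index[OF p X ij(2,5,3,6)] by (simp add: sum_distrib_left mult_ac)
  finally show "nc_poly_eval g r c p (z \<cdot>\<^sub>m X) $$ (i', j') = (z ^ \<alpha> \<cdot>\<^sub>m nc_poly_eval g r c p X) $$ (i', j')"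
    using C ij by (simp add: block_index_less)
qed (use X in \<open>auto simp: nc_poly_eval_def\<close>)

lemma homogeneous_hom_part:
  assumes "\<forall>w\<in>nc_words g. b w \<in> carrier_mat r c"
  shows "homogeneous g r c \<alpha> (hom_part r c b \<alpha>)"
  using assms by (auto simp: homogeneous_def hom_part_def)

lemma hom_part_eval_index:
  assumes "\<forall>w\<in>nc_words g. b w \<in> carrier_mat r c" "X \<in> carrier_mat R N"
    "i < r" "j < c" "m < N" "l < N"
  shows "nc_poly_eval g r c (hom_part r c b \<alpha>) X $$ (i * N + m, j * N + l)
    = (\<Sum>w\<in>words g \<alpha>. b w $$ (i,j) * word_eval X w $$ (m,l))"
  unfolding nc_poly_eval_index[OF homogeneous_hom_part[OF assms(1)] assms(2-)]
  by (intro sum.cong) (auto simp: hom_part_def words_def)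

section \<open>Convergence on the whole ball\<close>

text \<open>By the uniqueness of power series coefficients an expansion valid near 0 is the Taylor
  expansion, which converges on every disc where the function is holomorphic.\<close>

lemma power_series_continuation:
  fixes F :: "complex \<Rightarrow> complex"
  assumes hol: "F holomorphic_on ball 0 \<rho>" and d: "0 < \<delta>"
    and s: "\<And>z. cmod z < \<delta> \<Longrightarrow> (\<lambda>n. a n * z ^ n) sums F z" and w: "cmod w < \<rho>"
  shows "(\<lambda>n. a n * w ^ n) sums F w"
proof -
  have "conv_radius a \<ge> ereal \<delta>"
  proof (rule conv_radius_geI_ex')
    fix r :: real assume "0 < r" "ereal r < ereal \<delta>"
    then show "summable (\<lambda>n. a n * of_real r ^ n)" using s[of "of_real r"] sums_summable by auto
  qed
  then have "fps_conv_radius (Abs_fps a) \<ge> ereal \<delta>" by (simp add: fps_conv_radius_def)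
  then have "fps_conv_radius (Abs_fps a) > 0" using d by (metis ereal_less(2) less_le_trans)
  moreover have "eventually (\<lambda>z. eval_fps (Abs_fps a) z = F z) (nhds 0)"
  proof -
    have "eventually (\<lambda>z::complex. z \<in> ball 0 \<delta>) (nhds 0)" using d by (intro eventually_nhds_in_open) auto
    then show ?thesis
      by eventually_elim (use s in \<open>auto simp: eval_fps_def sums_iff\<close>)
  qed
  ultimately have "F has_fps_expansion Abs_fps a" by (simp add: has_fps_expansion_def)
  from has_fps_expansion_imp_sums_complex[OF this, of "ereal \<rho>" w] show ?thesis
    using hol w by simp
qed

text \<open>Holomorphy along complex lines through 0, entry by entry. This is all that is needed of
  analyticity.\<close>

definition radially_holomorphic :: "nat \<Rightarrow> nat \<Rightarrow> nat \<Rightarrow> (complex mat \<Rightarrow> complex mat) \<Rightarrow> bool" where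
  "radially_holomorphic g r c F \<longleftrightarrow> (\<forall>N\<ge>1. \<forall>X\<in>nc_mats g 1 N. \<forall>\<rho>>0.
     (\<forall>z. cmod z < \<rho> \<longrightarrow> z \<cdot>\<^sub>m X \<in> int_ball g N) \<longrightarrow>
     (\<forall>i<r * N. \<forall>j<c * N. (\<lambda>z. F (z \<cdot>\<^sub>m X) $$ (i,j)) holomorphic_on ball 0 \<rho>))"

lemma mat_norm_smult_le:
  assumes X: "X \<in> carrier_mat m n"
  shows "mat_norm (z \<cdot>\<^sub>m X) \<le> cmod z * mat_norm X"
proof (rule mat_norm_le[of _ m n])
  fix v :: "complex vec" assume v: "v \<in> carrier_vec n"
  have "vec_norm ((z \<cdot>\<^sub>m X) *\<^sub>v v) = cmod z * vec_norm (X *\<^sub>v v)"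
  proof -
    have "(z \<cdot>\<^sub>m X) *\<^sub>v v = z \<cdot>\<^sub>v (X *\<^sub>v v)" using X v by (intro eq_vecI) auto
    then show ?thesis by (simp add: vec_norm_smult)
  qed
  also have "\<dots> \<le> cmod z * (mat_norm X * vec_norm v)"
    using mat_norm_bound[OF X v] by (intro mult_left_mono) auto
  finally show "vec_norm ((z \<cdot>\<^sub>m X) *\<^sub>v v) \<le> cmod z * mat_norm X * vec_norm v" by (simp add: mult_ac)
qed (use X mat_norm_nonneg in auto)

lemma expansion_converges_on_ball:
  assumes F: "radially_holomorphic g r c F" and b: "nc_expansion g r c F b"
    and N: "N \<ge> 1" and X: "X \<in> int_ball g N" and FX: "F X \<in> nc_mats r c N"
  shows "mat_sums (r * N) (c * N) (\<lambda>\<alpha>. nc_poly_eval g r c (hom_part r c b \<alpha>) X) (F X)"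
proof -
  have Xc: "X \<in> carrier_mat (g * N) N" and X1: "mat_norm X < 1" using X by (auto simp: nc_nbhd_def nc_mats_def)
  have bc: "\<forall>w\<in>nc_words g. b w \<in> carrier_mat r c" using b by (simp add: nc_expansion_def)
  obtain \<epsilon> where \<epsilon>: "\<epsilon> > 0" and near: "\<And>Z. Z \<in> nc_nbhd g \<epsilon> N \<Longrightarrow>
      mat_sums (r * N) (c * N) (\<lambda>\<alpha>. nc_poly_eval g r c (hom_part r c b \<alpha>) Z) (F Z)"
    using b N by (auto simp: nc_expansion_def)
  \<comment> \<open>any \<open>q\<close> strictly between \<open>\<parallel>X\<parallel>\<close> and 1 makes \<open>z X\<close> stay in the ball for \<open>|z| < 1 / q\<close>, past \<open>z = 1\<close>\<close>
  define q where "q = (1 + mat_norm X) / 2"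
  have q: "0 < q" "q < 1" "mat_norm X < q" using X1 mat_norm_nonneg[of X] by (auto simp: q_def)
  define \<rho> where "\<rho> = 1 / q"
  have \<rho>: "\<rho> > 1" using q by (simp add: \<rho>_def)
  have zX: "mat_norm (z \<cdot>\<^sub>m X) < t" if "cmod z < t / q" "t > 0" for z t
  proof -
    have "mat_norm (z \<cdot>\<^sub>m X) \<le> cmod z * mat_norm X" by (rule mat_norm_smult_le[OF Xc])
    also have "\<dots> \<le> cmod z * q" using q by (intro mult_left_mono) auto
    also have "\<dots> < t" using that q by (simp add: field_simps)
    finally show ?thesis .
  qed
  have ball: "z \<cdot>\<^sub>m X \<in> int_ball g N" if "cmod z < \<rho>" for z
    using zX[of z 1] that Xc by (auto simp: nc_nbhd_def nc_mats_def \<rho>_def)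
  show ?thesis unfolding mat_sums_def
  proof (intro conjI allI impI)
    show "nc_poly_eval g r c (hom_part r c b \<alpha>) X \<in> carrier_mat (r * N) (c * N)" for \<alpha>
      by (rule nc_poly_eval_carrier[OF Xc])
    show "F X \<in> carrier_mat (r * N) (c * N)" using FX by (simp add: nc_mats_def)
    fix i j assume ij: "i < r * N" "j < c * N"
    let ?a = "\<lambda>\<alpha>. nc_poly_eval g r c (hom_part r c b \<alpha>) X $$ (i,j)"
    have hol: "(\<lambda>z. F (z \<cdot>\<^sub>m X) $$ (i,j)) holomorphic_on ball 0 \<rho>"
      using F N ball ij \<rho> Xc unfolding radially_holomorphic_def nc_mats_def by auto
    have "(\<lambda>\<alpha>. ?a \<alpha> * z ^ \<alpha>) sums F (z \<cdot>\<^sub>m X) $$ (i,j)" if z: "cmod z < \<epsilon> / q" for z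
    proof -
      have "z \<cdot>\<^sub>m X \<in> nc_nbhd g \<epsilon> N" using zX[OF z \<epsilon>] Xc by (auto simp: nc_nbhd_def nc_mats_def)
      from near[OF this] have "(\<lambda>\<alpha>. nc_poly_eval g r c (hom_part r c b \<alpha>) (z \<cdot>\<^sub>m X) $$ (i,j)) sums F (z \<cdot>\<^sub>m X) $$ (i,j)"
        using ij by (simp add: mat_sums_def)
      moreover have "nc_poly_eval g r c (hom_part r c b \<alpha>) (z \<cdot>\<^sub>m X) $$ (i,j) = ?a \<alpha> * z ^ \<alpha>" for \<alpha>
        using nc_poly_eval_smult[OF homogeneous_hom_part[OF bc] Xc, of \<alpha> z] nc_poly_eval_carrier[OF Xc, of g r c "hom_part r c b \<alpha>"] ij
        by (simp add: mult.commute)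
      ultimately show ?thesis by simp
    qed
    then have *: "\<forall>z. cmod z < \<epsilon> / q \<longrightarrow> (\<lambda>\<alpha>. ?a \<alpha> * z ^ \<alpha>) sums F (z \<cdot>\<^sub>m X) $$ (i,j)" by blast
    have "(\<lambda>\<alpha>. ?a \<alpha> * 1 ^ \<alpha>) sums F (1 \<cdot>\<^sub>m X) $$ (i,j)"
    proof (rule power_series_continuation[OF hol, where \<delta>="\<epsilon> / q" and a="?a" and w=1])
      show "(\<lambda>\<alpha>. ?a \<alpha> * z ^ \<alpha>) sums F (z \<cdot>\<^sub>m X) $$ (i,j)" if "cmod z < \<epsilon> / q" for z
        using * that by blast
    qed (use \<epsilon> q \<rho> in simp_all)
    moreover have "1 \<cdot>\<^sub>m X = X" by (intro eq_matI) auto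
    ultimately show "?a sums F X $$ (i,j)" by simp
  qed
qed

subsection \<open>Analyticity along complex lines\<close>

lemma bij_betw_one_dim: "bij_betw (\<lambda>x. \<lambda>i\<in>{..<1::nat}. x) UNIV ({..<1} \<rightarrow>\<^sub>E UNIV)"
  by (rule bij_betwI[where g="\<lambda>m. m 0"]) (auto simp: PiE_iff extensional_def fun_eq_iff)

lemma has_sum_one_dim:
  "(G has_sum s) ({..<1::nat} \<rightarrow>\<^sub>E UNIV) \<longleftrightarrow> ((\<lambda>n. G (\<lambda>i\<in>{..<1}. n)) has_sum s) UNIV"
  using has_sum_reindex_bij_betw[OF bij_betw_one_dim, of G s] by simp

text \<open>The disc of radius \<open>\<rho>\<close> around 0 as a subset of \<open>\<complex>\<^sup>1\<close>, whose points are functions on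
  \<open>{..<1}\<close>.\<close>

definition line_disc :: "real \<Rightarrow> (nat \<Rightarrow> complex) set" where
  "line_disc \<rho> = (\<lambda>z. \<lambda>i\<in>{..<1}. z) ` ball 0 \<rho>"

lemma mem_line_disc: "p \<in> line_disc \<rho> \<longleftrightarrow> p \<in> {..<1} \<rightarrow>\<^sub>E UNIV \<and> cmod (p 0) < \<rho>"
proof
  assume p: "p \<in> {..<1} \<rightarrow>\<^sub>E UNIV \<and> cmod (p 0) < \<rho>"
  then have "p = (\<lambda>i\<in>{..<1}. p 0)" by (auto simp: PiE_iff extensional_def fun_eq_iff)
  moreover have "p 0 \<in> ball 0 \<rho>" using p by simp
  ultimately show "p \<in> line_disc \<rho>" unfolding line_disc_def by (rule image_eqI)
next
  assume "p \<in> line_disc \<rho>"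
  then obtain x where x: "p = (\<lambda>i\<in>{..<1}. x)" "cmod x < \<rho>" by (auto simp: line_disc_def)
  then have "p \<in> {..<1} \<rightarrow>\<^sub>E UNIV" by (simp only: restrict_PiE_iff) simp
  then show "p \<in> {..<1} \<rightarrow>\<^sub>E UNIV \<and> cmod (p 0) < \<rho>" using x by simp
qed

lemma is_domain_line_disc:
  assumes "\<rho> > 0"
  shows "is_domain 1 (line_disc \<rho>)"
  unfolding is_domain_def
proof (intro conjI)
  show "line_disc \<rho> \<noteq> {}" using assms by (auto simp: line_disc_def)
  have "openin (Cn 1) {p \<in> topspace (Cn 1). p 0 \<in> ball 0 \<rho>}"
    unfolding Cn_def
    by (rule openin_continuous_map_preimage[OF continuous_map_product_projection[of 0]]) auto
  moreover have "{p \<in> topspace (Cn 1). p 0 \<in> ball 0 \<rho>} = line_disc \<rho>"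
    unfolding set_eq_iff mem_line_disc Cn_def topspace_product_topology by simp
  ultimately show "openin (Cn 1) (line_disc \<rho>)" by simp
  have "continuous_map euclidean (Cn 1) (\<lambda>z::complex. \<lambda>i\<in>{..<1}. z)"
    unfolding Cn_def by (auto simp: continuous_map_componentwise)
  moreover have "connectedin euclidean (ball (0::complex) \<rho>)" by simp
  ultimately show "connectedin (Cn 1) (line_disc \<rho>)"
    unfolding line_disc_def by (rule connectedin_continuous_map_image)
qed

lemma analytic_line_linear: "analytic_Cn 1 W (\<lambda>p. p 0 * x)"
  unfolding analytic_Cn_def
proof (intro ballI exI[of _ 1] conjI)
  fix p :: "nat \<Rightarrow> complex"
  let ?c = "\<lambda>m::nat\<Rightarrow>nat. if m 0 = 0 then p 0 * x else if m 0 = 1 then x else 0"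
  have *: "((\<lambda>m. ?c m * (\<Prod>i<1. (z i - p i) ^ m i)) has_sum z 0 * x) ({..<1} \<rightarrow>\<^sub>E UNIV)" for z
  proof -
    define G where "G = (\<lambda>n. ?c (\<lambda>i\<in>{..<1}. n) * (z 0 - p 0) ^ n)"
    have G: "G n = (if n = 0 then p 0 * x else if n = 1 then x * (z 0 - p 0) else 0)" for n
      by (simp add: G_def)
    have "(G has_sum z 0 * x) {0,1}" by (rule has_sum_finiteI) (simp_all add: G algebra_simps)
    moreover have "(G has_sum z 0 * x) {0,1} \<longleftrightarrow> (G has_sum z 0 * x) UNIV"
      by (rule has_sum_cong_neutral) (simp_all add: G)
    ultimately have "(G has_sum z 0 * x) UNIV" by simp
    then show ?thesis unfolding has_sum_one_dim G_def by simp
  qed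
  show "\<exists>c. \<forall>z\<in>W. (\<forall>i<1. cmod (z i - p i) < 1) \<longrightarrow>
      ((\<lambda>m. c m * (\<Prod>i<1. (z i - p i) ^ m i)) has_sum z 0 * x) ({..<1} \<rightarrow>\<^sub>E UNIV)"
    by (rule exI[of _ "?c"], intro ballI impI, rule *)
qed simp

lemma holomorphic_if_analytic_line:
  assumes an: "analytic_Cn 1 (line_disc \<rho>) G"
  shows "(\<lambda>z. G (\<lambda>i\<in>{..<1}. z)) holomorphic_on ball 0 \<rho>"
proof -
  have "\<exists>s>0. (\<lambda>z. G (\<lambda>i\<in>{..<1}. z)) holomorphic_on ball p s" if p: "p \<in> ball 0 \<rho>" for p
  proof -
    have "(\<lambda>i\<in>{..<1}. p) \<in> line_disc \<rho>" using p by (auto simp: line_disc_def)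
    from an[unfolded analytic_Cn_def, rule_format, OF this] obtain s c where s: "s > 0" and c: "\<And>z. z \<in> line_disc \<rho> \<Longrightarrow> (\<forall>i<1. cmod (z i - (\<lambda>i\<in>{..<1}. p) i) < s) \<Longrightarrow>
       ((\<lambda>m. c m * (\<Prod>i<1. (z i - (\<lambda>i\<in>{..<1}. p) i) ^ m i)) has_sum G z) ({..<1} \<rightarrow>\<^sub>E UNIV)"
      by blast
    define t where "t = min s (\<rho> - cmod p)"
    have t: "t > 0" using s p by (simp add: t_def)
    have "(\<lambda>z. G (\<lambda>i\<in>{..<1}. z)) holomorphic_on ball p t"
    proof (rule power_series_holomorphic)
      fix z assume "z \<in> ball p t"
      then have z: "cmod (z - p) < s" "cmod (z - p) < \<rho> - cmod p" by (auto simp: t_def dist_norm norm_minus_commute)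
      have "cmod z < \<rho>" using z(2) norm_triangle_sub[of z p] by simp
      then have "(\<lambda>i\<in>{..<1}. z) \<in> line_disc \<rho>" by (auto simp: line_disc_def)
      from c[OF this] z(1) have "((\<lambda>n. c (\<lambda>i\<in>{..<1}. n) * (z - p) ^ n) has_sum G (\<lambda>i\<in>{..<1}. z)) UNIV"
        unfolding has_sum_one_dim by simp
      then show "(\<lambda>n. c (\<lambda>i\<in>{..<1}. n) * (z - p) ^ n) sums G (\<lambda>i\<in>{..<1}. z)" by (rule has_sum_imp_sums)
    qed
    then show ?thesis using t by blast
  qed
  then have "(\<lambda>z. G (\<lambda>i\<in>{..<1}. z)) analytic_on ball 0 \<rho>" by (auto simp: analytic_on_def)
  then show ?thesis by (rule analytic_imp_holomorphic)
qed

lemma nc_analytic_radially_holomorphic: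
  assumes f: "nc_analytic g r c f"
  shows "radially_holomorphic g r c f"
  unfolding radially_holomorphic_def
proof (intro allI impI ballI)
  fix N X \<rho> i j
  assume N: "(1::nat) \<le> N" and X: "X \<in> nc_mats g 1 N" and \<rho>: "\<rho> > 0"
    and ball: "\<forall>z. cmod z < \<rho> \<longrightarrow> z \<cdot>\<^sub>m X \<in> int_ball g N" and ij: "i < r * N" "j < c * N"
  let ?a = "\<lambda>p::nat\<Rightarrow>complex. p 0 \<cdot>\<^sub>m X"
  have Xc: "X \<in> carrier_mat (g * N) N" using X by (simp add: nc_mats_def)
  have "?a ` line_disc \<rho> \<subseteq> int_ball g N" using ball by (auto simp: mem_line_disc)
  moreover have "mat_analytic 1 (line_disc \<rho>) (g * N) N ?a"
    unfolding mat_analytic_def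
  proof (intro allI impI)
    fix k l assume "k < g * N" "l < N"
    then have "(\<lambda>p. ?a p $$ (k,l)) = (\<lambda>p. p 0 * X $$ (k,l))" using Xc by auto
    then show "analytic_Cn 1 (line_disc \<rho>) (\<lambda>p. ?a p $$ (k,l))" using analytic_line_linear[of "line_disc \<rho>" "X $$ (k,l)"] by simp
  qed
  ultimately have "mat_analytic 1 (line_disc \<rho>) (r * N) (c * N) (f \<circ> ?a)"
    using f N is_domain_line_disc[OF \<rho>] unfolding nc_analytic_def by blast
  then have "analytic_Cn 1 (line_disc \<rho>) (\<lambda>p. f (p 0 \<cdot>\<^sub>m X) $$ (i,j))"
    using ij by (simp add: mat_analytic_def)
  from holomorphic_if_analytic_line[OF this] show "(\<lambda>z. f (z \<cdot>\<^sub>m X) $$ (i,j)) holomorphic_on ball 0 \<rho>" by simp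
qed

section \<open>A noncommutative Schwarz lemma\<close>

lemma sum_lessThan_add:
  fixes F :: "nat \<Rightarrow> 'a::comm_monoid_add"
  shows "(\<Sum>c<N + k. F c) = (\<Sum>c<N. F c) + (\<Sum>c<k. F (N + c))"
  by (induction k) (auto simp: add.assoc)

lemma sum_words_snoc:
  "(\<Sum>w\<in>words g (Suc k). F w) = (\<Sum>w\<in>words g k. \<Sum>j<g. F (w @ [j]))"
proof -
  have "bij_betw (\<lambda>(w,j). w @ [j]) (words g k \<times> {..<g}) (words g (Suc k))"
  proof (rule bij_betwI[where g="\<lambda>w. (butlast w, last w)"])
    show "(\<lambda>w. (butlast w, last w)) \<in> words g (Suc k) \<rightarrow> words g k \<times> {..<g}"
    proof
      fix w assume "w \<in> words g (Suc k)"
      then have w: "length w = Suc k" "set w \<subseteq> {..<g}" by (auto simp: words_def)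
      then have ne: "w \<noteq> []" by auto
      show "(butlast w, last w) \<in> words g k \<times> {..<g}"
        using w last_in_set[OF ne] in_set_butlastD[of _ w] by (auto simp: words_def)
    qed
    show "(case (butlast w, last w) of (w, j) \<Rightarrow> w @ [j]) = w" if "w \<in> words g (Suc k)" for w
    proof -
      have "w \<noteq> []" using that by (auto simp: words_def)
      then show ?thesis by simp
    qed
  qed (auto simp: words_def)
  from sum.reindex_bij_betw[OF this, of F] show ?thesis
    by (simp add: sum.cartesian_product case_prod_unfold)
qed

lemma nc_poly_eval_mult_vec:
  assumes p: "homogeneous g r c \<alpha> p" and X: "X \<in> carrier_mat R N"
    and v: "v \<in> carrier_vec (c * N)" and i: "i < r" and m: "m < N"
  shows "(nc_poly_eval g r c p X *\<^sub>v v) $ (i * N + m)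
    = (\<Sum>w\<in>words g \<alpha>. \<Sum>l<N. word_eval X w $$ (m,l) * (p w *\<^sub>v slice c N v l) $ i)"
proof -
  let ?E = "nc_poly_eval g r c p X"
  have pc: "p w \<in> carrier_mat r c" if "w \<in> words g \<alpha>" for w
    using p that by (auto simp: homogeneous_def words_def)
  have "(?E *\<^sub>v v) $ (i * N + m) = (\<Sum>j<c. \<Sum>l<N. ?E $$ (i * N + m, j * N + l) * v $ (j * N + l))"
    unfolding mat_mult_vec_index[OF nc_poly_eval_carrier[OF X] v block_index_less[OF i m]] by (rule sum_blocks)
  also have "\<dots> = (\<Sum>j<c. \<Sum>l<N. \<Sum>w\<in>words g \<alpha>. word_eval X w $$ (m,l) * (p w $$ (i,j) * slice c N v l $ j))"
  proof (intro sum.cong refl)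
    fix j l assume "j \<in> {..<c}" "l \<in> {..<N}"
    then have jl: "j < c" "l < N" by auto
    show "?E $$ (i * N + m, j * N + l) * v $ (j * N + l)
        = (\<Sum>w\<in>words g \<alpha>. word_eval X w $$ (m,l) * (p w $$ (i,j) * slice c N v l $ j))"
      unfolding nc_poly_eval_index[OF p X i jl(1) m jl(2)] slice_index[OF jl(1)]
      by (simp add: sum_distrib_left mult_ac)
  qed
  also have "\<dots> = (\<Sum>j<c. \<Sum>w\<in>words g \<alpha>. \<Sum>l<N. word_eval X w $$ (m,l) * (p w $$ (i,j) * slice c N v l $ j))"
    by (rule sum.cong[OF refl], rule sum.swap)
  also have "\<dots> = (\<Sum>w\<in>words g \<alpha>. \<Sum>j<c. \<Sum>l<N. word_eval X w $$ (m,l) * (p w $$ (i,j) * slice c N v l $ j))"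
    by (rule sum.swap)
  also have "\<dots> = (\<Sum>w\<in>words g \<alpha>. \<Sum>l<N. \<Sum>j<c. word_eval X w $$ (m,l) * (p w $$ (i,j) * slice c N v l $ j))"
    by (rule sum.cong[OF refl], rule sum.swap)
  also have "\<dots> = (\<Sum>w\<in>words g \<alpha>. \<Sum>l<N. word_eval X w $$ (m,l) * (p w *\<^sub>v slice c N v l) $ i)"
    using i by (intro sum.cong refl) (simp add: mat_mult_vec_index[OF pc slice_carrier] sum_distrib_left del: index_mult_mat_vec)
  finally show ?thesis .
qed

text \<open>The vector \<open>(I\<^sub>d \<otimes> Z\<^sub>j)\<^sub>j \<zeta>\<close>, where \<open>Z\<close> is the column of the \<open>N \<times> K\<close> matrices \<open>Z\<^sub>j\<close>.\<close>

definition column_apply :: "nat \<Rightarrow> nat \<Rightarrow> nat \<Rightarrow> nat \<Rightarrow> complex mat \<Rightarrow> complex vec \<Rightarrow> complex vec" where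
  "column_apply g d N K Z \<zeta> = vec (d * g * N)
     (\<lambda>k. \<Sum>c<K. Z $$ (k div N div d * N + k mod N, c) * \<zeta> $ (k div N mod d * K + c))"

lemma column_apply_carrier [simp]: "column_apply g d N K Z \<zeta> \<in> carrier_vec (d * g * N)"
  by (simp add: column_apply_def)

lemma column_apply_index:
  assumes "j < g" "q < d" "m < N"
  shows "column_apply g d N K Z \<zeta> $ ((j * d + q) * N + m) = (\<Sum>c<K. Z $$ (j * N + m, c) * \<zeta> $ (q * K + c))"
proof -
  have "j * d + q < d * g" using block_index_less[OF assms(1,2)] by (simp add: mult.commute)
  then show ?thesis
    using assms block_index_less[of "j * d + q" "d * g" m N] by (simp add: column_apply_def)
qed

lemma x_eval_carrier: "X \<in> carrier_mat R N \<Longrightarrow> x_eval g d X \<in> carrier_mat (d * g * N) (d * N)"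
  by (auto simp: x_eval_def)

lemma x_eval_mult_vec:
  assumes X: "X \<in> carrier_mat (g * N) N" and u: "u \<in> carrier_vec (d * N)"
  shows "x_eval g d X *\<^sub>v u = column_apply g d N N X u"
proof (rule eq_vecI)
  fix k assume "k < dim_vec (column_apply g d N N X u)"
  then have "k < (d * g) * N" by (simp add: column_apply_def)
  then obtain a m where k: "k = a * N + m" "a < d * g" "m < N" by (rule block_index_cases)
  from k(2) have "a < g * d" by (simp add: mult.commute)
  then obtain j q where a: "a = j * d + q" "j < g" "q < d" by (rule block_index_cases)
  have k': "k = j * (d * N) + (q * N + m)" using k a by (simp add: algebra_simps)
  have qm: "q * N + m < d * N" using a k by (intro block_index_less)
  have kl: "k < d * g * N" using block_index_less[OF k(2,3)] k(1) by simp
  have entry: "x_eval g d X $$ (k, q' * N + l) = (if q' = q then X $$ (j * N + m, l) else 0)"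
    if "q' < d" "l < N" for q' l
  proof -
    have "x_eval g d X $$ (k, q' * N + l) = (1\<^sub>m d \<otimes>\<^sub>k component X j) $$ (q * N + m, q' * N + l)"
      using X kl qm that block_index_less[OF that] unfolding x_eval_def k' by simp
    also have "\<dots> = 1\<^sub>m d $$ (q, q') * component X j $$ (m, l)"
      using a k that by (intro kron_index[OF one_carrier_mat component_carrier[OF X]]) auto
    finally show ?thesis using a k that component_index[OF X k(3) that(2)] by simp
  qed
  have "(x_eval g d X *\<^sub>v u) $ k = (\<Sum>q'<d. \<Sum>l<N. x_eval g d X $$ (k, q' * N + l) * u $ (q' * N + l))"
    unfolding mat_mult_vec_index[OF x_eval_carrier[OF X] u kl] by (rule sum_blocks)
  also have "\<dots> = (\<Sum>q'<d. if q' = q then (\<Sum>l<N. X $$ (j * N + m, l) * u $ (q * N + l)) else 0)"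
    by (intro sum.cong refl) (simp add: entry)
  also have "\<dots> = column_apply g d N N X u $ k"
    using a unfolding k(1) a(1) column_apply_index[OF a(2,3) k(3)] by simp
  finally show "(x_eval g d X *\<^sub>v u) $ k = column_apply g d N N X u $ k" .
qed (use X in \<open>auto simp: x_eval_def column_apply_def\<close>)

text \<open>The coefficient of \<open>w\<close> in the series \<open>Q\<close> with \<open>Q(x) x = \<Sum>\<^sub>w b\<^sub>w w\<close>, the sum being over the
  nonempty words: the row of the matrices
  \<open>b\<^bsub>w x\<^sub>0\<^esub>, \<dots>, b\<^bsub>w x\<^sub>g\<^sub>-\<^sub>1\<^esub>\<close>.\<close>

definition left_coeff :: "nat \<Rightarrow> nat \<Rightarrow> nat \<Rightarrow> (nat list \<Rightarrow> complex mat) \<Rightarrow> nat list \<Rightarrow> complex mat" where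
  "left_coeff g d' d b w = mat d' (d * g) (\<lambda>(p,c). b (w @ [c div d]) $$ (p, c mod d))"

text \<open>The homogeneous part of degree \<open>k\<close> of that series.\<close>

definition left_part :: "nat \<Rightarrow> nat \<Rightarrow> nat \<Rightarrow> (nat list \<Rightarrow> complex mat) \<Rightarrow> nat \<Rightarrow> nat list \<Rightarrow> complex mat" where
  "left_part g d' d b k w = (if length w = k then left_coeff g d' d b w else 0\<^sub>m d' (d * g))"

lemma left_coeff_carrier: "left_coeff g d' d b w \<in> carrier_mat d' (d * g)"
  by (simp add: left_coeff_def)

lemma left_coeff_index:
  assumes "p < d'" "j < g" "q < d"
  shows "left_coeff g d' d b w $$ (p, j * d + q) = b (w @ [j]) $$ (p,q)"
proof -
  have "j * d + q < d * g" using block_index_less[OF assms(2,3)] by (simp add: mult.commute)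
  then show ?thesis using assms by (simp add: left_coeff_def)
qed

lemma homogeneous_left_part: "homogeneous g d' (d * g) k (left_part g d' d b k)"
  by (auto simp: homogeneous_def left_part_def left_coeff_carrier)

lemma left_coeff_mult_column_apply:
  assumes b: "\<And>j. j < g \<Longrightarrow> b (w @ [j]) \<in> carrier_mat d' d" and p: "p < d'" and m: "m < N"
  shows "(left_coeff g d' d b w *\<^sub>v slice (d * g) N (column_apply g d N K Z \<zeta>) m) $ p
    = (\<Sum>j<g. \<Sum>c<K. Z $$ (j * N + m, c) * (b (w @ [j]) *\<^sub>v slice d K \<zeta> c) $ p)"
proof -
  let ?v = "column_apply g d N K Z \<zeta>"
  have dg: "j * d + q < d * g" if "j < g" "q < d" for j q
    using block_index_less[OF that] by (simp add: mult.commute)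
  have "(left_coeff g d' d b w *\<^sub>v slice (d * g) N ?v m) $ p
      = (\<Sum>k<g * d. left_coeff g d' d b w $$ (p, k) * slice (d * g) N ?v m $ k)"
    unfolding mat_mult_vec_index[OF left_coeff_carrier slice_carrier p] by (simp add: mult.commute)
  also have "\<dots> = (\<Sum>j<g. \<Sum>q<d. left_coeff g d' d b w $$ (p, j * d + q) * slice (d * g) N ?v m $ (j * d + q))"
    by (rule sum_blocks)
  also have "\<dots> = (\<Sum>j<g. \<Sum>q<d. \<Sum>c<K. Z $$ (j * N + m, c) * (b (w @ [j]) $$ (p,q) * slice d K \<zeta> c $ q))"
  proof (intro sum.cong refl)
    fix j q assume "j \<in> {..<g}" "q \<in> {..<d}"
    then have jq: "j < g" "q < d" by auto
    show "left_coeff g d' d b w $$ (p, j * d + q) * slice (d * g) N ?v m $ (j * d + q)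
        = (\<Sum>c<K. Z $$ (j * N + m, c) * (b (w @ [j]) $$ (p,q) * slice d K \<zeta> c $ q))"
      unfolding left_coeff_index[OF p jq] slice_index[OF dg[OF jq]] slice_index[OF jq(2)] column_apply_index[OF jq m]
      by (simp add: sum_distrib_left mult_ac)
  qed
  also have "\<dots> = (\<Sum>j<g. \<Sum>c<K. \<Sum>q<d. Z $$ (j * N + m, c) * (b (w @ [j]) $$ (p,q) * slice d K \<zeta> c $ q))"
    by (rule sum.cong[OF refl], rule sum.swap)
  also have "\<dots> = (\<Sum>j<g. \<Sum>c<K. Z $$ (j * N + m, c) * (b (w @ [j]) *\<^sub>v slice d K \<zeta> c) $ p)"
    using p by (intro sum.cong refl)
      (simp add: mat_mult_vec_index[OF b slice_carrier] sum_distrib_left del: index_mult_mat_vec)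
  finally show ?thesis .
qed

text \<open>If the top \<open>N\<close> rows of \<open>(w x\<^sub>j)(Y)\<close> are \<open>w(X) Z\<^sub>j\<close> then those of \<open>h\<^bsup>(k+1)\<^esup>(Y)\<close> are
  \<open>Q\<^bsup>(k)\<^esup>(X) (I \<otimes> Z\<^sub>j)\<^sub>j\<close>.\<close>

lemma hom_part_via_left_part:
  assumes bc: "\<forall>w\<in>nc_words g. b w \<in> carrier_mat d' d"
    and X: "X \<in> carrier_mat (g * N) N" and Y: "Y \<in> carrier_mat (g * K) K" and NK: "N \<le> K"
    and dil: "\<And>w j i c. w \<in> nc_words g \<Longrightarrow> j < g \<Longrightarrow> i < N \<Longrightarrow> c < K \<Longrightarrow>
      word_eval Y (w @ [j]) $$ (i,c) = (\<Sum>m<N. word_eval X w $$ (i,m) * Z $$ (j * N + m, c))"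
    and u: "\<zeta> \<in> carrier_vec (d * K)" and p: "p < d'" and i: "i < N"
  shows "(nc_poly_eval g d' d (hom_part d' d b (Suc k)) Y *\<^sub>v \<zeta>) $ (p * K + i)
    = (nc_poly_eval g d' (d * g) (left_part g d' d b k) X *\<^sub>v column_apply g d N K Z \<zeta>) $ (p * N + i)"
proof -
  have iK: "i < K" using i NK by simp
  have wj: "w @ [j] \<in> nc_words g" "w \<in> nc_words g" "length w = k" if "w \<in> words g k" "j < g" for w j
    using that by (auto simp: words_def)
  have "(nc_poly_eval g d' d (hom_part d' d b (Suc k)) Y *\<^sub>v \<zeta>) $ (p * K + i)
      = (\<Sum>w\<in>words g (Suc k). \<Sum>c<K. word_eval Y w $$ (i,c) * (hom_part d' d b (Suc k) w *\<^sub>v slice d K \<zeta> c) $ p)"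
    by (rule nc_poly_eval_mult_vec[OF homogeneous_hom_part[OF bc] Y u p iK])
  also have "\<dots> = (\<Sum>w\<in>words g k. \<Sum>j<g. \<Sum>c<K.
      word_eval Y (w @ [j]) $$ (i,c) * (hom_part d' d b (Suc k) (w @ [j]) *\<^sub>v slice d K \<zeta> c) $ p)"
    by (rule sum_words_snoc)
  also have "\<dots> = (\<Sum>w\<in>words g k. \<Sum>j<g. \<Sum>c<K. \<Sum>m<N.
      word_eval X w $$ (i,m) * (Z $$ (j * N + m, c) * (b (w @ [j]) *\<^sub>v slice d K \<zeta> c) $ p))"
    using i wj by (intro sum.cong refl) (simp add: dil hom_part_def sum_distrib_right mult.assoc del: index_mult_mat_vec)
  also have "\<dots> = (\<Sum>w\<in>words g k. \<Sum>m<N. \<Sum>j<g. \<Sum>c<K.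
      word_eval X w $$ (i,m) * (Z $$ (j * N + m, c) * (b (w @ [j]) *\<^sub>v slice d K \<zeta> c) $ p))"
  proof (rule sum.cong[OF refl])
    fix w
    let ?T = "\<lambda>j c m. word_eval X w $$ (i,m) * (Z $$ (j * N + m, c) * (b (w @ [j]) *\<^sub>v slice d K \<zeta> c) $ p)"
    have "(\<Sum>j<g. \<Sum>c<K. \<Sum>m<N. ?T j c m) = (\<Sum>j<g. \<Sum>m<N. \<Sum>c<K. ?T j c m)"
      by (rule sum.cong[OF refl], rule sum.swap)
    also have "\<dots> = (\<Sum>m<N. \<Sum>j<g. \<Sum>c<K. ?T j c m)" by (rule sum.swap)
    finally show "(\<Sum>j<g. \<Sum>c<K. \<Sum>m<N. ?T j c m) = (\<Sum>m<N. \<Sum>j<g. \<Sum>c<K. ?T j c m)" .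
  qed
  also have "\<dots> = (\<Sum>w\<in>words g k. \<Sum>m<N. word_eval X w $$ (i,m) *
      (left_coeff g d' d b w *\<^sub>v slice (d * g) N (column_apply g d N K Z \<zeta>) m) $ p)"
    using bc wj p by (intro sum.cong refl)
      (subst left_coeff_mult_column_apply, auto simp: sum_distrib_left simp del: index_mult_mat_vec)
  also have "\<dots> = (\<Sum>w\<in>words g k. \<Sum>m<N. word_eval X w $$ (i,m) *
      (left_part g d' d b k w *\<^sub>v slice (d * g) N (column_apply g d N K Z \<zeta>) m) $ p)"
    by (intro sum.cong refl) (simp add: left_part_def words_def)
  also have "\<dots> = (nc_poly_eval g d' (d * g) (left_part g d' d b k) X *\<^sub>v column_apply g d N K Z \<zeta>) $ (p * N + i)"
    by (rule nc_poly_eval_mult_vec[OF homogeneous_left_part X column_apply_carrier p i, symmetric])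
  finally show ?thesis .
qed

lemma word_eval_snoc_index:
  assumes X: "X \<in> carrier_mat (g * N) N" and "i < N" "c < N"
  shows "word_eval X (w @ [j]) $$ (i,c) = (\<Sum>m<N. word_eval X w $$ (i,m) * X $$ (j * N + m, c))"
  using assms(2)
proof (induction w arbitrary: i)
  case Nil
  have *: "(if i = m then 1 else 0) * X $$ (j * N + m, c) = (if i = m then X $$ (j * N + m, c) else 0)"
    "X $$ (j * N + i, m) * (if m = c then 1 else 0) = (if m = c then X $$ (j * N + i, m) else 0)" for m
    by auto
  show ?case
    using Nil assms(3) by (simp add: word_eval_Cons_index[OF X] word_eval_Nil[OF X] * cong: sum.cong_simp)
next
  case (Cons j' w)
  have "word_eval X ((j' # w) @ [j]) $$ (i,c) = (\<Sum>k<N. \<Sum>m<N. X $$ (j' * N + i, k) * (word_eval X w $$ (k,m) * X $$ (j * N + m, c)))"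
    using Cons by (simp add: word_eval_Cons_index[OF X _ assms(3)] sum_distrib_left)
  also have "\<dots> = (\<Sum>m<N. \<Sum>k<N. X $$ (j' * N + i, k) * (word_eval X w $$ (k,m) * X $$ (j * N + m, c)))"
    by (rule sum.swap)
  also have "\<dots> = (\<Sum>m<N. word_eval X (j' # w) $$ (i,m) * X $$ (j * N + m, c))"
    using Cons.prems by (intro sum.cong refl) (simp add: word_eval_Cons_index[OF X] sum_distrib_right mult.assoc)
  finally show ?case .
qed

corollary hom_part_eq_left_part_x_eval:
  assumes bc: "\<forall>w\<in>nc_words g. b w \<in> carrier_mat d' d"
    and X: "X \<in> carrier_mat (g * N) N" and u: "u \<in> carrier_vec (d * N)"
  shows "nc_poly_eval g d' d (hom_part d' d b (Suc k)) X *\<^sub>v u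
    = nc_poly_eval g d' (d * g) (left_part g d' d b k) X *\<^sub>v (x_eval g d X *\<^sub>v u)"
proof (rule eq_vecI)
  fix k' assume "k' < dim_vec (nc_poly_eval g d' (d * g) (left_part g d' d b k) X *\<^sub>v (x_eval g d X *\<^sub>v u))"
  then have "k' < d' * N" using X by (simp add: nc_poly_eval_def)
  then obtain p i where k': "k' = p * N + i" "p < d'" "i < N" by (rule block_index_cases)
  show "(nc_poly_eval g d' d (hom_part d' d b (Suc k)) X *\<^sub>v u) $ k'
    = (nc_poly_eval g d' (d * g) (left_part g d' d b k) X *\<^sub>v (x_eval g d X *\<^sub>v u)) $ k'"
    unfolding x_eval_mult_vec[OF X u] k'(1)
    by (rule hom_part_via_left_part[OF bc X X order.refl _ u k'(2,3)]) (rule word_eval_snoc_index[OF X])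
qed (simp add: nc_poly_eval_def)

subsection \<open>Coisometric dilation\<close>

lemma mult_adjoint_index:
  fixes A :: "complex mat"
  assumes A: "A \<in> carrier_mat n K" and u: "u \<in> carrier_vec n" and a: "a < n"
  shows "(A *\<^sub>v (mat_adjoint A *\<^sub>v u)) $ a = (\<Sum>b<n. (\<Sum>c<K. A $$ (a,c) * cnj (A $$ (b,c))) * u $ b)"
proof -
  note A' = mat_adjoint_carrier[OF A]
  have "(A *\<^sub>v (mat_adjoint A *\<^sub>v u)) $ a = (\<Sum>c<K. \<Sum>b<n. A $$ (a,c) * (cnj (A $$ (b,c)) * u $ b))"
    unfolding mat_mult_vec_index[OF A mult_mat_vec_carrier[OF A' u] a]
    by (intro sum.cong refl)
      (simp add: mat_mult_vec_index[OF A' u] mat_adjoint_index[OF A] sum_distrib_left del: index_mult_mat_vec)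
  also have "\<dots> = (\<Sum>b<n. (\<Sum>c<K. A $$ (a,c) * cnj (A $$ (b,c))) * u $ b)"
    by (subst sum.swap) (simp add: sum_distrib_right mult.assoc)
  finally show ?thesis .
qed

text \<open>A matrix of norm at most \<open>r\<close> is a block of some \<open>Z = [X E]\<close> with \<open>Z Z\<^sup>* = r\<^sup>2 I\<close>: factor
  the positive semidefinite matrix \<open>r\<^sup>2 I - X X\<^sup>*\<close> as \<open>E E\<^sup>*\<close>.\<close>

lemma coisometric_extension:
  assumes X: "X \<in> carrier_mat n N" and r: "mat_norm X \<le> r"
  obtains K Z where "N \<le> K" "Z \<in> carrier_mat n K"
    "\<And>a c. a < n \<Longrightarrow> c < N \<Longrightarrow> Z $$ (a,c) = X $$ (a,c)"
    "\<And>a b. a < n \<Longrightarrow> b < n \<Longrightarrow> (\<Sum>c<K. Z $$ (a,c) * cnj (Z $$ (b,c))) = (if a = b then of_real (r\<^sup>2) else 0)"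
proof -
  have r0: "0 \<le> r" using r mat_norm_nonneg[of X] by linarith
  note X' = mat_adjoint_carrier[OF X]
  define H where "H = mat n n (\<lambda>(a,b). (if a = b then of_real (r\<^sup>2) else 0) - (\<Sum>c<N. X $$ (a,c) * cnj (X $$ (b,c))))"
  have H: "H \<in> carrier_mat n n" by (simp add: H_def)
  have Hv: "H *\<^sub>v v = of_real (r\<^sup>2) \<cdot>\<^sub>v v - X *\<^sub>v (mat_adjoint X *\<^sub>v v)" if v: "v \<in> carrier_vec n" for v
  proof (rule eq_vecI)
    fix a assume "a < dim_vec (of_real (r\<^sup>2) \<cdot>\<^sub>v v - X *\<^sub>v (mat_adjoint X *\<^sub>v v))"
    then have a: "a < n" using X by simp
    note 1 = mult_adjoint_index[OF X v a]
    have "(H *\<^sub>v v) $ a = (\<Sum>b<n. (if a = b then of_real (r\<^sup>2) * v $ b else 0)) - (\<Sum>b<n. (\<Sum>c<N. X $$ (a,c) * cnj (X $$ (b,c))) * v $ b)"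
      unfolding mat_mult_vec_index[OF H v a] sum_subtractf[symmetric]
      using a by (intro sum.cong refl) (auto simp: H_def left_diff_distrib)
    also have "\<dots> = (of_real (r\<^sup>2) \<cdot>\<^sub>v v) $ a - (X *\<^sub>v (mat_adjoint X *\<^sub>v v)) $ a"
      unfolding 1 using a v by simp
    finally show "(H *\<^sub>v v) $ a = (of_real (r\<^sup>2) \<cdot>\<^sub>v v - X *\<^sub>v (mat_adjoint X *\<^sub>v v)) $ a"
      using a X by (simp del: index_mult_mat_vec)
  qed (use H X in auto)
  have form: "(H *\<^sub>v x) \<bullet>c y = of_real (r\<^sup>2) * (x \<bullet>c y) - (mat_adjoint X *\<^sub>v x) \<bullet>c (mat_adjoint X *\<^sub>v y)"
    if x: "x \<in> carrier_vec n" and y: "y \<in> carrier_vec n" for x y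
  proof -
    have c: "mat_adjoint X *\<^sub>v x \<in> carrier_vec N" "X *\<^sub>v (mat_adjoint X *\<^sub>v x) \<in> carrier_vec n" using X X' x by auto
    show ?thesis
      unfolding Hv[OF x] using x y c
      by (simp add: cip_minus_left[of _ n] cip_smult_left[of _ n] cip_adjoint[OF X c(1) y])
  qed
  have herm: "(H *\<^sub>v x) \<bullet>c y = x \<bullet>c (H *\<^sub>v y)" if x: "x \<in> carrier_vec n" and y: "y \<in> carrier_vec n" for x y
  proof -
    have c: "mat_adjoint X *\<^sub>v x \<in> carrier_vec N" "mat_adjoint X *\<^sub>v y \<in> carrier_vec N" using X' x y by auto
    have "x \<bullet>c (H *\<^sub>v y) = cnj ((H *\<^sub>v y) \<bullet>c x)" using H x y by (intro cip_cnj[of _ n]) auto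
    also have "\<dots> = of_real (r\<^sup>2) * cnj (y \<bullet>c x) - cnj ((mat_adjoint X *\<^sub>v y) \<bullet>c (mat_adjoint X *\<^sub>v x))"
      unfolding form[OF y x] by simp
    also have "\<dots> = (H *\<^sub>v x) \<bullet>c y" unfolding form[OF x y] using cip_cnj[OF y x] cip_cnj[OF c(2,1)] by simp
    finally show ?thesis by simp
  qed
  have psd: "0 \<le> Re ((H *\<^sub>v v) \<bullet>c v)" if v: "v \<in> carrier_vec n" for v
  proof -
    have c: "mat_adjoint X *\<^sub>v v \<in> carrier_vec N" using X' v by auto
    have "vec_norm (X *\<^sub>v w) \<le> r * vec_norm w" if "w \<in> carrier_vec N" for w
      using mat_norm_bound[OF X that] mult_right_mono[OF r, of "vec_norm w"] by simp
    then have "vec_norm (mat_adjoint X *\<^sub>v v) \<le> r * vec_norm v" using adjoint_bound[OF X r0 _ v] by blast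
    then have "(vec_norm (mat_adjoint X *\<^sub>v v))\<^sup>2 \<le> (r * vec_norm v)\<^sup>2" by (intro power_mono) auto
    then show ?thesis unfolding form[OF v v] cip_self[OF v] cip_self[OF c] by (simp add: power_mult_distrib flip: of_real_mult of_real_power)
  qed
  obtain k E where E: "E \<in> carrier_mat n k"
    and HE: "\<And>a b. a < n \<Longrightarrow> b < n \<Longrightarrow> H $$ (a,b) = (\<Sum>c<k. E $$ (a,c) * cnj (E $$ (b,c)))"
    using psd_factorization[OF H herm psd] by blast
  define Z where "Z = mat n (N + k) (\<lambda>(a,c). if c < N then X $$ (a,c) else E $$ (a, c - N))"
  show thesis
  proof (rule that[of "N + k" Z])
    fix a b assume ab: "a < n" "b < n"
    have "(\<Sum>c<N + k. Z $$ (a,c) * cnj (Z $$ (b,c))) = (\<Sum>c<N. X $$ (a,c) * cnj (X $$ (b,c))) + H $$ (a,b)"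
      unfolding sum_lessThan_add HE[OF ab] using ab by (simp add: Z_def)
    then show "(\<Sum>c<N + k. Z $$ (a,c) * cnj (Z $$ (b,c))) = (if a = b then of_real (r\<^sup>2) else 0)"
      using ab by (simp add: H_def)
  qed (auto simp: Z_def)
qed

lemma coisometry_bound:
  assumes Z: "Z \<in> carrier_mat n K" and r: "0 \<le> r"
    and co: "\<And>a b. a < n \<Longrightarrow> b < n \<Longrightarrow> (\<Sum>c<K. Z $$ (a,c) * cnj (Z $$ (b,c))) = (if a = b then of_real (r\<^sup>2) else 0)"
    and v: "v \<in> carrier_vec K"
  shows "vec_norm (Z *\<^sub>v v) \<le> r * vec_norm v"
proof -
  note Z' = mat_adjoint_carrier[OF Z]
  have ZZ: "Z *\<^sub>v (mat_adjoint Z *\<^sub>v u) = of_real (r\<^sup>2) \<cdot>\<^sub>v u" if u: "u \<in> carrier_vec n" for u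
  proof (rule eq_vecI)
    fix a assume "a < dim_vec (of_real (r\<^sup>2) \<cdot>\<^sub>v u)"
    then have a: "a < n" using u by simp
    have "(Z *\<^sub>v (mat_adjoint Z *\<^sub>v u)) $ a = (\<Sum>b<n. (\<Sum>c<K. Z $$ (a,c) * cnj (Z $$ (b,c))) * u $ b)"
      by (rule mult_adjoint_index[OF Z u a])
    also have "\<dots> = (\<Sum>b<n. if a = b then of_real (r\<^sup>2) * u $ b else 0)"
      using co a by (intro sum.cong refl) simp
    finally show "(Z *\<^sub>v (mat_adjoint Z *\<^sub>v u)) $ a = (of_real (r\<^sup>2) \<cdot>\<^sub>v u) $ a" using a u by simp
  qed (use Z u in auto)
  have "vec_norm (mat_adjoint Z *\<^sub>v u) \<le> r * vec_norm u" if u: "u \<in> carrier_vec n" for u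
  proof -
    have Z'u: "mat_adjoint Z *\<^sub>v u \<in> carrier_vec K" using Z' u by auto
    have "complex_of_real ((vec_norm (mat_adjoint Z *\<^sub>v u))\<^sup>2) = cnj ((Z *\<^sub>v (mat_adjoint Z *\<^sub>v u)) \<bullet>c u)"
      unfolding cip_adjoint[OF Z Z'u u] using cip_self[OF Z'u] by simp
    also have "\<dots> = of_real ((r * vec_norm u)\<^sup>2)"
      unfolding ZZ[OF u] using u cip_self[OF u] by (simp add: cip_smult_left[of _ n] power_mult_distrib)
    finally have "(vec_norm (mat_adjoint Z *\<^sub>v u))\<^sup>2 = (r * vec_norm u)\<^sup>2" unfolding of_real_eq_iff .
    then show ?thesis using r by (simp add: power2_eq_iff_nonneg)
  qed
  from adjoint_bound[OF Z' r this v] have "vec_norm (mat_adjoint (mat_adjoint Z) *\<^sub>v v) \<le> r * vec_norm v" .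
  moreover have "mat_adjoint (mat_adjoint Z) = Z"
    using Z mat_adjoint_carrier[OF Z'] by (intro eq_matI) (auto simp: mat_adjoint_index[OF Z'] mat_adjoint_index[OF Z])
  ultimately show ?thesis by simp
qed

lemma mat_sums_mult_vec:
  assumes s: "mat_sums r c A B" and v: "v \<in> carrier_vec c"
  shows "vec_sums r (\<lambda>k. A k *\<^sub>v v) (B *\<^sub>v v)"
proof -
  have A: "A k \<in> carrier_mat r c" and B: "B \<in> carrier_mat r c" for k using s by (auto simp: mat_sums_def)
  have "(\<lambda>k. (A k *\<^sub>v v) $ i) sums (B *\<^sub>v v) $ i" if i: "i < r" for i
    unfolding mat_mult_vec_index[OF A v i] mat_mult_vec_index[OF B v i]
    by (intro sums_sum sums_mult2) (use s i in \<open>auto simp: mat_sums_def\<close>)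
  then show ?thesis using mult_mat_vec_carrier[OF A v] mult_mat_vec_carrier[OF B v] by (auto simp: vec_sums_def simp del: index_mult_mat_vec)
qed

lemma vec_sums_unique:
  assumes "vec_sums n f x" "vec_sums n f y"
  shows "x = y"
proof (rule eq_vecI)
  fix i assume "i < dim_vec y"
  then have "(\<lambda>\<alpha>. f \<alpha> $ i) sums (x $ i)" "(\<lambda>\<alpha>. f \<alpha> $ i) sums (y $ i)"
    using assms by (auto simp: vec_sums_def)
  then show "x $ i = y $ i" by (rule sums_unique2)
qed (use assms in \<open>auto simp: vec_sums_def\<close>)

text \<open>The NC series with coefficients \<open>b\<close>, without constant term, converges on the open ball to a
  function \<open>h\<close> whose values are contractions.\<close>

locale contractive_series =
  fixes g d' d :: nat and b :: "nat list \<Rightarrow> complex mat" and h :: "complex mat \<Rightarrow> complex mat"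
  assumes coeff: "\<forall>w\<in>nc_words g. b w \<in> carrier_mat d' d"
    and b_Nil: "b [] = 0\<^sub>m d' d"
    and contr: "\<And>N X. N \<ge> 1 \<Longrightarrow> X \<in> int_ball g N \<Longrightarrow> mat_norm (h X) \<le> 1"
    and series: "\<And>N X. N \<ge> 1 \<Longrightarrow> X \<in> int_ball g N \<Longrightarrow>
      mat_sums (d' * N) (d * N) (\<lambda>\<alpha>. nc_poly_eval g d' d (hom_part d' d b \<alpha>) X) (h X)"
begin

text \<open>With \<open>b\<close> fixed, \<open>Q w\<close> are the coefficients of the series \<open>Q\<close> with \<open>h(x) = Q(x) x\<close>, and
  \<open>Qpart k X\<close> is the value at \<open>X\<close> of its homogeneous part of degree \<open>k\<close>.\<close>

abbreviation Q :: "nat list \<Rightarrow> complex mat" where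
  "Q \<equiv> left_coeff g d' d b"

abbreviation Qpart :: "nat \<Rightarrow> complex mat \<Rightarrow> complex mat" where
  "Qpart k X \<equiv> nc_poly_eval g d' (d * g) (left_part g d' d b k) X"

lemma hom_part_0_eval:
  assumes X: "X \<in> carrier_mat (g * N) N"
  shows "nc_poly_eval g d' d (hom_part d' d b 0) X = 0\<^sub>m (d' * N) (d * N)"
proof (rule eq_matI)
  fix i' j' assume "i' < dim_row (0\<^sub>m (d' * N) (d * N))" "j' < dim_col (0\<^sub>m (d' * N) (d * N))"
  then have "i' < d' * N" "j' < d * N" by auto
  then obtain i m j l where ij: "i' = i * N + m" "i < d'" "m < N" "j' = j * N + l" "j < d" "l < N"
    by (metis block_index_cases)
  have "words g 0 = {[]}" by (auto simp: words_def)
  then show "nc_poly_eval g d' d (hom_part d' d b 0) X $$ (i', j') = 0\<^sub>m (d' * N) (d * N) $$ (i', j')"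
    unfolding ij(1,4) hom_part_eval_index[OF coeff X ij(2,5,3,6)]
    using ij b_Nil by (simp add: block_index_less)
qed (use X in \<open>auto simp: nc_poly_eval_def\<close>)

text \<open>The Schwarz lemma with the bound \<open>1 / r\<close>, from one dilation.\<close>

lemma schwarz_aux:
  assumes N: "N \<ge> 1" and X: "X \<in> carrier_mat (g * N) N" and Xr: "mat_norm X \<le> r" and r: "0 < r" "r < 1"
    and v: "v \<in> carrier_vec (d * g * N)"
  shows "\<exists>u. vec_sums (d' * N) (\<lambda>k. Qpart k X *\<^sub>v v) u \<and> vec_norm u \<le> vec_norm v / r"
proof -
  obtain K Z where NK: "N \<le> K" and Z: "Z \<in> carrier_mat (g * N) K"
    and ZX: "\<And>a c. a < g * N \<Longrightarrow> c < N \<Longrightarrow> Z $$ (a,c) = X $$ (a,c)"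
    and co: "\<And>a b. a < g * N \<Longrightarrow> b < g * N \<Longrightarrow> (\<Sum>c<K. Z $$ (a,c) * cnj (Z $$ (b,c))) = (if a = b then of_real (r\<^sup>2) else 0)"
    using coisometric_extension[OF X Xr] by blast
  have K: "K \<ge> 1" using N NK by simp
  \<comment> \<open>the component \<open>Y\<^sub>j\<close> is the \<open>N \<times> K\<close> matrix \<open>Z\<^sub>j\<close> extended by zero rows to a square matrix\<close>
  define Y where "Y = mat (g * K) K (\<lambda>(k,c). if k mod K < N then Z $$ (k div K * N + k mod K, c) else 0)"
  have Y: "Y \<in> carrier_mat (g * K) K" by (simp add: Y_def)
  have Yi: "Y $$ (j * K + i, c) = (if i < N then Z $$ (j * N + i, c) else 0)" if "j < g" "i < K" "c < K" for j i c
    using that by (simp add: Y_def block_index_less)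
  have Ynorm: "mat_norm Y \<le> r"
  proof (rule mat_norm_le[OF Y])
    fix y :: "complex vec" assume y: "y \<in> carrier_vec K"
    have "(vec_norm (Y *\<^sub>v y))\<^sup>2 = (\<Sum>j<g. \<Sum>i<K. (cmod ((Y *\<^sub>v y) $ (j * K + i)))\<^sup>2)"
      unfolding vec_norm_sq[OF mult_mat_vec_carrier[OF Y y]] by (rule sum_blocks)
    also have "\<dots> = (\<Sum>j<g. \<Sum>i<N. (cmod ((Z *\<^sub>v y) $ (j * N + i)))\<^sup>2)"
    proof (rule sum.cong[OF refl])
      fix j assume j: "j \<in> {..<g}"
      have top: "(Y *\<^sub>v y) $ (j * K + i) = (Z *\<^sub>v y) $ (j * N + i)" if i: "i < N" for i
      proof -
        have "j * K + i < g * K" "j * N + i < g * N" "i < K"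
          using j i NK by (auto intro!: block_index_less)
        then show ?thesis
          unfolding mat_mult_vec_index[OF Y y \<open>j * K + i < g * K\<close>] mat_mult_vec_index[OF Z y \<open>j * N + i < g * N\<close>]
          using j i by (intro sum.cong refl) (simp add: Yi)
      qed
      have bot: "(Y *\<^sub>v y) $ (j * K + i) = 0" if i: "i < K" "\<not> i < N" for i
        using j i block_index_less[of j g i K]
        by (subst mat_mult_vec_index[OF Y y]) (simp_all add: Yi)
      have "(\<Sum>i<K. (cmod ((Y *\<^sub>v y) $ (j * K + i)))\<^sup>2) = (\<Sum>i<N. (cmod ((Y *\<^sub>v y) $ (j * K + i)))\<^sup>2)"
        using NK bot by (intro sum.mono_neutral_right) (auto simp del: index_mult_mat_vec)
      then show "(\<Sum>i<K. (cmod ((Y *\<^sub>v y) $ (j * K + i)))\<^sup>2) = (\<Sum>i<N. (cmod ((Z *\<^sub>v y) $ (j * N + i)))\<^sup>2)"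
        using top by (simp del: index_mult_mat_vec)
    qed
    also have "\<dots> = (vec_norm (Z *\<^sub>v y))\<^sup>2"
      unfolding vec_norm_sq[OF mult_mat_vec_carrier[OF Z y]] by (rule sum_blocks[symmetric])
    finally have "vec_norm (Y *\<^sub>v y) = vec_norm (Z *\<^sub>v y)" by (simp add: power2_eq_iff_nonneg)
    then show "vec_norm (Y *\<^sub>v y) \<le> r * vec_norm y" using coisometry_bound[OF Z _ co y] r by simp
  qed (use r in simp)
  have Yball: "Y \<in> int_ball g K" using Y Ynorm r by (simp add: nc_nbhd_def nc_mats_def)
  have low: "word_eval Y (w @ [j]) $$ (i,c) = 0"
    if wj: "w \<in> nc_words g" "j < g" "N \<le> i" "i < K" "c < K" for w j i c
  proof -
    obtain j' w' where w': "w @ [j] = j' # w'" "j' < g" using wj(1,2) by (cases w) auto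
    show ?thesis unfolding w'(1) word_eval_Cons_index[OF Y wj(4,5)]
      using w'(2) wj by (simp add: Yi)
  qed
  have dil: "word_eval Y (w @ [j]) $$ (i,c) = (\<Sum>m<N. word_eval X w $$ (i,m) * Z $$ (j * N + m, c))"
    if "w \<in> nc_words g" "j < g" "i < N" "c < K" for w j i c
    using that(1,3)
  proof (induction w arbitrary: i rule: list.induct)
    case Nil
    have iK: "i < K" using Nil NK by simp
    have "word_eval Y ([] @ [j]) $$ (i,c) = (\<Sum>k<K. if k = c then Y $$ (j * K + i, k) else 0)"
      unfolding append_Nil word_eval_Cons_index[OF Y iK that(4)] word_eval_Nil[OF Y]
      using that(4) by (intro sum.cong refl) auto
    also have "\<dots> = Z $$ (j * N + i, c)" using that Nil iK by (simp add: Yi)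
    also have "\<dots> = (\<Sum>m<N. if m = i then Z $$ (j * N + m, c) else 0)" using Nil by simp
    also have "\<dots> = (\<Sum>m<N. word_eval X [] $$ (i,m) * Z $$ (j * N + m, c))"
      unfolding word_eval_Nil[OF X] using Nil by (intro sum.cong refl) auto
    finally show ?case .
  next
    case (Cons j' w)
    have iK: "i < K" using Cons.prems(2) NK by simp
    have j': "j' < g" and w: "w \<in> nc_words g" using Cons.prems(1) by simp_all
    have "word_eval Y ((j' # w) @ [j]) $$ (i,c) = (\<Sum>k<K. Y $$ (j' * K + i, k) * word_eval Y (w @ [j]) $$ (k,c))"
      unfolding append_Cons word_eval_Cons_index[OF Y iK that(4)] ..
    also have "\<dots> = (\<Sum>k<N. Y $$ (j' * K + i, k) * word_eval Y (w @ [j]) $$ (k,c))"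
      using NK low[OF w that(2) _ _ that(4)] by (intro sum.mono_neutral_right) auto
    also have "\<dots> = (\<Sum>k<N. \<Sum>m<N. X $$ (j' * N + i, k) * (word_eval X w $$ (k,m) * Z $$ (j * N + m, c)))"
      using Cons.IH[OF w] NK iK j' Cons.prems(2)
      by (intro sum.cong refl) (simp add: Yi ZX block_index_less sum_distrib_left)
    also have "\<dots> = (\<Sum>m<N. \<Sum>k<N. X $$ (j' * N + i, k) * (word_eval X w $$ (k,m) * Z $$ (j * N + m, c)))"
      by (rule sum.swap)
    also have "\<dots> = (\<Sum>m<N. word_eval X (j' # w) $$ (i,m) * Z $$ (j * N + m, c))"
      using Cons.prems by (intro sum.cong refl) (simp add: word_eval_Cons_index[OF X] sum_distrib_right mult.assoc)
    finally show ?case .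
  qed
  \<comment> \<open>\<open>\<zeta> = (I \<otimes> Z)\<^sup>* v / r\<^sup>2\<close>, so that \<open>(I \<otimes> Z) \<zeta> = v\<close>\<close>
  define V where "V q a = v $ ((a div N * d + q) * N + a mod N)" for q a
  define \<zeta> where "\<zeta> = vec (d * K) (\<lambda>k. (1 / of_real (r\<^sup>2)) * (\<Sum>a<g * N. cnj (Z $$ (a, k mod K)) * V (k div K) a))"
  have \<zeta>: "\<zeta> \<in> carrier_vec (d * K)" by (simp add: \<zeta>_def)
  have \<zeta>i: "\<zeta> $ (q * K + c) = (1 / of_real (r\<^sup>2)) * (\<Sum>a<g * N. cnj (Z $$ (a, c)) * V q a)"
    if "q < d" "c < K" for q c
    using that by (simp add: \<zeta>_def block_index_less)
  have Z\<zeta>: "(\<Sum>c<K. Z $$ (a,c) * \<zeta> $ (q * K + c)) = V q a" if q: "q < d" and a: "a < g * N" for q a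
  proof -
    have "(\<Sum>c<K. Z $$ (a,c) * \<zeta> $ (q * K + c))
        = (1 / of_real (r\<^sup>2)) * (\<Sum>c<K. \<Sum>a'<g * N. Z $$ (a,c) * cnj (Z $$ (a', c)) * V q a')"
      unfolding sum_distrib_left
    proof (rule sum.cong[OF refl])
      fix c assume "c \<in> {..<K}"
      then show "Z $$ (a,c) * \<zeta> $ (q * K + c)
          = (\<Sum>a'<g * N. (1 / of_real (r\<^sup>2)) * (Z $$ (a,c) * cnj (Z $$ (a', c)) * V q a'))"
        using q by (simp add: \<zeta>i sum_distrib_left mult.assoc mult.left_commute del: of_real_power)
    qed
    also have "(\<Sum>c<K. \<Sum>a'<g * N. Z $$ (a,c) * cnj (Z $$ (a', c)) * V q a')
        = (\<Sum>a'<g * N. (\<Sum>c<K. Z $$ (a,c) * cnj (Z $$ (a', c))) * V q a')"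
      by (subst sum.swap) (simp add: sum_distrib_right)
    also have "\<dots> = (\<Sum>a'<g * N. if a' = a then of_real (r\<^sup>2) * V q a' else 0)"
      using co[OF a] by (intro sum.cong refl) auto
    finally show ?thesis using a r by simp
  qed
  have lift: "column_apply g d N K Z \<zeta> = v"
  proof (rule eq_vecI)
    fix k assume "k < dim_vec v"
    then have "k < (d * g) * N" using v by simp
    then obtain a m where k: "k = a * N + m" "a < d * g" "m < N" by (rule block_index_cases)
    from k(2) have "a < g * d" by (simp add: mult.commute)
    then obtain j q where a: "a = j * d + q" "j < g" "q < d" by (rule block_index_cases)
    show "column_apply g d N K Z \<zeta> $ k = v $ k"
      unfolding k(1) a(1) column_apply_index[OF a(2,3) k(3)] Z\<zeta>[OF a(3) block_index_less[OF a(2) k(3)]]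
      using k(3) by (simp add: V_def)
  qed (use v in \<open>simp add: column_apply_def\<close>)
  have \<zeta>norm: "vec_norm \<zeta> = vec_norm v / r"
  proof -
    have "\<zeta> \<bullet>c \<zeta> = (\<Sum>q<d. \<Sum>c<K. \<zeta> $ (q * K + c) * cnj (\<zeta> $ (q * K + c)))"
      unfolding cip_sum[OF \<zeta> \<zeta>] by (rule sum_blocks)
    also have "\<dots> = (\<Sum>q<d. \<Sum>c<K. \<Sum>a<g * N. (1 / of_real (r\<^sup>2)) * (cnj (V q a) * (Z $$ (a,c) * \<zeta> $ (q * K + c))))"
    proof (intro sum.cong refl)
      fix q c assume "q \<in> {..<d}" "c \<in> {..<K}"
      then have "cnj (\<zeta> $ (q * K + c)) = (1 / of_real (r\<^sup>2)) * (\<Sum>a<g * N. Z $$ (a, c) * cnj (V q a))"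
        using \<zeta>i[of q c] by simp
      then show "\<zeta> $ (q * K + c) * cnj (\<zeta> $ (q * K + c))
          = (\<Sum>a<g * N. (1 / of_real (r\<^sup>2)) * (cnj (V q a) * (Z $$ (a,c) * \<zeta> $ (q * K + c))))"
        by (simp add: sum_distrib_left mult_ac)
    qed
    also have "\<dots> = (\<Sum>q<d. \<Sum>a<g * N. \<Sum>c<K. (1 / of_real (r\<^sup>2)) * (cnj (V q a) * (Z $$ (a,c) * \<zeta> $ (q * K + c))))"
      by (rule sum.cong[OF refl], rule sum.swap)
    also have "\<dots> = (\<Sum>q<d. \<Sum>a<g * N. (1 / of_real (r\<^sup>2)) * (V q a * cnj (V q a)))"
    proof (intro sum.cong refl)
      fix q a assume "q \<in> {..<d}" "a \<in> {..<g * N}"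
      then have qa: "(\<Sum>c<K. Z $$ (a,c) * \<zeta> $ (q * K + c)) = V q a" by (intro Z\<zeta>) auto
      show "(\<Sum>c<K. (1 / of_real (r\<^sup>2)) * (cnj (V q a) * (Z $$ (a,c) * \<zeta> $ (q * K + c))))
          = (1 / of_real (r\<^sup>2)) * (V q a * cnj (V q a))"
        unfolding sum_distrib_left[symmetric] qa by (simp only: mult.commute)
    qed
    also have "\<dots> = (1 / of_real (r\<^sup>2)) * (\<Sum>q<d. \<Sum>j<g. \<Sum>m<N. V q (j * N + m) * cnj (V q (j * N + m)))"
      unfolding sum_blocks by (simp add: sum_distrib_left)
    also have "(\<Sum>q<d. \<Sum>j<g. \<Sum>m<N. V q (j * N + m) * cnj (V q (j * N + m)))
        = (\<Sum>j<g. \<Sum>q<d. \<Sum>m<N. v $ ((j * d + q) * N + m) * cnj (v $ ((j * d + q) * N + m)))"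
      by (subst sum.swap) (simp add: V_def)
    also have "\<dots> = (\<Sum>k<(g * d) * N. v $ k * cnj (v $ k))" unfolding sum_blocks ..
    also have "\<dots> = v \<bullet>c v" unfolding cip_sum[OF v v] by (simp add: mult.commute)
    finally have "complex_of_real ((vec_norm \<zeta>)\<^sup>2) = of_real ((vec_norm v / r)\<^sup>2)"
      unfolding cip_self[OF \<zeta>] cip_self[OF v] by (simp add: power_divide)
    then have "(vec_norm \<zeta>)\<^sup>2 = (vec_norm v / r)\<^sup>2" unfolding of_real_eq_iff .
    then show ?thesis using r by (simp add: power2_eq_iff_nonneg)
  qed
  have hY: "h Y \<in> carrier_mat (d' * K) (d * K)" using series[OF K Yball] by (simp add: mat_sums_def)
  define z where "z = h Y *\<^sub>v \<zeta>"
  have z: "z \<in> carrier_vec (d' * K)" using hY \<zeta> by (auto simp: z_def)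
  have zn: "vec_norm z \<le> vec_norm v / r"
  proof -
    have "vec_norm z \<le> mat_norm (h Y) * vec_norm \<zeta>" unfolding z_def by (rule mat_norm_bound[OF hY \<zeta>])
    also have "\<dots> \<le> 1 * vec_norm \<zeta>" using contr[OF K Yball] by (rule mult_right_mono) simp
    finally show ?thesis using \<zeta>norm by simp
  qed
  \<comment> \<open>the top \<open>N\<close> rows in each block of \<open>h(Y) \<zeta>\<close>\<close>
  define u where "u = vec (d' * N) (\<lambda>k. z $ (k div N * K + k mod N))"
  have u: "u \<in> carrier_vec (d' * N)" by (simp add: u_def)
  have ui: "u $ (p * N + i) = z $ (p * K + i)" if "p < d'" "i < N" for p i
    using that by (simp add: u_def block_index_less)
  have "vec_sums (d' * N) (\<lambda>k. Qpart k X *\<^sub>v v) u"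
    unfolding vec_sums_def
  proof (intro conjI allI impI)
    show "Qpart k X *\<^sub>v v \<in> carrier_vec (d' * N)" for k
      using nc_poly_eval_carrier[OF X, of g d' "d * g" "left_part g d' d b k"] v by auto
    fix i' assume "i' < d' * N"
    then obtain p i where pi: "i' = p * N + i" "p < d'" "i < N" by (rule block_index_cases)
    let ?H = "\<lambda>\<alpha>. (nc_poly_eval g d' d (hom_part d' d b \<alpha>) Y *\<^sub>v \<zeta>) $ (p * K + i)"
    have pK: "p * K + i < d' * K" using pi NK by (intro block_index_less) auto
    have "?H sums z $ (p * K + i)"
      using mat_sums_mult_vec[OF series[OF K Yball] \<zeta>] pK by (simp add: vec_sums_def z_def del: index_mult_mat_vec)
    moreover have "?H 0 = 0" unfolding hom_part_0_eval[OF Y] using \<zeta> pK by simp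
    ultimately have "(\<lambda>k. ?H (Suc k)) sums z $ (p * K + i)" using sums_Suc_iff[of ?H] by simp
    moreover have "?H (Suc k) = (Qpart k X *\<^sub>v v) $ i'" for k
      using hom_part_via_left_part[OF coeff X Y NK _ \<zeta> pi(2,3), of Z k] dil unfolding lift pi(1) by blast
    ultimately show "(\<lambda>k. (Qpart k X *\<^sub>v v) $ i') sums u $ i'"
      unfolding pi(1) ui[OF pi(2,3)] by simp
  qed (rule u)
  moreover have "vec_norm u \<le> vec_norm v / r"
  proof -
    have "(vec_norm u)\<^sup>2 = (\<Sum>p<d'. \<Sum>i<N. (cmod (z $ (p * K + i)))\<^sup>2)"
      unfolding vec_norm_sq[OF u] sum_blocks by (intro sum.cong refl) (simp add: ui)
    also have "\<dots> \<le> (\<Sum>p<d'. \<Sum>i<K. (cmod (z $ (p * K + i)))\<^sup>2)"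
      using NK by (intro sum_mono sum_mono2) auto
    also have "\<dots> = (vec_norm z)\<^sup>2" unfolding vec_norm_sq[OF z] sum_blocks ..
    finally have "vec_norm u \<le> vec_norm z" by (rule power2_le_imp_le) simp
    then show ?thesis using zn by simp
  qed
  ultimately show ?thesis by blast
qed

lemma schwarz:
  assumes N: "N \<ge> 1" and X: "X \<in> int_ball g N" and v: "v \<in> carrier_vec (d * g * N)"
  shows "\<exists>u. vec_sums (d' * N) (\<lambda>k. Qpart k X *\<^sub>v v) u \<and> vec_norm u \<le> vec_norm v"
proof -
  have Xc: "X \<in> carrier_mat (g * N) N" and X1: "mat_norm X < 1" using X by (auto simp: nc_nbhd_def nc_mats_def)
  define r0 where "r0 = (1 + mat_norm X) / 2"
  have r0: "0 < r0" "r0 < 1" "mat_norm X \<le> r0" using X1 mat_norm_nonneg[of X] by (auto simp: r0_def)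
  obtain u where u: "vec_sums (d' * N) (\<lambda>k. Qpart k X *\<^sub>v v) u"
    using schwarz_aux[OF N Xc r0(3,1,2) v] by blast
  have le: "vec_norm u \<le> vec_norm v / r" if rr: "r0 \<le> r" "r < 1" for r
  proof -
    obtain u' where "vec_sums (d' * N) (\<lambda>k. Qpart k X *\<^sub>v v) u'" "vec_norm u' \<le> vec_norm v / r"
      using schwarz_aux[OF N Xc, of r v] r0 rr v by force
    then show ?thesis using vec_sums_unique[OF u] by auto
  qed
  have "vec_norm u \<le> vec_norm v"
  proof (rule tendsto_lowerbound)
    have "((\<lambda>r. vec_norm v / r) \<longlongrightarrow> vec_norm v / 1) (at_left (1::real))" by (intro tendsto_intros) auto
    then show "((\<lambda>r. vec_norm v / r) \<longlongrightarrow> vec_norm v) (at_left (1::real))" by simp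
    have "eventually (\<lambda>r. r \<in> {r0<..<1}) (at_left (1::real))" using r0 by (intro eventually_at_left_real) auto
    then show "eventually (\<lambda>r. vec_norm u \<le> vec_norm v / r) (at_left (1::real))"
      by eventually_elim (use le in auto)
  qed simp
  then show ?thesis using u by blast
qed

end

section \<open>Nilpotent test points\<close>

text \<open>For \<open>w = w\<^sub>0 \<dots> w\<^sub>n\<^sub>-\<^sub>1\<close> the tuple of partial shifts on \<open>\<complex>\<^bsup>n+1\<^esup>\<close> with \<open>X\<^bsub>w\<^sub>i\<^esub> e\<^bsub>i+1\<^esub> = e\<^sub>i\<close>.\<close>

definition chain_mat :: "nat \<Rightarrow> nat list \<Rightarrow> complex mat" where
  "chain_mat g w = (let N = Suc (length w) in
     mat (g * N) N (\<lambda>(k,c). if k mod N < length w \<and> c = Suc (k mod N) \<and> k div N = w ! (k mod N) then 1 else 0))"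

lemma chain_mat_carrier: "chain_mat g w \<in> carrier_mat (g * Suc (length w)) (Suc (length w))"
  by (simp add: chain_mat_def Let_def)

lemma chain_mat_index:
  assumes "j < g" "i < Suc (length w)" "c < Suc (length w)"
  shows "chain_mat g w $$ (j * Suc (length w) + i, c) = (if i < length w \<and> c = Suc i \<and> j = w ! i then 1 else 0)"
proof -
  have "(j * Suc (length w) + i) mod Suc (length w) = i" "(j * Suc (length w) + i) div Suc (length w) = j"
    using assms(2) by (simp_all del: mult_Suc_right)
  then show ?thesis
    using assms block_index_less[OF assms(1,2)] by (simp add: chain_mat_def Let_def del: mult_Suc_right)
qed

lemma chain_mat_mult_vec:
  assumes v: "v \<in> carrier_vec (Suc (length w))" and j: "j < g" and i: "i < Suc (length w)"
  shows "(chain_mat g w *\<^sub>v v) $ (j * Suc (length w) + i) = (if i < length w \<and> j = w ! i then v $ Suc i else 0)"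
proof -
  have "(chain_mat g w *\<^sub>v v) $ (j * Suc (length w) + i)
      = (\<Sum>c<Suc (length w). if c = Suc i then if i < length w \<and> j = w ! i then v $ c else 0 else 0)"
    unfolding mat_mult_vec_index[OF chain_mat_carrier v block_index_less[OF j i]]
    using chain_mat_index[OF j i] by (intro sum.cong refl) auto
  then show ?thesis using i by (simp del: sum.lessThan_Suc)
qed

lemma chain_mat_norm_le:
  assumes w: "w \<in> nc_words g"
  shows "mat_norm (chain_mat g w) \<le> 1"
proof (rule mat_norm_le[OF chain_mat_carrier])
  let ?n = "length w" and ?X = "chain_mat g w"
  fix v :: "complex vec" assume v: "v \<in> carrier_vec (Suc ?n)"
  have "(vec_norm (?X *\<^sub>v v))\<^sup>2 = (\<Sum>j<g. \<Sum>i<Suc ?n. (cmod ((?X *\<^sub>v v) $ (j * Suc ?n + i)))\<^sup>2)"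
    unfolding vec_norm_sq[OF mult_mat_vec_carrier[OF chain_mat_carrier v]] by (rule sum_blocks)
  also have "\<dots> = (\<Sum>j<g. \<Sum>i<Suc ?n. if i < ?n \<and> j = w ! i then (cmod (v $ Suc i))\<^sup>2 else 0)"
  proof (intro sum.cong refl)
    fix j i assume "j \<in> {..<g}" "i \<in> {..<Suc ?n}"
    then have ji: "j < g" "i < Suc ?n" by auto
    show "(cmod ((?X *\<^sub>v v) $ (j * Suc ?n + i)))\<^sup>2 = (if i < ?n \<and> j = w ! i then (cmod (v $ Suc i))\<^sup>2 else 0)"
      unfolding chain_mat_mult_vec[OF v ji] by simp
  qed
  also have "\<dots> = (\<Sum>j<g. \<Sum>i<?n. if j = w ! i then (cmod (v $ Suc i))\<^sup>2 else 0)"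
    unfolding sum.lessThan_Suc by (intro sum.cong refl) simp
  also have "\<dots> = (\<Sum>i<?n. \<Sum>j<g. if j = w ! i then (cmod (v $ Suc i))\<^sup>2 else 0)" by (rule sum.swap)
  also have "\<dots> = (\<Sum>i<?n. (cmod (v $ Suc i))\<^sup>2)"
  proof (rule sum.cong[OF refl])
    fix i assume "i \<in> {..<?n}"
    then have "w ! i < g" using w nth_mem[of i w] by auto
    then show "(\<Sum>j<g. if j = w ! i then (cmod (v $ Suc i))\<^sup>2 else 0) = (cmod (v $ Suc i))\<^sup>2" by simp
  qed
  also have "\<dots> \<le> (vec_norm v)\<^sup>2"
    unfolding vec_norm_sq[OF v] sum.lessThan_Suc_shift by simp
  finally have "vec_norm (?X *\<^sub>v v) \<le> vec_norm v" by (rule power2_le_imp_le) simp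
  then show "vec_norm (?X *\<^sub>v v) \<le> 1 * vec_norm v" by simp
qed simp

lemma chain_mat_word_eval:
  assumes "i < Suc (length w)" "c < Suc (length w)" "u \<in> nc_words g"
  shows "word_eval (chain_mat g w) u $$ (i,c) = (if c = i + length u \<and> u = take (length u) (drop i w) then 1 else 0)"
  using assms(1,3)
proof (induction u arbitrary: i)
  case Nil
  then show ?case using assms(2) by (auto simp: word_eval_Nil[OF chain_mat_carrier])
next
  case (Cons j u)
  let ?n = "length w" and ?X = "chain_mat g w"
  have j: "j < g" and u: "u \<in> nc_words g" using Cons.prems by auto
  have "word_eval ?X (j # u) $$ (i,c)
      = (\<Sum>k<Suc ?n. if k = Suc i then if i < ?n \<and> j = w ! i then word_eval ?X u $$ (k,c) else 0 else 0)"
    unfolding word_eval_Cons_index[OF chain_mat_carrier Cons.prems(1) assms(2)]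
    using chain_mat_index[OF j Cons.prems(1)] by (intro sum.cong refl) auto
  also have "\<dots> = (if i < ?n \<and> j = w ! i then word_eval ?X u $$ (Suc i,c) else 0)"
    using Cons.prems(1) by (simp del: sum.lessThan_Suc)
  also have "\<dots> = (if c = i + length (j # u) \<and> j # u = take (length (j # u)) (drop i w) then 1 else 0)"
  proof (cases "i < ?n")
    case True
    then have "drop i w = w ! i # drop (Suc i) w" by (simp add: Cons_nth_drop_Suc)
    then show ?thesis using True Cons.IH[OF _ u, of "Suc i"] by auto
  qed simp
  finally show ?case .
qed

text \<open>The vector \<open>\<Sum>\<^sub>m V\<^sub>m \<otimes> e\<^sub>m\<close>.\<close>

definition vec_of_slices :: "nat \<Rightarrow> nat \<Rightarrow> (nat \<Rightarrow> complex vec) \<Rightarrow> complex vec" where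
  "vec_of_slices n N V = vec (n * N) (\<lambda>k. V (k mod N) $ (k div N))"

lemma vec_of_slices_carrier [simp]: "vec_of_slices n N V \<in> carrier_vec (n * N)"
  by (simp add: vec_of_slices_def)

lemma slice_vec_of_slices:
  assumes "m < N" "V m \<in> carrier_vec n"
  shows "slice n N (vec_of_slices n N V) m = V m"
  using assms by (intro eq_vecI) (auto simp: vec_of_slices_def slice_def block_index_less)

context contractive_series
begin

text \<open>The contraction \<open>Q(X/2)\<close> at the chain \<open>X\<close> of \<open>w\<close>, applied to \<open>\<Sum>\<^sub>l V\<^sub>l \<otimes> e\<^sub>l\<close>: \<open>U\<close> is the component at
  \<open>e\<^sub>0\<close>, and the component at the last basis vector is \<open>Q\<^sub>[\<^sub>] V\<^sub>n\<close>. The two coincide for the empty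
  word. The factor \<open>1/2\<close> only serves to move \<open>X\<close> into the open ball.\<close>

lemma chain_test:
  assumes w: "w \<in> nc_words g" and V: "\<And>l. l \<le> length w \<Longrightarrow> V l \<in> carrier_vec (d * g)"
  defines "U \<equiv> vec d' (\<lambda>p. \<Sum>k\<le>length w. (1/2) ^ k * (Q (take k w) *\<^sub>v V k) $ p)"
  shows "(vec_norm U)\<^sup>2 + (if w = [] then 0 else (vec_norm (Q [] *\<^sub>v V (length w)))\<^sup>2)
    \<le> (\<Sum>l\<le>length w. (vec_norm (V l))\<^sup>2)"
proof -
  define n where "n = length w"
  define N where "N = Suc n"
  define X where "X = (1/2::complex) \<cdot>\<^sub>m chain_mat g w"
  have Cc: "chain_mat g w \<in> carrier_mat (g * N) N" using chain_mat_carrier by (simp add: N_def n_def)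
  have Xc: "X \<in> carrier_mat (g * N) N" using Cc by (simp add: X_def)
  have "mat_norm X \<le> 1/2 * mat_norm (chain_mat g w)"
    using mat_norm_smult_le[OF Cc, of "1/2"] by (simp add: X_def norm_divide)
  then have "mat_norm X < 1" using chain_mat_norm_le[OF w] by linarith
  then have X: "X \<in> int_ball g N" using Xc by (simp add: nc_nbhd_def nc_mats_def)
  define v where "v = vec_of_slices (d * g) N V"
  have v: "v \<in> carrier_vec (d * g * N)" by (simp add: v_def)
  have sl: "slice (d * g) N v l = V l" if "l < N" for l
    using that V[of l] unfolding v_def by (intro slice_vec_of_slices) (auto simp: N_def n_def)
  obtain u where u: "vec_sums (d' * N) (\<lambda>k. Qpart k X *\<^sub>v v) u" and un: "vec_norm u \<le> vec_norm v"
    using schwarz[OF _ X v] by (auto simp: N_def)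
  have uc: "u \<in> carrier_vec (d' * N)" using u by (simp add: vec_sums_def)
  have we: "word_eval X u' $$ (m,l) = (if l = m + k \<and> u' = take k (drop m w) then (1/2) ^ k else 0)"
    if "u' \<in> words g k" "m < N" "l < N" for u' m l k
    using that word_eval_smult_index[OF Cc that(2,3), of u' "1/2"] chain_mat_word_eval[of m w l u' g]
    by (auto simp: X_def words_def N_def n_def)
  have entry: "(Qpart k X *\<^sub>v v) $ (p * N + m)
      = (if m + k \<le> n then (1/2) ^ k * (Q (take k (drop m w)) *\<^sub>v V (m + k)) $ p else 0)"
    if p: "p < d'" and m: "m < N" for p m k
  proof -
    have tk: "take k (drop m w) \<in> words g k" if "m + k \<le> n"
      using that w by (auto simp: words_def n_def dest!: in_set_takeD in_set_dropD)
    have "(Qpart k X *\<^sub>v v) $ (p * N + m) = (\<Sum>u'\<in>words g k. \<Sum>l<N.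
        word_eval X u' $$ (m,l) * (left_part g d' d b k u' *\<^sub>v slice (d * g) N v l) $ p)"
      by (rule nc_poly_eval_mult_vec[OF homogeneous_left_part Xc v p m])
    also have "\<dots> = (\<Sum>u'\<in>words g k. \<Sum>l<N. if u' = take k (drop m w) then
        if l = m + k then (1/2) ^ k * (Q u' *\<^sub>v V l) $ p else 0 else 0)"
    proof (intro sum.cong refl)
      fix u' l assume ul: "u' \<in> words g k" "l \<in> {..<N}"
      then have "left_part g d' d b k u' = Q u'" by (simp add: left_part_def words_def)
      then show "word_eval X u' $$ (m,l) * (left_part g d' d b k u' *\<^sub>v slice (d * g) N v l) $ p
        = (if u' = take k (drop m w) then if l = m + k then (1/2) ^ k * (Q u' *\<^sub>v V l) $ p else 0 else 0)"
        using ul we[OF ul(1) m, of l] sl[of l] by (simp del: index_mult_mat_vec)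
    qed
    also have "\<dots> = (\<Sum>u'\<in>words g k. if u' = take k (drop m w) then
        (\<Sum>l<N. if l = m + k then (1/2) ^ k * (Q u' *\<^sub>v V l) $ p else 0) else 0)"
      by (intro sum.cong refl) simp
    also have "\<dots> = (if m + k \<le> n then (1/2) ^ k * (Q (take k (drop m w)) *\<^sub>v V (m + k)) $ p else 0)"
      using tk by (simp add: N_def less_Suc_eq_le del: index_mult_mat_vec sum.lessThan_Suc)
    finally show ?thesis .
  qed
  have top: "slice d' N u 0 = U"
  proof (rule eq_vecI)
    fix p assume "p < dim_vec U"
    then have p: "p < d'" by (simp add: U_def)
    have pN: "p * N + 0 < d' * N" using p by (intro block_index_less) (auto simp: N_def)
    have "(\<lambda>k. (Qpart k X *\<^sub>v v) $ (p * N + 0)) sums u $ (p * N + 0)"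
      using u pN unfolding vec_sums_def by blast
    moreover have "(\<lambda>k. (Qpart k X *\<^sub>v v) $ (p * N + 0)) sums (\<Sum>k\<le>n. (Qpart k X *\<^sub>v v) $ (p * N + 0))"
      by (rule sums_finite) (use entry[OF p, of 0] in \<open>auto simp: N_def\<close>)
    ultimately have "u $ (p * N + 0) = (\<Sum>k\<le>n. (Qpart k X *\<^sub>v v) $ (p * N + 0))" by (rule sums_unique2)
    also have "\<dots> = (\<Sum>k\<le>n. (1/2) ^ k * (Q (take k w) *\<^sub>v V k) $ p)"
      using entry[OF p, of 0] by (intro sum.cong refl) (simp add: N_def del: index_mult_mat_vec)
    finally show "slice d' N u 0 $ p = U $ p" using p by (simp add: U_def n_def)
  qed (simp add: U_def slice_def)
  have bot: "slice d' N u n = Q [] *\<^sub>v V n"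
  proof (rule eq_vecI)
    fix p assume "p < dim_vec (Q [] *\<^sub>v V n)"
    then have p: "p < d'" by (simp add: left_coeff_def)
    have n: "n < N" by (simp add: N_def)
    have pN: "p * N + n < d' * N" using p n by (intro block_index_less)
    have "(\<lambda>k. (Qpart k X *\<^sub>v v) $ (p * N + n)) sums u $ (p * N + n)"
      using u pN unfolding vec_sums_def by blast
    moreover have "(\<lambda>k. (Qpart k X *\<^sub>v v) $ (p * N + n)) sums (\<Sum>k\<in>{0}. (Qpart k X *\<^sub>v v) $ (p * N + n))"
      by (rule sums_finite) (use entry[OF p n] in auto)
    ultimately have "u $ (p * N + n) = (\<Sum>k\<in>{0}. (Qpart k X *\<^sub>v v) $ (p * N + n))" by (rule sums_unique2)
    also have "\<dots> = (Q [] *\<^sub>v V n) $ p" using entry[OF p n, of 0] by simp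
    finally show "slice d' N u n $ p = (Q [] *\<^sub>v V n) $ p" using p by simp
  qed (simp add: left_coeff_def)
  have "(vec_norm U)\<^sup>2 + (if w = [] then 0 else (vec_norm (Q [] *\<^sub>v V n))\<^sup>2) \<le> (\<Sum>m<N. (vec_norm (slice d' N u m))\<^sup>2)"
  proof (cases "w = []")
    case True
    then show ?thesis using top by (simp add: N_def n_def)
  next
    case False
    then have "n \<noteq> 0" by (simp add: n_def)
    then have "(\<Sum>m\<in>{0,n}. (vec_norm (slice d' N u m))\<^sup>2) = (vec_norm U)\<^sup>2 + (vec_norm (Q [] *\<^sub>v V n))\<^sup>2"
      using top bot by simp
    moreover have "(\<Sum>m\<in>{0,n}. (vec_norm (slice d' N u m))\<^sup>2) \<le> (\<Sum>m<N. (vec_norm (slice d' N u m))\<^sup>2)"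
      by (rule sum_mono2) (auto simp: N_def)
    ultimately show ?thesis using False by simp
  qed
  also have "\<dots> = (vec_norm u)\<^sup>2" using norm_slices[OF uc] by simp
  also have "\<dots> \<le> (vec_norm v)\<^sup>2" using un by (intro power_mono) auto
  also have "\<dots> = (\<Sum>l\<le>n. (vec_norm (V l))\<^sup>2)"
    unfolding norm_slices[OF v]
  proof (rule sum.cong)
    show "{..<N} = {..n}" by (auto simp: N_def)
    fix l assume "l \<in> {..n}"
    then show "(vec_norm (slice (d * g) N v l))\<^sup>2 = (vec_norm (V l))\<^sup>2" using sl[of l] by (simp add: N_def)
  qed
  finally show ?thesis unfolding n_def .
qed

lemma Q_Nil_contraction:
  assumes v: "v \<in> carrier_vec (d * g)"
  shows "vec_norm (Q [] *\<^sub>v v) \<le> vec_norm v"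
proof -
  have "vec d' (\<lambda>p. (Q [] *\<^sub>v v) $ p) = Q [] *\<^sub>v v" by (intro eq_vecI) (auto simp: left_coeff_def)
  then have "(vec_norm (Q [] *\<^sub>v v))\<^sup>2 \<le> (vec_norm v)\<^sup>2"
    using chain_test[of "[]" "\<lambda>_. v"] v by simp
  then show ?thesis by (rule power2_le_imp_le) simp
qed

lemma chain_test_two:
  assumes w: "w \<in> nc_words g" "w \<noteq> []" and s: "s \<in> carrier_vec (d * g)" and y: "y \<in> carrier_vec (d * g)"
  shows "(vec_norm (Q [] *\<^sub>v s + (1/2) ^ length w \<cdot>\<^sub>v (Q w *\<^sub>v y)))\<^sup>2 + (vec_norm (Q [] *\<^sub>v y))\<^sup>2
    \<le> (vec_norm s)\<^sup>2 + (vec_norm y)\<^sup>2"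
proof -
  let ?n = "length w"
  have n: "?n \<noteq> 0" using w by simp
  define V where "V k = (if k = 0 then s else if k = ?n then y else 0\<^sub>v (d * g))" for k
  have V: "V k \<in> carrier_vec (d * g)" for k using s y by (simp add: V_def)
  have z: "(Q u *\<^sub>v 0\<^sub>v (d * g)) $ p = 0" if "p < d'" for u p
    using that by (simp add: mat_mult_vec_zero[OF left_coeff_carrier] del: index_mult_mat_vec)
  have Qs: "Q [] *\<^sub>v s \<in> carrier_vec d'" "Q w *\<^sub>v y \<in> carrier_vec d'"
    using s y by (auto intro: mult_mat_vec_carrier[OF left_coeff_carrier])
  have two: "(\<Sum>k\<le>?n. F k) = F 0 + F ?n" if "\<And>k. k \<noteq> 0 \<Longrightarrow> k \<noteq> ?n \<Longrightarrow> F k = 0" for F :: "nat \<Rightarrow> 'a::comm_monoid_add"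
  proof -
    have "(\<Sum>k\<le>?n. F k) = (\<Sum>k\<in>{0, ?n}. F k)" using that by (intro sum.mono_neutral_right) auto
    then show ?thesis using n by simp
  qed
  have "vec d' (\<lambda>p. \<Sum>k\<le>?n. (1/2) ^ k * (Q (take k w) *\<^sub>v V k) $ p) = Q [] *\<^sub>v s + (1/2) ^ ?n \<cdot>\<^sub>v (Q w *\<^sub>v y)"
  proof (rule eq_vecI)
    fix p assume "p < dim_vec (Q [] *\<^sub>v s + (1/2) ^ ?n \<cdot>\<^sub>v (Q w *\<^sub>v y))"
    then have p: "p < d'" by (simp add: left_coeff_def)
    have "(\<Sum>k\<le>?n. (1/2) ^ k * (Q (take k w) *\<^sub>v V k) $ p) = (Q [] *\<^sub>v s) $ p + (1/2) ^ ?n * (Q w *\<^sub>v y) $ p"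
      by (subst two) (use n z[OF p] in \<open>auto simp: V_def simp del: index_mult_mat_vec\<close>)
    then show "vec d' (\<lambda>p. \<Sum>k\<le>?n. (1/2) ^ k * (Q (take k w) *\<^sub>v V k) $ p) $ p
        = (Q [] *\<^sub>v s + (1/2) ^ ?n \<cdot>\<^sub>v (Q w *\<^sub>v y)) $ p"
    proof -
      have "(x + c \<cdot>\<^sub>v y) $ p = x $ p + c * y $ p" if "x \<in> carrier_vec d'" "y \<in> carrier_vec d'"
        for x y :: "complex vec" and c using that p by simp
      from this[OF Qs] \<open>(\<Sum>k\<le>?n. (1/2) ^ k * (Q (take k w) *\<^sub>v V k) $ p) = _\<close> p show ?thesis
        by (simp del: index_mult_mat_vec index_add_vec)
    qed
  qed (simp add: left_coeff_def)
  moreover have "(\<Sum>l\<le>?n. (vec_norm (V l))\<^sup>2) = (vec_norm s)\<^sup>2 + (vec_norm y)\<^sup>2"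
    by (subst two) (use n in \<open>auto simp: V_def\<close>)
  ultimately show ?thesis using chain_test[OF w(1), of V] V w(2) n by (simp add: V_def)
qed

text \<open>Where \<open>Q\<^sub>[\<^sub>]\<close> already preserves the norm, nothing is left for the other entries of the column.\<close>

lemma Q_vanishes_on_iso_space:
  assumes w: "w \<in> nc_words g" "w \<noteq> []" and s: "s \<in> iso_space (Q [])"
  shows "Q w *\<^sub>v s = 0\<^sub>v d'"
proof -
  have sc: "s \<in> carrier_vec (d * g)" using s by (simp add: iso_space_def left_coeff_def)
  have Qs: "Q w *\<^sub>v s \<in> carrier_vec d'" using sc by (rule mult_mat_vec_carrier[OF left_coeff_carrier])
  have "Q [] *\<^sub>v 0\<^sub>v (d * g) + (1/2) ^ length w \<cdot>\<^sub>v (Q w *\<^sub>v s) = (1/2) ^ length w \<cdot>\<^sub>v (Q w *\<^sub>v s)"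
    using Qs by (simp add: mat_mult_vec_zero[OF left_coeff_carrier])
  then have "(vec_norm ((1/2) ^ length w \<cdot>\<^sub>v (Q w *\<^sub>v s)))\<^sup>2 \<le> 0"
    using chain_test_two[OF w zero_carrier_vec sc] iso_space_norm[OF left_coeff_carrier s] by simp
  then show ?thesis using vec_norm_eq_0_iff[OF Qs] by (simp add: vec_norm_smult)
qed

text \<open>The inequality \<open>chain_test_two\<close> for \<open>t y\<close> and small \<open>t\<close>.\<close>

lemma Q_orthogonal_to_iso_image:
  assumes w: "w \<in> nc_words g" "w \<noteq> []" and s: "s \<in> iso_space (Q [])" and y: "y \<in> carrier_vec (d * g)"
  shows "(Q [] *\<^sub>v s) \<bullet>c (Q w *\<^sub>v y) = 0"
proof -
  have sc: "s \<in> carrier_vec (d * g)" using s by (simp add: iso_space_def left_coeff_def)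
  let ?e = "(1/2::complex) ^ length w"
  have Qs: "Q [] *\<^sub>v s \<in> carrier_vec d'" "Q w *\<^sub>v y \<in> carrier_vec d'"
    using sc y by (auto intro: mult_mat_vec_carrier[OF left_coeff_carrier])
  have "(Q [] *\<^sub>v s) \<bullet>c (?e \<cdot>\<^sub>v (Q w *\<^sub>v y)) = 0"
  proof (rule orthogonal_if_norm_le[where C="(vec_norm y)\<^sup>2"])
    fix t :: complex
    have "Q w *\<^sub>v (t \<cdot>\<^sub>v y) = t \<cdot>\<^sub>v (Q w *\<^sub>v y)" using y by (rule mult_mat_vec[OF left_coeff_carrier])
    then have "t \<cdot>\<^sub>v (?e \<cdot>\<^sub>v (Q w *\<^sub>v y)) = ?e \<cdot>\<^sub>v (Q w *\<^sub>v (t \<cdot>\<^sub>v y))"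
      by (simp add: smult_smult_assoc mult.commute)
    moreover have "(vec_norm (Q [] *\<^sub>v s + ?e \<cdot>\<^sub>v (Q w *\<^sub>v (t \<cdot>\<^sub>v y))))\<^sup>2 \<le> (vec_norm s)\<^sup>2 + (vec_norm (t \<cdot>\<^sub>v y))\<^sup>2"
    proof -
      have "t \<cdot>\<^sub>v y \<in> carrier_vec (d * g)" using y by simp
      from chain_test_two[OF w sc this] zero_le_power2[of "vec_norm (Q [] *\<^sub>v (t \<cdot>\<^sub>v y))"]
      show ?thesis by linarith
    qed
    ultimately show "(vec_norm (Q [] *\<^sub>v s + t \<cdot>\<^sub>v (?e \<cdot>\<^sub>v (Q w *\<^sub>v y))))\<^sup>2
        \<le> (vec_norm (Q [] *\<^sub>v s))\<^sup>2 + (vec_norm y)\<^sup>2 * (cmod t)\<^sup>2"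
      using iso_space_norm[OF left_coeff_carrier s] by (simp add: vec_norm_smult power_mult_distrib mult.commute)
  qed (use Qs in auto)
  then show ?thesis using Qs by (simp add: cip_smult_right[of _ d'])
qed

end

section \<open>The linear part and the tail\<close>

lemma words_0: "words g 0 = {[]}"
  by (auto simp: words_def)

lemma kron_one_norm_le:
  assumes A: "A \<in> carrier_mat r n" and c: "0 \<le> c"
    and le: "\<And>x. x \<in> carrier_vec n \<Longrightarrow> vec_norm (A *\<^sub>v x) \<le> c * vec_norm x" and v: "v \<in> carrier_vec (n * N)"
  shows "vec_norm ((A \<otimes>\<^sub>k 1\<^sub>m N) *\<^sub>v v) \<le> c * vec_norm v"
proof -
  have Av: "(A \<otimes>\<^sub>k 1\<^sub>m N) *\<^sub>v v \<in> carrier_vec (r * N)"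
    by (rule mult_mat_vec_carrier[OF kron_carrier[OF A one_carrier_mat] v])
  have "(vec_norm ((A \<otimes>\<^sub>k 1\<^sub>m N) *\<^sub>v v))\<^sup>2 = (\<Sum>m<N. (vec_norm (A *\<^sub>v slice n N v m))\<^sup>2)"
    unfolding norm_slices[OF Av] by (intro sum.cong refl) (simp add: kron_one_slice[OF A v])
  also have "\<dots> \<le> (\<Sum>m<N. (c * vec_norm (slice n N v m))\<^sup>2)"
    by (intro sum_mono power_mono le) auto
  also have "\<dots> = (c * vec_norm v)\<^sup>2" by (simp add: power_mult_distrib norm_slices[OF v] sum_distrib_left)
  finally show ?thesis by (rule power2_le_imp_le) (simp add: c)
qed

lemma norm_column_apply_le:
  assumes X: "X \<in> carrier_mat (g * N) K" and c: "0 \<le> c" "mat_norm X \<le> c" and u: "u \<in> carrier_vec (d * K)"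
  shows "vec_norm (column_apply g d N K X u) \<le> c * vec_norm u"
proof -
  define U where "U q = vec K (\<lambda>l. u $ (q * K + l))" for q
  have U: "U q \<in> carrier_vec K" for q by (simp add: U_def)
  let ?v = "column_apply g d N K X u"
  have "(vec_norm ?v)\<^sup>2 = (\<Sum>k<(g * d) * N. (cmod (?v $ k))\<^sup>2)"
    unfolding vec_norm_sq[OF column_apply_carrier] by (simp add: mult.commute)
  also have "\<dots> = (\<Sum>j<g. \<Sum>q<d. \<Sum>m<N. (cmod (?v $ ((j * d + q) * N + m)))\<^sup>2)"
    unfolding sum_blocks ..
  also have "\<dots> = (\<Sum>j<g. \<Sum>q<d. \<Sum>m<N. (cmod ((X *\<^sub>v U q) $ (j * N + m)))\<^sup>2)"
  proof (intro sum.cong refl)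
    fix j q m assume "j \<in> {..<g}" "q \<in> {..<d}" "m \<in> {..<N}"
    then have jqm: "j < g" "q < d" "m < N" by auto
    show "(cmod (?v $ ((j * d + q) * N + m)))\<^sup>2 = (cmod ((X *\<^sub>v U q) $ (j * N + m)))\<^sup>2"
      unfolding column_apply_index[OF jqm] mat_mult_vec_index[OF X U block_index_less[OF jqm(1,3)]]
      by (simp add: U_def)
  qed
  also have "\<dots> = (\<Sum>q<d. \<Sum>j<g. \<Sum>m<N. (cmod ((X *\<^sub>v U q) $ (j * N + m)))\<^sup>2)" by (rule sum.swap)
  also have "\<dots> = (\<Sum>q<d. (vec_norm (X *\<^sub>v U q))\<^sup>2)"
    unfolding vec_norm_sq[OF mult_mat_vec_carrier[OF X U]] sum_blocks ..
  also have "\<dots> \<le> (\<Sum>q<d. (c * vec_norm (U q))\<^sup>2)"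
  proof (intro sum_mono power_mono)
    fix q
    show "vec_norm (X *\<^sub>v U q) \<le> c * vec_norm (U q)"
      using mat_norm_bound[OF X U, of q] mult_right_mono[OF c(2) vec_norm_nonneg, of "U q"] by linarith
  qed simp
  also have "\<dots> = (c * vec_norm u)\<^sup>2"
  proof -
    have "(\<Sum>q<d. (vec_norm (U q))\<^sup>2) = (vec_norm u)\<^sup>2"
      unfolding vec_norm_sq[OF U] vec_norm_sq[OF u] sum_blocks by (simp add: U_def)
    then show ?thesis by (simp add: power_mult_distrib flip: sum_distrib_left)
  qed
  finally show ?thesis by (rule power2_le_imp_le) (simp add: c)
qed

context contractive_series
begin

text \<open>\<open>S\<close> and \<open>P\<close> are the subspace and the polynomials of the theorem, and \<open>Pr\<close> is the projection onto
  the orthogonal complement of \<open>S\<close>. Since \<open>Q\<^sub>w\<close> vanishes on \<open>S\<close> for nonempty \<open>w\<close>, it does not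
  matter whether \<open>Pr\<close> is absorbed into \<open>P\<close>.\<close>

abbreviation S :: "complex vec set" where
  "S \<equiv> iso_space (Q [])"

abbreviation Pr :: "complex mat" where
  "Pr \<equiv> proj_mat (d * g) (orth_compl (d * g) S)"

abbreviation P :: "nat \<Rightarrow> nat list \<Rightarrow> complex mat" where
  "P \<alpha> \<equiv> left_part g d' d b (\<alpha> - 1)"

lemma S_subspace: "lin_subspace (d * g) S"
  by (rule iso_space_lin_subspace[OF left_coeff_carrier])

lemma S_carrier: "s \<in> S \<Longrightarrow> s \<in> carrier_vec (d * g)"
  using S_subspace by (auto simp: lin_subspace_def)

lemma S_orth_subspace: "lin_subspace (d * g) (orth_compl (d * g) S)"
  using S_carrier by (intro lin_subspace_orth_compl) auto

lemma proj_carrier: "Pr \<in> carrier_mat (d * g) (d * g)"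
  by (rule proj_mat_carrier[OF S_orth_subspace])

lemma Q_mult_proj_vec:
  assumes w: "w \<in> nc_words g" "w \<noteq> []" and v: "v \<in> carrier_vec (d * g)"
  shows "Q w *\<^sub>v (Pr *\<^sub>v v) = Q w *\<^sub>v v"
proof -
  have pv: "Pr *\<^sub>v v \<in> carrier_vec (d * g)" by (rule mult_mat_vec_carrier[OF proj_carrier v])
  have "Q w *\<^sub>v (v - Pr *\<^sub>v v) = 0\<^sub>v d'"
    by (rule Q_vanishes_on_iso_space[OF w residual_orth_compl_in[OF S_subspace v]])
  then have "Q w *\<^sub>v v - Q w *\<^sub>v (Pr *\<^sub>v v) = 0\<^sub>v d'"
    using mult_minus_distrib_mat_vec[OF left_coeff_carrier v pv] by simp
  then show ?thesis
    using vec_diff_eq_0 mult_mat_vec_carrier[OF left_coeff_carrier v] mult_mat_vec_carrier[OF left_coeff_carrier pv]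
    by metis
qed

lemma Q_mult_proj:
  assumes "w \<in> nc_words g" "w \<noteq> []"
  shows "Q w * Pr = Q w"
proof (rule mat_eq_if_mult_vec_eq[OF mult_carrier_mat[OF left_coeff_carrier proj_carrier] left_coeff_carrier])
  fix v :: "complex vec" assume v: "v \<in> carrier_vec (d * g)"
  show "(Q w * Pr) *\<^sub>v v = Q w *\<^sub>v v"
    unfolding assoc_mult_mat_vec[OF left_coeff_carrier proj_carrier v] by (rule Q_mult_proj_vec[OF assms v])
qed

lemma Qpart_carrier:
  assumes X: "X \<in> carrier_mat R N" and v: "v \<in> carrier_vec (d * g * N)"
  shows "Qpart k X *\<^sub>v v \<in> carrier_vec (d' * N)"
  by (rule mult_mat_vec_carrier[OF nc_poly_eval_carrier[OF X] v])

lemma Qpart_index: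
  assumes X: "X \<in> carrier_mat R N" and v: "v \<in> carrier_vec (d * g * N)" and p: "p < d'" and m: "m < N"
  shows "(Qpart k X *\<^sub>v v) $ (p * N + m)
    = (\<Sum>w\<in>words g k. \<Sum>l<N. word_eval X w $$ (m,l) * (Q w *\<^sub>v slice (d * g) N v l) $ p)"
  unfolding nc_poly_eval_mult_vec[OF homogeneous_left_part X v p m]
  by (intro sum.cong refl) (simp add: left_part_def words_def)

lemma Qpart_0:
  assumes X: "X \<in> carrier_mat R N" and v: "v \<in> carrier_vec (d * g * N)"
  shows "Qpart 0 X *\<^sub>v v = (Q [] \<otimes>\<^sub>k 1\<^sub>m N) *\<^sub>v v"
proof (rule eq_vecI)
  fix k assume "k < dim_vec ((Q [] \<otimes>\<^sub>k 1\<^sub>m N) *\<^sub>v v)"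
  then have "k < d' * N" by (simp add: kron_def left_coeff_def)
  then obtain p m where k: "k = p * N + m" "p < d'" "m < N" by (rule block_index_cases)
  show "(Qpart 0 X *\<^sub>v v) $ k = ((Q [] \<otimes>\<^sub>k 1\<^sub>m N) *\<^sub>v v) $ k"
    unfolding k(1) Qpart_index[OF X v k(2,3)] kron_mult_vec_index[OF left_coeff_carrier one_carrier_mat v k(2,3)]
    by (simp add: words_0 word_eval_Nil[OF X] del: index_mult_mat_vec)
qed (use X in \<open>simp add: nc_poly_eval_def kron_def left_coeff_def\<close>)

lemma Qpart_proj:
  assumes X: "X \<in> carrier_mat R N" and v: "v \<in> carrier_vec (d * g * N)" and k: "k \<noteq> 0"
  shows "Qpart k X *\<^sub>v ((Pr \<otimes>\<^sub>k 1\<^sub>m N) *\<^sub>v v) = Qpart k X *\<^sub>v v"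
proof (rule eq_vecI)
  have pv: "(Pr \<otimes>\<^sub>k 1\<^sub>m N) *\<^sub>v v \<in> carrier_vec (d * g * N)"
    by (rule mult_mat_vec_carrier[OF kron_carrier[OF proj_carrier one_carrier_mat] v])
  fix i assume "i < dim_vec (Qpart k X *\<^sub>v v)"
  then have "i < d' * N" using X by (simp add: nc_poly_eval_def)
  then obtain p m where i: "i = p * N + m" "p < d'" "m < N" by (rule block_index_cases)
  show "(Qpart k X *\<^sub>v ((Pr \<otimes>\<^sub>k 1\<^sub>m N) *\<^sub>v v)) $ i = (Qpart k X *\<^sub>v v) $ i"
    unfolding i(1) Qpart_index[OF X v i(2,3)] Qpart_index[OF X pv i(2,3)]
  proof (intro sum.cong refl)
    fix w l assume "w \<in> words g k" "l \<in> {..<N}"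
    then have w: "w \<in> nc_words g" "w \<noteq> []" and l: "l < N" using k by (auto simp: words_def)
    show "word_eval X w $$ (m,l) * (Q w *\<^sub>v slice (d * g) N ((Pr \<otimes>\<^sub>k 1\<^sub>m N) *\<^sub>v v) l) $ p
      = word_eval X w $$ (m,l) * (Q w *\<^sub>v slice (d * g) N v l) $ p"
      unfolding kron_one_slice[OF proj_carrier v l] Q_mult_proj_vec[OF w slice_carrier] ..
  qed
qed simp

text \<open>The sum \<open>\<Sum>\<^sub>\<alpha>\<^sub>\<ge>\<^sub>2 P\<^sub>\<alpha>(X) v\<close> converges for all \<open>v\<close>, and adding
  \<open>(Q\<^sub>[\<^sub>] \<otimes> I) v\<close> to it gives \<open>Q(X) v\<close>.\<close>

lemma tail_sums:
  assumes N: "N \<ge> 1" and X: "X \<in> int_ball g N" and v: "v \<in> carrier_vec (d * g * N)"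
  shows "vec_sums (d' * N) (\<lambda>k. Qpart (Suc k) X *\<^sub>v v) (tail_apply g d' (d * g) P X v)"
    and "vec_norm ((Q [] \<otimes>\<^sub>k 1\<^sub>m N) *\<^sub>v v + tail_apply g d' (d * g) P X v) \<le> vec_norm v"
proof -
  have Xc: "X \<in> carrier_mat (g * N) N" using X by (auto simp: nc_nbhd_def nc_mats_def)
  obtain u where u: "vec_sums (d' * N) (\<lambda>k. Qpart k X *\<^sub>v v) u" and un: "vec_norm u \<le> vec_norm v"
    using schwarz[OF N X v] by blast
  have uc: "u \<in> carrier_vec (d' * N)" using u by (simp add: vec_sums_def)
  note c0 = Qpart_carrier[OF Xc v, of 0]
  let ?T = "tail_apply g d' (d * g) P X v"
  have Tc: "?T \<in> carrier_vec (d' * N)" using Xc by (simp add: tail_apply_def)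
  have s: "(\<lambda>k. (Qpart (Suc k) X *\<^sub>v v) $ i) sums (u $ i - (Qpart 0 X *\<^sub>v v) $ i)" if "i < d' * N" for i
    using u that sums_Suc_iff[of "\<lambda>k. (Qpart k X *\<^sub>v v) $ i" "u $ i - (Qpart 0 X *\<^sub>v v) $ i"]
    unfolding vec_sums_def by (simp del: index_mult_mat_vec)
  have T: "?T $ i = u $ i - (Qpart 0 X *\<^sub>v v) $ i" if "i < d' * N" for i
    using s[OF that] that Xc by (simp add: tail_apply_def sums_iff del: index_mult_mat_vec)
  show "vec_sums (d' * N) (\<lambda>k. Qpart (Suc k) X *\<^sub>v v) ?T"
    unfolding vec_sums_def using Qpart_carrier[OF Xc v] Tc s T by (simp del: index_mult_mat_vec)
  have "Qpart 0 X *\<^sub>v v + ?T = u"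
    using uc Tc c0 T by (intro eq_vecI) (simp_all del: index_mult_mat_vec)
  then show "vec_norm ((Q [] \<otimes>\<^sub>k 1\<^sub>m N) *\<^sub>v v + ?T) \<le> vec_norm v"
    using un unfolding Qpart_0[OF Xc v] by simp
qed

lemma tail_converges:
  assumes "N \<ge> 1" "X \<in> int_ball g N" "v \<in> carrier_vec (d * g * N)"
  shows "tail_converges g d' (d * g) P X v"
proof -
  have "dim_col X = N" using assms(2) by (auto simp: nc_nbhd_def nc_mats_def)
  then show ?thesis unfolding tail_converges_def using tail_sums(1)[OF assms] by auto
qed

lemma hom_tail_sums:
  assumes N: "N \<ge> 1" and X: "X \<in> int_ball g N" and u: "u \<in> carrier_vec (d * N)"
  shows "vec_sums (d' * N) (\<lambda>\<alpha>. nc_poly_eval g d' d (hom_part d' d b (\<alpha> + 2)) X *\<^sub>v u)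
    (tail_apply g d' (d * g) P X ((Pr \<otimes>\<^sub>k 1\<^sub>m N) *\<^sub>v (x_eval g d X *\<^sub>v u)))"
proof -
  have Xc: "X \<in> carrier_mat (g * N) N" using X by (auto simp: nc_nbhd_def nc_mats_def)
  have xu: "x_eval g d X *\<^sub>v u \<in> carrier_vec (d * g * N)"
    by (rule mult_mat_vec_carrier[OF x_eval_carrier[OF Xc] u])
  have pv: "(Pr \<otimes>\<^sub>k 1\<^sub>m N) *\<^sub>v (x_eval g d X *\<^sub>v u) \<in> carrier_vec (d * g * N)"
    by (rule mult_mat_vec_carrier[OF kron_carrier[OF proj_carrier one_carrier_mat] xu])
  have "nc_poly_eval g d' d (hom_part d' d b (\<alpha> + 2)) X *\<^sub>v u
      = Qpart (Suc \<alpha>) X *\<^sub>v ((Pr \<otimes>\<^sub>k 1\<^sub>m N) *\<^sub>v (x_eval g d X *\<^sub>v u))" for \<alpha>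
    using hom_part_eq_left_part_x_eval[OF coeff Xc u, of "Suc \<alpha>"] Qpart_proj[OF Xc xu, of "Suc \<alpha>"] by simp
  then show ?thesis using tail_sums(1)[OF N X pv] by simp
qed

text \<open>With \<open>M = Q\<^sub>[\<^sub>]\<close>, \<open>M\<^sup>* M\<close> is the identity on \<open>S\<close>, so \<open>M\<close> preserves inner products with vectors of \<open>S\<close>.\<close>

lemma orthogonal_linear_linear:
  assumes u: "u \<in> tensor_space (d * g) S N" and v: "v \<in> tensor_space (d * g) (orth_compl (d * g) S) N"
  shows "((Q [] \<otimes>\<^sub>k 1\<^sub>m N) *\<^sub>v u) \<bullet>c ((Q [] \<otimes>\<^sub>k 1\<^sub>m N) *\<^sub>v v) = 0"
proof -
  have uc: "u \<in> carrier_vec (d * g * N)" and us: "\<And>m. m < N \<Longrightarrow> slice (d * g) N u m \<in> S"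
    using u by (auto simp: tensor_space_eq[OF S_subspace])
  have vc: "v \<in> carrier_vec (d * g * N)" and vs: "\<And>m. m < N \<Longrightarrow> slice (d * g) N v m \<in> orth_compl (d * g) S"
    using v by (auto simp: tensor_space_eq[OF S_orth_subspace])
  note QN = kron_carrier[OF left_coeff_carrier one_carrier_mat]
  show ?thesis
    unfolding cip_slices[OF mult_mat_vec_carrier[OF QN uc] mult_mat_vec_carrier[OF QN vc]]
  proof (rule sum.neutral, intro ballI)
    fix m assume "m \<in> {..<N}"
    then have m: "m < N" by simp
    have "slice (d * g) N u m \<bullet>c slice (d * g) N v m = cnj (slice (d * g) N v m \<bullet>c slice (d * g) N u m)"
      by (rule cip_cnj[OF slice_carrier slice_carrier])
    also have "\<dots> = 0" using us[OF m] vs[OF m] by (simp add: orth_compl_def)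
    finally show "slice d' N ((Q [] \<otimes>\<^sub>k 1\<^sub>m N) *\<^sub>v u) m \<bullet>c slice d' N ((Q [] \<otimes>\<^sub>k 1\<^sub>m N) *\<^sub>v v) m = 0"
      unfolding kron_one_slice[OF left_coeff_carrier uc m] kron_one_slice[OF left_coeff_carrier vc m]
      by (simp add: iso_space_cip[OF left_coeff_carrier us[OF m]])
  qed
qed

lemma orthogonal_linear_Qpart:
  assumes u: "u \<in> tensor_space (d * g) S N" and v: "v \<in> carrier_vec (d * g * N)"
    and X: "X \<in> carrier_mat R N" and k: "k \<noteq> 0"
  shows "((Q [] \<otimes>\<^sub>k 1\<^sub>m N) *\<^sub>v u) \<bullet>c (Qpart k X *\<^sub>v v) = 0"
proof -
  have uc: "u \<in> carrier_vec (d * g * N)" and us: "\<And>m. m < N \<Longrightarrow> slice (d * g) N u m \<in> S"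
    using u by (auto simp: tensor_space_eq[OF S_subspace])
  note QN = kron_carrier[OF left_coeff_carrier one_carrier_mat]
  show ?thesis
    unfolding cip_slices[OF mult_mat_vec_carrier[OF QN uc] Qpart_carrier[OF X v]]
  proof (rule sum.neutral, intro ballI)
    fix m assume "m \<in> {..<N}"
    then have m: "m < N" by simp
    define a where "a = Q [] *\<^sub>v slice (d * g) N u m"
    have a: "a \<in> carrier_vec d'" unfolding a_def by (rule mult_mat_vec_carrier[OF left_coeff_carrier slice_carrier])
    have orth: "a \<bullet>c (Q w *\<^sub>v slice (d * g) N v l) = 0" if "w \<in> words g k" for w l
      unfolding a_def using that k by (intro Q_orthogonal_to_iso_image us m) (auto simp: words_def)
    have "a \<bullet>c slice d' N (Qpart k X *\<^sub>v v) m
        = (\<Sum>p<d'. \<Sum>w\<in>words g k. \<Sum>l<N. cnj (word_eval X w $$ (m,l)) * (a $ p * cnj ((Q w *\<^sub>v slice (d * g) N v l) $ p)))"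
      unfolding cip_sum[OF a slice_carrier]
      by (intro sum.cong refl) (simp add: Qpart_index[OF X v _ m] sum_distrib_left mult_ac del: index_mult_mat_vec)
    also have "\<dots> = (\<Sum>w\<in>words g k. \<Sum>p<d'. \<Sum>l<N. cnj (word_eval X w $$ (m,l)) * (a $ p * cnj ((Q w *\<^sub>v slice (d * g) N v l) $ p)))"
      by (rule sum.swap)
    also have "\<dots> = (\<Sum>w\<in>words g k. \<Sum>l<N. \<Sum>p<d'. cnj (word_eval X w $$ (m,l)) * (a $ p * cnj ((Q w *\<^sub>v slice (d * g) N v l) $ p)))"
      by (rule sum.cong[OF refl], rule sum.swap)
    also have "\<dots> = (\<Sum>w\<in>words g k. \<Sum>l<N. cnj (word_eval X w $$ (m,l)) * (a \<bullet>c (Q w *\<^sub>v slice (d * g) N v l)))"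
      unfolding cip_sum[OF a mult_mat_vec_carrier[OF left_coeff_carrier slice_carrier]]
      by (simp add: sum_distrib_left del: index_mult_mat_vec)
    also have "\<dots> = 0" using orth by simp
    finally show "slice d' N ((Q [] \<otimes>\<^sub>k 1\<^sub>m N) *\<^sub>v u) m \<bullet>c slice d' N (Qpart k X *\<^sub>v v) m = 0"
      unfolding kron_one_slice[OF left_coeff_carrier uc m] a_def .
  qed
qed

lemma orthogonal_linear_tail:
  assumes u: "u \<in> tensor_space (d * g) S N" and N: "N \<ge> 1" and X: "X \<in> int_ball g N"
    and v: "v \<in> carrier_vec (d * g * N)"
  shows "((Q [] \<otimes>\<^sub>k 1\<^sub>m N) *\<^sub>v u) \<bullet>c tail_apply g d' (d * g) P X v = 0"
proof -
  have Xc: "X \<in> carrier_mat (g * N) N" using X by (auto simp: nc_nbhd_def nc_mats_def)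
  have uc: "u \<in> carrier_vec (d * g * N)" using u by (auto simp: tensor_space_eq[OF S_subspace])
  define a where "a = (Q [] \<otimes>\<^sub>k 1\<^sub>m N) *\<^sub>v u"
  have a: "a \<in> carrier_vec (d' * N)"
    unfolding a_def by (rule mult_mat_vec_carrier[OF kron_carrier[OF left_coeff_carrier one_carrier_mat] uc])
  let ?T = "tail_apply g d' (d * g) P X v"
  note s = tail_sums(1)[OF N X v]
  have T: "?T \<in> carrier_vec (d' * N)" using s by (simp add: vec_sums_def)
  have "(\<lambda>k. \<Sum>i<d' * N. a $ i * cnj ((Qpart (Suc k) X *\<^sub>v v) $ i)) sums (\<Sum>i<d' * N. a $ i * cnj (?T $ i))"
  proof (intro sums_sum sums_mult)
    fix i assume "i \<in> {..<d' * N}"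
    then have "(\<lambda>k. (Qpart (Suc k) X *\<^sub>v v) $ i) sums (?T $ i)" using s by (simp add: vec_sums_def del: index_mult_mat_vec)
    then show "(\<lambda>k. cnj ((Qpart (Suc k) X *\<^sub>v v) $ i)) sums cnj (?T $ i)" unfolding sums_cnj .
  qed
  moreover have "(\<Sum>i<d' * N. a $ i * cnj ((Qpart (Suc k) X *\<^sub>v v) $ i)) = 0" for k
    using orthogonal_linear_Qpart[OF u v Xc, of "Suc k"]
    unfolding a_def[symmetric] cip_sum[OF a Qpart_carrier[OF Xc v]] by simp
  ultimately have "(\<lambda>k. 0) sums (\<Sum>i<d' * N. a $ i * cnj (?T $ i))" by simp
  then have "(\<Sum>i<d' * N. a $ i * cnj (?T $ i)) = 0" using sums_unique2 sums_zero by blast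
  then show ?thesis unfolding a_def[symmetric] cip_sum[OF a T] .
qed

end

section \<open>Composition with a pencil\<close>

lemma pencil_eval_carrier:
  "X \<in> carrier_mat R N \<Longrightarrow> pencil_eval g d' d A X \<in> carrier_mat (d' * N) (d * N)"
  by (auto simp: pencil_eval_def)

lemma pencil_eval_index:
  assumes A: "is_pencil g d' d A" and X: "X \<in> carrier_mat R N"
    and ij: "i < d'" "j < d" "m < N" "l < N"
  shows "pencil_eval g d' d A X $$ (i * N + m, j * N + l) = (\<Sum>k<g. A k $$ (i,j) * X $$ (k * N + m, l))"
proof -
  have "pencil_eval g d' d A X $$ (i * N + m, j * N + l) = (\<Sum>k<g. (A k \<otimes>\<^sub>k component X k) $$ (i * N + m, j * N + l))"
    using X ij by (simp add: pencil_eval_def block_index_less)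
  also have "\<dots> = (\<Sum>k<g. A k $$ (i,j) * X $$ (k * N + m, l))"
  proof (intro sum.cong refl)
    fix k assume "k \<in> {..<g}"
    then have Ak: "A k \<in> carrier_mat d' d" using A by (simp add: is_pencil_def)
    show "(A k \<otimes>\<^sub>k component X k) $$ (i * N + m, j * N + l) = A k $$ (i,j) * X $$ (k * N + m, l)"
      unfolding kron_index[OF Ak component_carrier[OF X] ij] component_index[OF X ij(3,4)] ..
  qed
  finally show ?thesis .
qed

lemma radially_holomorphic_pencil:
  assumes A: "is_pencil g d' d A" and f: "radially_holomorphic g g 1 f"
    and fc: "\<And>N X. N \<ge> 1 \<Longrightarrow> X \<in> int_ball g N \<Longrightarrow> f X \<in> carrier_mat (g * N) N"
  shows "radially_holomorphic g d' d (pencil_eval g d' d A \<circ> f)"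
  unfolding radially_holomorphic_def
proof (intro allI impI ballI)
  fix N X \<rho> i' j'
  assume N: "(1::nat) \<le> N" and X: "X \<in> nc_mats g 1 N" and \<rho>: "\<rho> > 0"
    and ball: "\<forall>z. cmod z < \<rho> \<longrightarrow> z \<cdot>\<^sub>m X \<in> int_ball g N" and "i' < d' * N" "j' < d * N"
  then obtain i m j l where ij: "i' = i * N + m" "i < d'" "m < N" "j' = j * N + l" "j < d" "l < N"
    by (metis block_index_cases)
  have hol: "(\<lambda>z. f (z \<cdot>\<^sub>m X) $$ (k * N + m, l)) holomorphic_on ball 0 \<rho>" if "k < g" for k
  proof -
    have "\<forall>i<g * N. \<forall>j<1 * N. (\<lambda>z. f (z \<cdot>\<^sub>m X) $$ (i,j)) holomorphic_on ball 0 \<rho>"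
      using f N X \<rho> ball unfolding radially_holomorphic_def by blast
    then show ?thesis using ij block_index_less[OF that ij(3)] by simp
  qed
  have "(\<lambda>z. \<Sum>k<g. A k $$ (i,j) * f (z \<cdot>\<^sub>m X) $$ (k * N + m, l)) holomorphic_on ball 0 \<rho>"
    by (intro holomorphic_intros hol) auto
  then show "(\<lambda>z. (pencil_eval g d' d A \<circ> f) (z \<cdot>\<^sub>m X) $$ (i', j')) holomorphic_on ball 0 \<rho>"
  proof (rule holomorphic_transform)
    fix z :: complex assume "z \<in> ball 0 \<rho>"
    then have "f (z \<cdot>\<^sub>m X) \<in> carrier_mat (g * N) N" using ball by (intro fc[OF N]) auto
    from pencil_eval_index[OF A this ij(2,5,3,6)]
    show "(\<Sum>k<g. A k $$ (i,j) * f (z \<cdot>\<^sub>m X) $$ (k * N + m, l)) = (pencil_eval g d' d A \<circ> f) (z \<cdot>\<^sub>m X) $$ (i', j')"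
      by (simp add: ij)
  qed
qed

lemma nc_expansion_pencil:
  assumes A: "is_pencil g d' d A" and a: "nc_expansion g g 1 f a"
  shows "nc_expansion g d' d (pencil_eval g d' d A \<circ> f)
    (\<lambda>w. mat d' d (\<lambda>(i,j). \<Sum>k<g. A k $$ (i,j) * a w $$ (k,0)))" (is "nc_expansion g d' d ?h ?b")
proof -
  have ac: "\<forall>w\<in>nc_words g. a w \<in> carrier_mat g 1" using a by (simp add: nc_expansion_def)
  have bc: "\<forall>w\<in>nc_words g. ?b w \<in> carrier_mat d' d" by simp
  obtain \<epsilon> where \<epsilon>: "\<epsilon> > 0" and near: "\<And>N X. N \<ge> 1 \<Longrightarrow> X \<in> nc_nbhd g \<epsilon> N \<Longrightarrow>
      mat_sums (g * N) (1 * N) (\<lambda>\<alpha>. nc_poly_eval g g 1 (hom_part g 1 a \<alpha>) X) (f X)"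
    using a by (auto simp: nc_expansion_def)
  have "mat_sums (d' * N) (d * N) (\<lambda>\<alpha>. nc_poly_eval g d' d (hom_part d' d ?b \<alpha>) X) (?h X)"
    if N: "N \<ge> 1" and X: "X \<in> nc_nbhd g \<epsilon> N" for N X
    unfolding mat_sums_def
  proof (intro conjI allI impI)
    have Xc: "X \<in> carrier_mat (g * N) N" using X by (simp add: nc_nbhd_def nc_mats_def)
    have fX: "f X \<in> carrier_mat (g * N) N" using near[OF N X] by (simp add: mat_sums_def)
    show "nc_poly_eval g d' d (hom_part d' d ?b \<alpha>) X \<in> carrier_mat (d' * N) (d * N)" for \<alpha>
      by (rule nc_poly_eval_carrier[OF Xc])
    show "?h X \<in> carrier_mat (d' * N) (d * N)" using pencil_eval_carrier[OF fX] by simp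
    fix i' j' assume "i' < d' * N" "j' < d * N"
    then obtain i m j l where ij: "i' = i * N + m" "i < d'" "m < N" "j' = j * N + l" "j < d" "l < N"
      by (metis block_index_cases)
    let ?H = "\<lambda>\<alpha>. nc_poly_eval g g 1 (hom_part g 1 a \<alpha>) X"
    have "(\<lambda>\<alpha>. \<Sum>k<g. A k $$ (i,j) * ?H \<alpha> $$ (k * N + m, 0 * N + l)) sums (\<Sum>k<g. A k $$ (i,j) * f X $$ (k * N + m, l))"
      using near[OF N X] ij by (intro sums_sum sums_mult) (auto simp: mat_sums_def block_index_less)
    also have "(\<Sum>k<g. A k $$ (i,j) * f X $$ (k * N + m, l)) = ?h X $$ (i', j')"
      using pencil_eval_index[OF A fX ij(2,5,3,6)] ij by simp
    also have "(\<lambda>\<alpha>. \<Sum>k<g. A k $$ (i,j) * ?H \<alpha> $$ (k * N + m, 0 * N + l))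
        = (\<lambda>\<alpha>. nc_poly_eval g d' d (hom_part d' d ?b \<alpha>) X $$ (i', j'))"
    proof
      fix \<alpha>
      have "(\<Sum>k<g. A k $$ (i,j) * ?H \<alpha> $$ (k * N + m, 0 * N + l))
          = (\<Sum>k<g. \<Sum>w\<in>words g \<alpha>. A k $$ (i,j) * (a w $$ (k,0) * word_eval X w $$ (m,l)))"
      proof (intro sum.cong refl)
        fix k assume "k \<in> {..<g}"
        then have k: "k < g" by simp
        show "A k $$ (i,j) * ?H \<alpha> $$ (k * N + m, 0 * N + l)
            = (\<Sum>w\<in>words g \<alpha>. A k $$ (i,j) * (a w $$ (k,0) * word_eval X w $$ (m,l)))"
          using hom_part_eval_index[OF ac Xc k _ ij(3,6), of 0 \<alpha>] by (simp only: zero_less_one sum_distrib_left)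
      qed
      also have "\<dots> = (\<Sum>w\<in>words g \<alpha>. \<Sum>k<g. A k $$ (i,j) * (a w $$ (k,0) * word_eval X w $$ (m,l)))"
        by (rule sum.swap)
      also have "\<dots> = nc_poly_eval g d' d (hom_part d' d ?b \<alpha>) X $$ (i', j')"
        unfolding ij(1,4) hom_part_eval_index[OF bc Xc ij(2,5,3,6)]
        using ij by (intro sum.cong refl) (simp add: sum_distrib_right mult.assoc)
      finally show "(\<Sum>k<g. A k $$ (i,j) * ?H \<alpha> $$ (k * N + m, 0 * N + l))
          = nc_poly_eval g d' d (hom_part d' d ?b \<alpha>) X $$ (i', j')" .
    qed
    finally show "(\<lambda>\<alpha>. nc_poly_eval g d' d (hom_part d' d ?b \<alpha>) X $$ (i', j')) sums ?h X $$ (i', j')" .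
  qed
  then show ?thesis unfolding nc_expansion_def using bc \<epsilon> by blast
qed

section \<open>The boundary condition\<close>

text \<open>Subadditivity of the rank, as \<open>I\<close> is the sum of two matrices of this shape.\<close>

lemma rank_corner_unit_ge_1:
  assumes D: "D = mat 2 2 (\<lambda>(a,b). if a = 1 \<and> b = 1 then 1 else (0::complex))"
  shows "1 \<le> vec_space.rank 2 D"
proof -
  interpret V: vec_space "TYPE(complex)" 2 .
  define E where "E = mat 2 2 (\<lambda>(a,b). if a = 0 \<and> b = 0 then 1 else (0::complex))"
  have sum: "D + E = 1\<^sub>m 2"
    by (intro eq_matI) (auto simp: D E_def less_2_cases_iff)
  have "V.rank (1\<^sub>m 2) = 2" using V.det_rank_iff[of "1\<^sub>m 2"] by simp
  moreover have "V.rank (D + E) \<le> V.rank D + V.rank E"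
    by (rule V.rank_subadditive[of _ 2]) (simp_all add: D E_def)
  moreover have "V.rank E \<le> 1"
    by (rule V.rank_le_1_product_entries[of _ 2 "\<lambda>a. if a = 0 then 1 else 0" "\<lambda>a. if a = 0 then 1 else 0"])
      (auto simp: E_def)
  ultimately show ?thesis unfolding sum by linarith
qed

lemma chain_mat_in_semi_dist_bdry:
  assumes g: "g \<ge> 1"
  shows "chain_mat g [0] \<in> semi_dist_bdry g 2"
proof -
  let ?X = "chain_mat g [0]"
  have Xc: "?X \<in> carrier_mat (g * 2) 2" using chain_mat_carrier[of g "[0]"] by (simp add: numeral_2_eq_2)
  define D where "D = mat 2 2 (\<lambda>(a,b). if a = 1 \<and> b = 1 then 1 else (0::complex))"
  have D: "mat_adjoint ?X * ?X = D"
  proof (rule eq_matI)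
    fix a b assume "a < dim_row D" "b < dim_col D"
    then have ab: "a < 2" "b < 2" by (auto simp: D_def)
    have "(mat_adjoint ?X * ?X) $$ (a,b) = (\<Sum>k<g * 2. cnj (?X $$ (k,a)) * ?X $$ (k,b))"
      using Xc mat_adjoint_carrier[OF Xc] ab
      by (auto simp: scalar_prod_def lessThan_atLeast0 mat_adjoint_index[OF Xc] intro!: sum.cong)
    also have "\<dots> = (\<Sum>j<g. \<Sum>i<2. cnj (?X $$ (j * 2 + i,a)) * ?X $$ (j * 2 + i,b))" by (rule sum_blocks)
    also have "\<dots> = (\<Sum>j<g. \<Sum>i<2::nat. if j = 0 then if i = 0 \<and> a = 1 \<and> b = 1 then 1 else 0 else 0)"
    proof (rule sum.cong[OF refl], rule sum.cong[OF refl])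
      fix j i :: nat assume "j \<in> {..<g}" "i \<in> {..<2}"
      then show "cnj (?X $$ (j * 2 + i,a)) * ?X $$ (j * 2 + i,b)
          = (if j = 0 then if i = 0 \<and> a = 1 \<and> b = 1 then 1 else 0 else 0)"
        using chain_mat_index[of j g i "[0]" a] chain_mat_index[of j g i "[0]" b] ab by (auto simp: numeral_2_eq_2)
    qed
    also have "\<dots> = (\<Sum>j<g. if j = 0 then \<Sum>i<2::nat. if i = 0 \<and> a = 1 \<and> b = 1 then 1 else 0 else 0)"
      by (intro sum.cong refl) simp
    also have "\<dots> = D $$ (a,b)" using g ab by (simp add: D_def numeral_2_eq_2)
    finally show "(mat_adjoint ?X * ?X) $$ (a,b) = D $$ (a,b)" .
  qed (use Xc mat_adjoint_carrier[OF Xc] in \<open>auto simp: D_def\<close>)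
  have "is_projection D"
    unfolding is_projection_def
  proof (intro conjI)
    have Dc: "D \<in> carrier_mat 2 2" by (simp add: D_def)
    show "square_mat D" by (simp add: D_def)
    show "D * D = D"
      by (rule eq_matI) (auto simp: D_def scalar_prod_def numeral_2_eq_2 less_Suc_eq)
    show "mat_adjoint D = D"
    proof (rule eq_matI)
      fix a b assume "a < dim_row D" "b < dim_col D"
      then have "a < 2" "b < 2" using Dc by auto
      then show "mat_adjoint D $$ (a,b) = D $$ (a,b)"
        unfolding mat_adjoint_index[OF Dc \<open>a < 2\<close> \<open>b < 2\<close>] by (auto simp: D_def)
    qed (use Dc mat_adjoint_carrier[OF Dc] in auto)
  qed
  moreover have "mat_norm ?X \<le> 1" using g by (intro chain_mat_norm_le) auto
  ultimately show ?thesis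
    using Xc D rank_corner_unit_ge_1[OF D_def] by (simp add: semi_dist_bdry_def nc_ball_def nc_mats_def)
qed

lemma at_left_1_interval: "eventually (\<lambda>\<delta>::real. 0 < \<delta> \<and> \<delta> < 1) (at_left 1)"
  using eventually_at_left_real[of 0 "1::real"] by simp

text \<open>Words of length at least 2 vanish at the chain of a single letter, so \<open>F\<close> is affine along the
  segment from 0 to that point.\<close>

lemma chain_limit:
  assumes F: "radially_holomorphic g r c F" and b: "nc_expansion g r c F b" and g: "g \<ge> 1"
    and Fc: "\<And>N X. N \<ge> 1 \<Longrightarrow> X \<in> int_ball g N \<Longrightarrow> F X \<in> nc_mats r c N"
  defines "X \<equiv> chain_mat g [0]"
  shows "mat_tendsto (r * 2) (c * 2) (\<lambda>\<delta>::real. F (complex_of_real \<delta> \<cdot>\<^sub>m X))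
    (nc_poly_eval g r c (hom_part r c b 0) X + nc_poly_eval g r c (hom_part r c b 1) X) (at_left 1)"
  unfolding mat_tendsto_def
proof (intro allI impI)
  fix i' j' assume ij': "i' < r * 2" "j' < c * 2"
  then obtain i m j l where ij: "i' = i * 2 + m" "i < r" "m < 2" "j' = j * 2 + l" "j < c" "l < 2"
    by (metis block_index_cases)
  have bc: "\<forall>w\<in>nc_words g. b w \<in> carrier_mat r c" using b by (simp add: nc_expansion_def)
  have Xc: "X \<in> carrier_mat (g * 2) 2" using chain_mat_carrier[of g "[0]"] by (simp add: X_def numeral_2_eq_2)
  have Xn: "mat_norm X \<le> 1" using g unfolding X_def by (intro chain_mat_norm_le) auto
  let ?H = "\<lambda>\<alpha>. nc_poly_eval g r c (hom_part r c b \<alpha>) X"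
  have H: "?H \<alpha> \<in> carrier_mat (r * 2) (c * 2)" for \<alpha> by (rule nc_poly_eval_carrier[OF Xc])
  have H0: "?H \<alpha> $$ (i', j') = 0" if "\<alpha> \<ge> 2" for \<alpha>
    unfolding ij(1,4) hom_part_eval_index[OF bc Xc ij(2,5,3,6)]
  proof (rule sum.neutral, intro ballI)
    fix w assume w: "w \<in> words g \<alpha>"
    then have "word_eval X w $$ (m,l) = 0"
      using chain_mat_word_eval[of m "[0]" l w g] ij that by (auto simp: words_def X_def)
    then show "b w $$ (i,j) * word_eval X w $$ (m,l) = 0" by simp
  qed
  have "F (of_real \<delta> \<cdot>\<^sub>m X) $$ (i',j') = ?H 0 $$ (i',j') + of_real \<delta> * ?H 1 $$ (i',j')" if \<delta>: "0 < \<delta> \<and> \<delta> < 1" for \<delta> :: real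
  proof -
    have "mat_norm (of_real \<delta> \<cdot>\<^sub>m X) \<le> \<delta> * mat_norm X" using mat_norm_smult_le[OF Xc, of "of_real \<delta>"] \<delta> by simp
    also have "\<dots> \<le> \<delta>" using Xn \<delta> by (simp add: mult_left_le)
    finally have ball: "of_real \<delta> \<cdot>\<^sub>m X \<in> int_ball g 2" using Xc \<delta> by (simp add: nc_nbhd_def nc_mats_def)
    have "mat_sums (r * 2) (c * 2) (\<lambda>\<alpha>. nc_poly_eval g r c (hom_part r c b \<alpha>) (of_real \<delta> \<cdot>\<^sub>m X)) (F (of_real \<delta> \<cdot>\<^sub>m X))"
      by (rule expansion_converges_on_ball[OF F b _ ball Fc[OF _ ball]]) auto
    then have "(\<lambda>\<alpha>. nc_poly_eval g r c (hom_part r c b \<alpha>) (of_real \<delta> \<cdot>\<^sub>m X) $$ (i',j')) sums F (of_real \<delta> \<cdot>\<^sub>m X) $$ (i',j')"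
      using ij' by (simp add: mat_sums_def)
    moreover have "nc_poly_eval g r c (hom_part r c b \<alpha>) (of_real \<delta> \<cdot>\<^sub>m X) $$ (i',j') = of_real \<delta> ^ \<alpha> * ?H \<alpha> $$ (i',j')" for \<alpha>
      unfolding nc_poly_eval_smult[OF homogeneous_hom_part[OF bc] Xc] using H[of \<alpha>] ij' by simp
    ultimately have "(\<lambda>\<alpha>. of_real \<delta> ^ \<alpha> * ?H \<alpha> $$ (i',j')) sums F (of_real \<delta> \<cdot>\<^sub>m X) $$ (i',j')" by simp
    moreover have "(\<lambda>\<alpha>. of_real \<delta> ^ \<alpha> * ?H \<alpha> $$ (i',j')) sums (\<Sum>\<alpha>\<in>{0,1}. of_real \<delta> ^ \<alpha> * ?H \<alpha> $$ (i',j'))"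
      by (rule sums_finite) (auto intro!: H0)
    ultimately have "F (of_real \<delta> \<cdot>\<^sub>m X) $$ (i',j') = (\<Sum>\<alpha>\<in>{0,1}. of_real \<delta> ^ \<alpha> * ?H \<alpha> $$ (i',j'))" by (rule sums_unique2)
    then show ?thesis by simp
  qed
  then have ev: "eventually (\<lambda>\<delta>::real. ?H 0 $$ (i',j') + of_real \<delta> * ?H 1 $$ (i',j') = F (of_real \<delta> \<cdot>\<^sub>m X) $$ (i',j')) (at_left 1)"
    using at_left_1_interval by (auto elim: eventually_mono)
  have "((\<lambda>\<delta>::real. ?H 0 $$ (i',j') + of_real \<delta> * ?H 1 $$ (i',j')) \<longlongrightarrow> ?H 0 $$ (i',j') + of_real 1 * ?H 1 $$ (i',j')) (at_left 1)"
    by (intro tendsto_intros)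
  from Lim_transform_eventually[OF this ev]
  show "((\<lambda>\<delta>::real. F (of_real \<delta> \<cdot>\<^sub>m X) $$ (i',j')) \<longlongrightarrow> (?H 0 + ?H 1) $$ (i',j')) (at_left 1)"
    using H[of 0] H[of 1] ij' by simp
qed

text \<open>The radial limit of \<open>f\<close> at the chain \<open>X\<close> of a single letter exists by \<open>chain_limit\<close>, and \<open>L\<close> maps it
  to \<open>h\<^sup>(\<^sup>1\<^sup>)(X) = (M \<otimes> I) (I \<otimes> X)\<close>, where \<open>M = Q\<^sub>[\<^sub>]\<close>, which
  must have norm 1. So no \<open>c < 1\<close> bounds \<open>M\<close>.\<close>

lemma (in contractive_series) boundary_norm:
  assumes g: "g \<ge> 1" and A: "is_pencil g d' d A"
    and f: "semi_dist_pencil_ball_map g d' d A f" and h: "h = pencil_eval g d' d A \<circ> f"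
    and b: "nc_expansion g d' d h b"
    and c: "0 \<le> c" "\<And>v. v \<in> carrier_vec (d * g) \<Longrightarrow> vec_norm (Q [] *\<^sub>v v) \<le> c * vec_norm v"
  shows "1 \<le> c"
proof -
  have fa: "nc_analytic g g 1 f" using f by (simp add: semi_dist_pencil_ball_map_def)
  have fc: "f X \<in> nc_mats g 1 N" if "N \<ge> 1" "X \<in> int_ball g N" for N X
    using fa that by (simp add: nc_analytic_def)
  obtain a where a: "nc_expansion g g 1 f a" using fa by (auto simp: nc_analytic_def)
  note fr = nc_analytic_radially_holomorphic[OF fa]
  have hr: "radially_holomorphic g d' d h"
    unfolding h using fc by (intro radially_holomorphic_pencil[OF A fr]) (simp add: nc_mats_def)
  have hc: "h X \<in> nc_mats d' d N" if "N \<ge> 1" "X \<in> int_ball g N" for N X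
    using fc[OF that] pencil_eval_carrier[of "f X" "g * N" N g d' d A] by (simp add: h nc_mats_def)
  define X where "X = chain_mat g [0]"
  have Xc: "X \<in> carrier_mat (g * 2) 2" using chain_mat_carrier[of g "[0]"] by (simp add: X_def numeral_2_eq_2)
  have Xn: "mat_norm X \<le> 1" using g unfolding X_def by (intro chain_mat_norm_le) auto
  define Y where "Y = nc_poly_eval g g 1 (hom_part g 1 a 0) X + nc_poly_eval g g 1 (hom_part g 1 a 1) X"
  have Y: "Y \<in> carrier_mat (g * 2) 2" using nc_poly_eval_carrier[OF Xc, of g g 1] by (simp add: Y_def)
  have lim: "mat_tendsto (g * 2) (1 * 2) (\<lambda>\<delta>::real. f (complex_of_real \<delta> \<cdot>\<^sub>m X)) Y (at_left 1)"
    unfolding Y_def X_def by (rule chain_limit[OF fr a g fc])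
  then have "Y \<in> pencil_bdry g d' d A 2"
    using f chain_mat_in_semi_dist_bdry[OF g] Y
    unfolding semi_dist_pencil_ball_map_def nc_mats_def X_def by (metis mult_1 one_le_numeral)
  then have norm1: "mat_norm (pencil_eval g d' d A Y) = 1" by (simp add: pencil_bdry_def)
  define H where "H = nc_poly_eval g d' d (hom_part d' d b 1) X"
  have H: "H \<in> carrier_mat (d' * 2) (d * 2)" unfolding H_def by (rule nc_poly_eval_carrier[OF Xc])
  have "pencil_eval g d' d A Y = H"
  proof (rule eq_matI)
    fix i' j' assume "i' < dim_row H" "j' < dim_col H"
    then have ij': "i' < d' * 2" "j' < d * 2" using H by auto
    then obtain i m j l where ij: "i' = i * 2 + m" "i < d'" "m < 2" "j' = j * 2 + l" "j < d" "l < 2"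
      by (metis block_index_cases)
    have "((\<lambda>\<delta>::real. \<Sum>k<g. A k $$ (i,j) * f (of_real \<delta> \<cdot>\<^sub>m X) $$ (k * 2 + m, l)) \<longlongrightarrow> (\<Sum>k<g. A k $$ (i,j) * Y $$ (k * 2 + m, l))) (at_left 1)"
      using lim ij block_index_less[of _ g m 2] unfolding mat_tendsto_def by (intro tendsto_sum tendsto_mult tendsto_const) auto
    moreover have "eventually (\<lambda>\<delta>::real. (\<Sum>k<g. A k $$ (i,j) * f (of_real \<delta> \<cdot>\<^sub>m X) $$ (k * 2 + m, l)) = h (of_real \<delta> \<cdot>\<^sub>m X) $$ (i',j')) (at_left 1)"
      using at_left_1_interval
    proof eventually_elim
      case (elim \<delta>)
      have "mat_norm (of_real \<delta> \<cdot>\<^sub>m X) \<le> \<delta> * mat_norm X" using mat_norm_smult_le[OF Xc, of "of_real \<delta>"] elim by simp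
      also have "\<dots> \<le> \<delta>" using Xn elim by (simp add: mult_left_le)
      finally have "of_real \<delta> \<cdot>\<^sub>m X \<in> int_ball g 2" using Xc elim by (simp add: nc_nbhd_def nc_mats_def)
      then have "f (of_real \<delta> \<cdot>\<^sub>m X) \<in> carrier_mat (g * 2) 2" using fc[of 2] by (simp add: nc_mats_def)
      from pencil_eval_index[OF A this ij(2,5,3,6)] show ?case by (simp add: h ij)
    qed
    ultimately have "((\<lambda>\<delta>::real. h (of_real \<delta> \<cdot>\<^sub>m X) $$ (i',j')) \<longlongrightarrow> (\<Sum>k<g. A k $$ (i,j) * Y $$ (k * 2 + m, l))) (at_left 1)"
      by (rule Lim_transform_eventually)
    moreover have "((\<lambda>\<delta>::real. h (of_real \<delta> \<cdot>\<^sub>m X) $$ (i',j')) \<longlongrightarrow> H $$ (i',j')) (at_left 1)"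
      using chain_limit[OF hr b g hc] ij' H hom_part_0_eval[OF Xc]
      unfolding mat_tendsto_def H_def X_def by simp
    ultimately have "(\<Sum>k<g. A k $$ (i,j) * Y $$ (k * 2 + m, l)) = H $$ (i',j')"
      by (rule tendsto_unique[rotated]) simp
    then show "pencil_eval g d' d A Y $$ (i',j') = H $$ (i',j')"
      using pencil_eval_index[OF A Y ij(2,5,3,6)] ij by simp
  qed (use pencil_eval_carrier[OF Y, of g d' d A] H in auto)
  then have "mat_norm H = 1" using norm1 by simp
  moreover have "mat_norm H \<le> c"
  proof (rule mat_norm_le[OF H c(1)])
    fix u :: "complex vec" assume u: "u \<in> carrier_vec (d * 2)"
    have xu: "x_eval g d X *\<^sub>v u \<in> carrier_vec (d * g * 2)"
      by (rule mult_mat_vec_carrier[OF x_eval_carrier[OF Xc] u])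
    have "H *\<^sub>v u = (Q [] \<otimes>\<^sub>k 1\<^sub>m 2) *\<^sub>v (x_eval g d X *\<^sub>v u)"
      using hom_part_eq_left_part_x_eval[OF coeff Xc u, of 0] Qpart_0[OF Xc xu] by (simp add: H_def)
    then have "vec_norm (H *\<^sub>v u) \<le> c * vec_norm (x_eval g d X *\<^sub>v u)"
      using kron_one_norm_le[OF left_coeff_carrier c(1) c(2) xu] by simp
    also have "\<dots> \<le> c * vec_norm u"
      using norm_column_apply_le[OF Xc _ Xn u] x_eval_mult_vec[OF Xc u] c(1) by (intro mult_left_mono) auto
    finally show "vec_norm (H *\<^sub>v u) \<le> c * vec_norm u" .
  qed
  ultimately show ?thesis by simp
qed

section \<open>Coefficient identities\<close>

lemma formal_sum_single:
  assumes zero: "\<And>\<alpha>. \<alpha> \<noteq> a \<Longrightarrow> \<alpha> \<ge> 2 \<Longrightarrow> F \<alpha> w = 0\<^sub>m r c" and Fa: "F a w \<in> carrier_mat r c"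
  shows "formal_sum r c F w = (if a \<ge> 2 then F a w else 0\<^sub>m r c)"
proof -
  let ?T = "{\<alpha>. \<alpha> \<ge> 2 \<and> F \<alpha> w \<noteq> 0\<^sub>m r c}"
  have "?T \<subseteq> {a}" using zero by auto
  then consider "?T = {a}" "a \<ge> 2" | "?T = {}" by blast
  then show ?thesis
  proof cases
    case 1
    have "formal_sum r c F w = mat r c (\<lambda>ij. F a w $$ ij)" unfolding formal_sum_def 1(1) by simp
    also have "\<dots> = F a w" using Fa by (intro eq_matI) auto
    finally show ?thesis using 1(2) by simp
  next
    case 2
    then have "a \<ge> 2 \<Longrightarrow> F a w = 0\<^sub>m r c" by blast
    moreover have "formal_sum r c F w = 0\<^sub>m r c" unfolding formal_sum_def 2 by (intro eq_matI) auto
    ultimately show ?thesis by simp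
  qed
qed

lemma zero_block:
  assumes "w \<in> nc_words g" "w \<noteq> []"
  shows "mat d' d (\<lambda>(i,l). 0\<^sub>m d' (d * g) $$ (i, last w * d + l)) = (0\<^sub>m d' d :: complex mat)"
proof (rule eq_matI)
  fix i l assume "i < dim_row (0\<^sub>m d' d :: complex mat)" "l < dim_col (0\<^sub>m d' d :: complex mat)"
  moreover have "last w < g" using assms last_in_set[of w] by auto
  ultimately show "mat d' d (\<lambda>(i,l). 0\<^sub>m d' (d * g) $$ (i, last w * d + l)) $$ (i,l) = (0\<^sub>m d' d :: complex mat) $$ (i,l)"
    using block_index_less[of "last w" g l d] by (simp add: mult.commute)
qed auto

context contractive_series
begin

lemma left_coeff_block:
  assumes w: "w \<in> nc_words g" "w \<noteq> []"
  shows "mat d' d (\<lambda>(i,l). Q (butlast w) $$ (i, last w * d + l)) = b w"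
proof (rule eq_matI)
  have bw: "b w \<in> carrier_mat d' d" using coeff w by blast
  have lw: "last w < g" using w last_in_set[of w] by auto
  fix i l assume "i < dim_row (b w)" "l < dim_col (b w)"
  then have il: "i < d'" "l < d" using bw by auto
  show "mat d' d (\<lambda>(i,l). Q (butlast w) $$ (i, last w * d + l)) $$ (i,l) = b w $$ (i,l)"
    using il left_coeff_index[OF il(1) lw il(2), of b "butlast w"] w by simp
qed (use coeff w in auto)

lemma butlast_word: "w \<in> nc_words g \<Longrightarrow> butlast w \<in> nc_words g"
  by (auto dest: in_set_butlastD)

lemma hom_part_linear:
  "series_eq g (hom_part d' d b 1) (series_mult_x d' d (const_series d' (d * g) (Q [])))"
  unfolding series_eq_def
proof
  fix w assume w: "w \<in> nc_words g"
  consider "w = []" | j where "w = [j]" | "length w \<ge> 2"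
    by (cases w rule: list.exhaust; cases "tl w"; force)
  then show "hom_part d' d b 1 w = series_mult_x d' d (const_series d' (d * g) (Q [])) w"
  proof cases
    case 1
    then show ?thesis by (simp add: hom_part_def series_mult_x_def)
  next
    case 2
    then show ?thesis using left_coeff_block[OF w] by (simp add: hom_part_def series_mult_x_def const_series_def)
  next
    case 3
    then have "w \<noteq> []" "butlast w \<noteq> []" by (auto simp flip: length_greater_0_conv)
    then show ?thesis using 3 zero_block[OF w, of d' d] by (simp add: hom_part_def series_mult_x_def const_series_def)
  qed
qed

lemma linear_part_unique:
  assumes M: "M \<in> carrier_mat d' (d * g)"
    and eq: "series_eq g (hom_part d' d b 1) (series_mult_x d' d (const_series d' (d * g) M))"
  shows "M = Q []"
proof (rule eq_matI)
  fix i k assume "i < dim_row (Q [])" "k < dim_col (Q [])"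
  then have i: "i < d'" and "k < g * d" by (auto simp: left_coeff_def mult.commute)
  then obtain j q where k: "k = j * d + q" "j < g" "q < d" by (metis block_index_cases)
  have "[j] \<in> nc_words g" using k by simp
  then have "b [j] = mat d' d (\<lambda>(i,l). M $$ (i, j * d + l))"
    using eq[unfolded series_eq_def, rule_format, of "[j]"]
    by (simp add: hom_part_def series_mult_x_def const_series_def)
  then show "M $$ (i,k) = Q [] $$ (i,k)"
    using left_coeff_index[OF i k(2,3), of b "[]"] i k by simp
qed (use M in \<open>auto simp: left_coeff_def\<close>)

lemma P_mult_proj:
  assumes "w \<in> nc_words g" "\<alpha> \<ge> 2"
  shows "P \<alpha> w * Pr = P \<alpha> w"
proof (cases "length w = \<alpha> - 1")
  case True
  then have "w \<noteq> []" using assms by auto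
  then show ?thesis using Q_mult_proj[OF assms(1)] True by (simp add: left_part_def)
next
  case False
  then show ?thesis using left_mult_zero_mat[OF proj_carrier, of d'] by (simp add: left_part_def)
qed

lemma hom_part_factors:
  assumes \<alpha>: "\<alpha> \<ge> 2"
  shows "series_eq g (hom_part d' d b \<alpha>) (series_mult_x d' d (\<lambda>w. P \<alpha> w * Pr))"
  unfolding series_eq_def
proof
  fix w assume w: "w \<in> nc_words g"
  show "hom_part d' d b \<alpha> w = series_mult_x d' d (\<lambda>w. P \<alpha> w * Pr) w"
  proof (cases "w = []")
    case True
    then show ?thesis using \<alpha> by (simp add: hom_part_def series_mult_x_def)
  next
    case False
    then have len: "length (butlast w) = \<alpha> - 1 \<longleftrightarrow> length w = \<alpha>" using \<alpha> by (cases w) auto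
    show ?thesis
      using False len left_coeff_block[OF w False] zero_block[OF w False, of d' d]
      unfolding series_mult_x_def P_mult_proj[OF butlast_word[OF w] \<alpha>]
      by (auto simp: hom_part_def left_part_def)
  qed
qed

lemma P_formally_summable: "formally_summable g d' (d * g) P"
  unfolding formally_summable_def
proof
  fix w
  have "{\<alpha>. \<alpha> \<ge> 2 \<and> P \<alpha> w \<noteq> 0\<^sub>m d' (d * g)} \<subseteq> {length w + 1}" by (auto simp: left_part_def split: if_splits)
  then show "finite {\<alpha>. \<alpha> \<ge> 2 \<and> P \<alpha> w \<noteq> 0\<^sub>m d' (d * g)}" by (rule finite_subset) simp
qed

lemma tail_factors:
  "series_eq g (formal_sum d' d (hom_part d' d b))
     (series_mult_x d' d (\<lambda>w. formal_sum d' (d * g) P w * Pr))"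
  unfolding series_eq_def
proof
  fix w assume w: "w \<in> nc_words g"
  have L: "formal_sum d' d (hom_part d' d b) w = (if length w \<ge> 2 then b w else 0\<^sub>m d' d)"
    using coeff w by (subst formal_sum_single[where a="length w"]) (auto simp: hom_part_def)
  have R: "formal_sum d' (d * g) P u * Pr = (if u = [] then 0\<^sub>m d' (d * g) else Q u)" if u: "u \<in> nc_words g" for u
  proof -
    have "formal_sum d' (d * g) P u = (if length u + 1 \<ge> 2 then P (length u + 1) u else 0\<^sub>m d' (d * g))"
      by (rule formal_sum_single) (auto simp: left_part_def left_coeff_carrier)
    then show ?thesis
      using Q_mult_proj[OF u] left_mult_zero_mat[OF proj_carrier, of d'] by (cases u) (auto simp: left_part_def)
  qed
  show "formal_sum d' d (hom_part d' d b) w = series_mult_x d' d (\<lambda>w. formal_sum d' (d * g) P w * Pr) w"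
  proof (cases "w = []")
    case True
    then show ?thesis unfolding L by (simp add: series_mult_x_def)
  next
    case False
    then have len: "butlast w = [] \<longleftrightarrow> \<not> length w \<ge> 2" by (cases w) (auto simp: Suc_le_eq)
    show ?thesis
      using False len left_coeff_block[OF w False] zero_block[OF w False, of d' d]
      unfolding L series_mult_x_def R[OF butlast_word[OF w]] by auto
  qed
qed

lemma linear_off_S_strict: "mat_norm (Q [] * Pr) < 1"
proof -
  obtain c where c: "0 \<le> c" "c < 1"
    and le: "\<And>v. v \<in> orth_compl (d * g) S \<Longrightarrow> vec_norm (Q [] *\<^sub>v v) \<le> c * vec_norm v"
    using strict_contraction_off_iso_space[OF left_coeff_carrier Q_Nil_contraction] by blast
  have "mat_norm (Q [] * Pr) \<le> c"
  proof (rule mat_norm_le[OF mult_carrier_mat[OF left_coeff_carrier proj_carrier] c(1)])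
    fix v :: "complex vec" assume v: "v \<in> carrier_vec (d * g)"
    have "vec_norm ((Q [] * Pr) *\<^sub>v v) \<le> c * vec_norm (Pr *\<^sub>v v)"
      unfolding assoc_mult_mat_vec[OF left_coeff_carrier proj_carrier v]
      by (rule le[OF proj_mat_in[OF S_orth_subspace v]])
    also have "\<dots> \<le> c * vec_norm v"
      using proj_mat_contraction[OF S_orth_subspace v] c(1) by (rule mult_left_mono)
    finally show "vec_norm ((Q [] * Pr) *\<^sub>v v) \<le> c * vec_norm v" .
  qed
  then show ?thesis using c by simp
qed

text \<open>A subspace with these two properties lies in \<open>S\<close>; a vector of \<open>S\<close> orthogonal to it would be
  both preserved in norm and strictly contracted.\<close>

lemma iso_subspace_unique:
  assumes S': "lin_subspace (d * g) S'" and iso: "\<And>v. v \<in> S' \<Longrightarrow> vec_norm (Q [] *\<^sub>v v) = vec_norm v"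
    and strict: "mat_norm (Q [] * proj_mat (d * g) (orth_compl (d * g) S')) < 1"
  shows "S' = S"
proof
  have S'c: "S' \<subseteq> carrier_vec (d * g)" using S' by (simp add: lin_subspace_def)
  show sub: "S' \<subseteq> S"
    using iso_space_if_norm_eq[OF left_coeff_carrier Q_Nil_contraction] iso S'c by blast
  show "S \<subseteq> S'"
  proof
    fix s assume s: "s \<in> S"
    then have sc: "s \<in> carrier_vec (d * g)" by (rule S_carrier)
    let ?O = "orth_compl (d * g) S'"
    have O: "lin_subspace (d * g) ?O" by (rule lin_subspace_orth_compl[OF S'c])
    let ?p = "proj_mat (d * g) S' *\<^sub>v s"
    have p: "?p \<in> S'" by (rule proj_mat_in[OF S' sc])
    then have pc: "?p \<in> carrier_vec (d * g)" using S'c by blast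
    define r where "r = s - ?p"
    have rO: "r \<in> ?O" unfolding r_def by (rule residual_in_orth_compl[OF S' sc])
    have rS: "r \<in> S" unfolding r_def using lin_subspace_diff[OF S_subspace s] sub p by blast
    have rc: "r \<in> carrier_vec (d * g)" by (rule S_carrier[OF rS])
    have "vec_norm r = vec_norm (Q [] *\<^sub>v r)" by (rule iso_space_norm[OF left_coeff_carrier rS, symmetric])
    also have "Q [] *\<^sub>v r = (Q [] * proj_mat (d * g) ?O) *\<^sub>v r"
      unfolding assoc_mult_mat_vec[OF left_coeff_carrier proj_mat_carrier[OF O] rc] proj_mat_fixes[OF O rO] ..
    also have "vec_norm \<dots> \<le> mat_norm (Q [] * proj_mat (d * g) ?O) * vec_norm r"
      by (rule mat_norm_bound[OF mult_carrier_mat[OF left_coeff_carrier proj_mat_carrier[OF O]] rc])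
    finally have "(1 - mat_norm (Q [] * proj_mat (d * g) ?O)) * vec_norm r \<le> 0" by (simp add: algebra_simps)
    then have "vec_norm r = 0" using strict vec_norm_nonneg[of r] by (simp add: mult_le_0_iff)
    then have "r = 0\<^sub>v (d * g)" using vec_norm_eq_0_iff[OF rc] by simp
    then have "s = ?p" using vec_diff_eq_0[OF sc pc] by (simp add: r_def)
    then show "s \<in> S'" using p by simp
  qed
qed

lemma linear_plus_tail_contraction:
  assumes N: "N \<ge> 1" and X: "X \<in> int_ball g N"
  shows "op_norm (d * g * N)
    (\<lambda>v. let v' = proj_mat (d * g * N) (tensor_space (d * g) (orth_compl (d * g) S) N) *\<^sub>v v
         in (Q [] \<otimes>\<^sub>k 1\<^sub>m N) *\<^sub>v v' + tail_apply g d' (d * g) P X v') \<le> 1"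
proof (rule op_norm_le)
  fix v :: "complex vec" assume v: "v \<in> carrier_vec (d * g * N)" "vec_norm v \<le> 1"
  let ?T = "tensor_space (d * g) (orth_compl (d * g) S) N"
  let ?v = "proj_mat (d * g * N) ?T *\<^sub>v v"
  note T = tensor_space_lin_subspace[OF S_orth_subspace, of N]
  have "?v \<in> carrier_vec (d * g * N)" by (rule mult_mat_vec_carrier[OF proj_mat_carrier[OF T] v(1)])
  from tail_sums(2)[OF N X this] proj_mat_contraction[OF T v(1)] v(2)
  show "vec_norm (let v' = ?v in (Q [] \<otimes>\<^sub>k 1\<^sub>m N) *\<^sub>v v' + tail_apply g d' (d * g) P X v') \<le> 1"
    by (simp add: Let_def)
qed

end

section \<open>Existence and uniqueness\<close>

lemma ex1_pairI:
  assumes "R x y" "\<And>x' y'. R x' y' \<Longrightarrow> x' = x \<and> y' = y"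
  shows "\<exists>!(x, y). R x y"
proof (rule ex1I[of _ "(x, y)"])
  show "p = (x, y)" if "case p of (x, y) \<Rightarrow> R x y" for p
    using that assms(2)[of "fst p" "snd p"] by (simp add: case_prod_unfold prod_eq_iff)
qed (simp add: assms(1))

lemma contractive_series_pencil:
  assumes "is_pencil g d' d A" and "semi_dist_pencil_ball_map g d' d A f"
    and f0: "\<forall>N\<ge>1. f (0\<^sub>m (g * N) N) = 0\<^sub>m (g * N) N"
    and b: "nc_expansion g d' d (pencil_eval g d' d A \<circ> f) b"
  shows "contractive_series g d' d b (pencil_eval g d' d A \<circ> f)"
proof
  let ?h = "pencil_eval g d' d A \<circ> f"
  have fa: "nc_analytic g g 1 f" using assms(2) by (simp add: semi_dist_pencil_ball_map_def)
  have fc: "f X \<in> carrier_mat (g * N) N" if "N \<ge> 1" "X \<in> int_ball g N" for N X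
    using fa that by (simp add: nc_analytic_def nc_mats_def)
  have hr: "radially_holomorphic g d' d ?h"
    by (rule radially_holomorphic_pencil[OF assms(1) nc_analytic_radially_holomorphic[OF fa] fc])
  show bc: "\<forall>w\<in>nc_words g. b w \<in> carrier_mat d' d" using b by (simp add: nc_expansion_def)
  show "mat_norm (?h X) \<le> 1" if "N \<ge> 1" "X \<in> int_ball g N" for N X
    using assms(2) that by (simp add: semi_dist_pencil_ball_map_def pencil_ball_def)
  show series: "mat_sums (d' * N) (d * N) (\<lambda>\<alpha>. nc_poly_eval g d' d (hom_part d' d b \<alpha>) X) (?h X)"
    if "N \<ge> 1" "X \<in> int_ball g N" for N X
    using expansion_converges_on_ball[OF hr b that] pencil_eval_carrier[OF fc[OF that], of g d' d A]
    by (simp add: nc_mats_def)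
  define X where "X = (0\<^sub>m (g * 1) 1 :: complex mat)"
  have Xc: "X \<in> carrier_mat (g * 1) 1" by (simp add: X_def)
  have X0: "0 \<cdot>\<^sub>m X = X" by (intro eq_matI) (auto simp: X_def)
  have "mat_norm X \<le> 0" using mat_norm_smult_le[OF Xc, of 0] unfolding X0 by simp
  then have Xb: "X \<in> int_ball g 1" using Xc by (simp add: nc_nbhd_def nc_mats_def)
  have fX: "f X = 0\<^sub>m (g * 1) 1" unfolding X_def using f0 by blast
  show "b [] = 0\<^sub>m d' d"
  proof (rule eq_matI)
    fix i j assume "i < dim_row (0\<^sub>m d' d)" "j < dim_col (0\<^sub>m d' d)"
    then have ij: "i < d'" "j < d" by auto
    have one: "(0::nat) < 1" by simp
    let ?H = "\<lambda>\<alpha>. nc_poly_eval g d' d (hom_part d' d b \<alpha>) X"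
    have H: "?H \<alpha> \<in> carrier_mat (d' * 1) (d * 1)" for \<alpha> by (rule nc_poly_eval_carrier[OF Xc])
    have "?H \<alpha> = 0 ^ \<alpha> \<cdot>\<^sub>m ?H \<alpha>" for \<alpha>
      using nc_poly_eval_smult[OF homogeneous_hom_part[OF bc] Xc, of \<alpha> 0] unfolding X0 .
    then have "?H \<alpha> $$ (i,j) = (0 ^ \<alpha> \<cdot>\<^sub>m ?H \<alpha>) $$ (i,j)" for \<alpha>
      by (rule arg_cong[of _ _ "\<lambda>A. A $$ (i,j)"])
    also have "(0 ^ \<alpha> \<cdot>\<^sub>m ?H \<alpha>) $$ (i,j) = 0 ^ \<alpha> * ?H \<alpha> $$ (i,j)" for \<alpha>
      using H[of \<alpha>] ij by simp
    finally have "?H \<alpha> $$ (i,j) = 0 ^ \<alpha> * ?H \<alpha> $$ (i,j)" for \<alpha> .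
    then have H0: "?H \<alpha> $$ (i,j) = 0" if "\<alpha> \<noteq> 0" for \<alpha>
      using that by (metis mult_zero_left power_0_left)
    have "(\<lambda>\<alpha>. ?H \<alpha> $$ (i,j)) sums ?h X $$ (i,j)"
      using series[OF _ Xb] ij by (simp add: mat_sums_def)
    moreover have "(\<lambda>\<alpha>. ?H \<alpha> $$ (i,j)) sums (\<Sum>\<alpha>\<in>{0}. ?H \<alpha> $$ (i,j))"
      by (rule sums_finite) (auto intro: H0)
    ultimately have "?h X $$ (i,j) = (\<Sum>\<alpha>\<in>{0}. ?H \<alpha> $$ (i,j))" by (rule sums_unique2)
    also have "\<dots> = b [] $$ (i,j)"
      using hom_part_eval_index[OF bc Xc ij one one, of 0]
      by (simp add: words_0 word_eval_Nil[OF Xc])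
    finally have "b [] $$ (i,j) = pencil_eval g d' d A (0\<^sub>m (g * 1) 1) $$ (i * 1 + 0, j * 1 + 0)" using fX by simp
    also have "\<dots> = (\<Sum>k<g. A k $$ (i,j) * 0\<^sub>m (g * 1) 1 $$ (k * 1 + 0, 0))"
      by (rule pencil_eval_index[OF assms(1) zero_carrier_mat ij one one])
    also have "\<dots> = 0" by (intro sum.neutral) auto
    finally show "b [] $$ (i,j) = 0\<^sub>m d' d $$ (i,j)" using ij by simp
  qed (use bc in auto)
qed

lemma tensor_space_carrier:
  assumes "lin_subspace n T" "v \<in> tensor_space n T N"
  shows "v \<in> carrier_vec (n * N)"
  using assms by (simp add: tensor_space_eq)

theorem theorem8p1:
  fixes g d' d :: nat
    and A :: "nat \<Rightarrow> complex mat"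
    and f h :: "complex mat \<Rightarrow> complex mat"
  assumes "g \<ge> 1" and "d' \<ge> 1" and "d \<ge> 1"
    and "is_pencil g d' d A"
    and "semi_dist_pencil_ball_map g d' d A f"
    and "\<forall>N\<ge>1. f (0\<^sub>m (g * N) N) = 0\<^sub>m (g * N) N"
  defines "h \<equiv> pencil_eval g d' d A \<circ> f"
  shows "(\<forall>N\<ge>1. \<forall>X\<in>int_ball g N. h X \<in> nc_ball d' d N) \<and>
    (\<exists>b. nc_expansion g d' d h b) \<and>
    (\<forall>b. nc_expansion g d' d h b \<longrightarrow>
      (\<exists>!(M, S).
        M \<in> carrier_mat d' (d * g) \<and> mat_norm M \<le> 1 \<and>
        is_subspace (d * g) S \<and> S \<noteq> {0\<^sub>v (d * g)} \<and>
        \<comment> \<open>(1)\<close>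
        series_eq g (hom_part d' d b 1) (series_mult_x d' d (const_series d' (d * g) M)) \<and>
        (\<forall>v\<in>S. vec_norm (M *\<^sub>v v) = vec_norm v) \<and>
        mat_norm (M * proj_mat (d * g) (orth_compl (d * g) S)) < 1 \<and>
        (\<exists>P.
          \<comment> \<open>(2)\<close>
          (\<forall>\<alpha>\<ge>2. nc_poly g d' (d * g) (P \<alpha>) \<and>
            series_eq g (hom_part d' d b \<alpha>)
              (series_mult_x d' d (\<lambda>w. P \<alpha> w * proj_mat (d * g) (orth_compl (d * g) S)))) \<and>
          \<comment> \<open>(3)\<close>
          formally_summable g d' (d * g) P \<and>
          series_eq g (formal_sum d' d (hom_part d' d b))
            (series_mult_x d' d
              (\<lambda>w. formal_sum d' (d * g) P w * proj_mat (d * g) (orth_compl (d * g) S))) \<and>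
          (\<exists>\<epsilon>>0. \<forall>N\<ge>1. \<forall>X\<in>nc_nbhd g \<epsilon> N.
            (\<forall>v\<in>tensor_space (d * g) (orth_compl (d * g) S) N.
               tail_converges g d' (d * g) P X v) \<and>
            (\<forall>u\<in>carrier_vec (d * N).
               vec_sums (d' * N)
                 (\<lambda>\<alpha>. nc_poly_eval g d' d (hom_part d' d b (\<alpha> + 2)) X *\<^sub>v u)
                 (tail_apply g d' (d * g) P X
                   ((proj_mat (d * g) (orth_compl (d * g) S) \<otimes>\<^sub>k 1\<^sub>m N) *\<^sub>v (x_eval g d X *\<^sub>v u))))) \<and>
          \<comment> \<open>(4)\<close>
          (\<forall>N\<ge>1. \<forall>X\<in>int_ball g N.
            (\<forall>v\<in>tensor_space (d * g) (orth_compl (d * g) S) N.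
               tail_converges g d' (d * g) P X v) \<and>
            op_norm (d * g * N)
              (\<lambda>v. let v' = proj_mat (d * g * N) (tensor_space (d * g) (orth_compl (d * g) S) N) *\<^sub>v v
                   in (M \<otimes>\<^sub>k 1\<^sub>m N) *\<^sub>v v' + tail_apply g d' (d * g) P X v') \<le> 1 \<and>
            (\<forall>u\<in>tensor_space (d * g) S N. \<forall>v\<in>tensor_space (d * g) (orth_compl (d * g) S) N.
               ((M \<otimes>\<^sub>k 1\<^sub>m N) *\<^sub>v u) \<bullet>c ((M \<otimes>\<^sub>k 1\<^sub>m N) *\<^sub>v v) = 0 \<and>
               (\<forall>\<alpha>\<ge>2. ((M \<otimes>\<^sub>k 1\<^sub>m N) *\<^sub>v u) \<bullet>c (nc_poly_eval g d' (d * g) (P \<alpha>) X *\<^sub>v v) = 0) \<and>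
               ((M \<otimes>\<^sub>k 1\<^sub>m N) *\<^sub>v u) \<bullet>c tail_apply g d' (d * g) P X v = 0)))))"
proof (intro conjI allI impI ballI, goal_cases)
  case (1 N X)
  then have "f X \<in> pencil_ball g d' d A N" using assms(5) by (simp add: semi_dist_pencil_ball_map_def)
  then show ?case
    using pencil_eval_carrier[of "f X" "g * N" N g d' d A]
    by (simp add: h_def nc_ball_def pencil_ball_def nc_mats_def)
next
  case 2
  show ?case
    using assms(5) nc_expansion_pencil[OF assms(4)]
    unfolding h_def semi_dist_pencil_ball_map_def nc_analytic_def by blast
next
  case (3 b)
  then have b: "nc_expansion g d' d h b" .
  interpret C: contractive_series g d' d b h
    unfolding h_def by (rule contractive_series_pencil[OF assms(4-6) b[unfolded h_def]])
  have tc: "v \<in> carrier_vec (d * g * N)" if "v \<in> tensor_space (d * g) (orth_compl (d * g) C.S) N" for v N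
    by (rule tensor_space_carrier[OF C.S_orth_subspace that])
  have S_ne: "C.S \<noteq> {0\<^sub>v (d * g)}"
  proof
    assume S0: "C.S = {0\<^sub>v (d * g)}"
    obtain c where c: "0 \<le> c" "c < 1"
      and le: "\<And>v. v \<in> orth_compl (d * g) C.S \<Longrightarrow> vec_norm (C.Q [] *\<^sub>v v) \<le> c * vec_norm v"
      using strict_contraction_off_iso_space[OF left_coeff_carrier C.Q_Nil_contraction] by blast
    have "v \<in> orth_compl (d * g) C.S" if "v \<in> carrier_vec (d * g)" for v
      unfolding S0 orth_compl_def using that by simp
    then have "1 \<le> c"
      using le by (intro C.boundary_norm[OF assms(1,4,5) _ b c(1)]) (simp_all add: h_def)
    then show False using c by simp
  qed
  show ?case
  proof (rule ex1_pairI[where x="C.Q []" and y="C.S"], goal_cases)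
    case 1
    show ?case
    proof (intro conjI exI[of _ C.P] allI impI ballI)
      show "C.Q [] \<in> carrier_mat d' (d * g)" by (rule left_coeff_carrier)
      show "mat_norm (C.Q []) \<le> 1"
        using C.Q_Nil_contraction by (intro mat_norm_le[OF left_coeff_carrier]) auto
      show "is_subspace (d * g) C.S" unfolding is_subspace_iff by (rule C.S_subspace)
      show "C.S \<noteq> {0\<^sub>v (d * g)}" by (rule S_ne)
      show "series_eq g (hom_part d' d b 1) (series_mult_x d' d (const_series d' (d * g) (C.Q [])))"
        by (rule C.hom_part_linear)
      show "vec_norm (C.Q [] *\<^sub>v v) = vec_norm v" if "v \<in> C.S" for v
        using iso_space_norm[OF left_coeff_carrier that] .
      show "mat_norm (C.Q [] * C.Pr) < 1" by (rule C.linear_off_S_strict)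
    next
      fix \<alpha> :: nat assume \<alpha>: "2 \<le> \<alpha>"
      show "nc_poly g d' (d * g) (C.P \<alpha>)" by (rule homogeneous_nc_poly[OF homogeneous_left_part])
      show "series_eq g (hom_part d' d b \<alpha>) (series_mult_x d' d (\<lambda>w. C.P \<alpha> w * C.Pr))"
        by (rule C.hom_part_factors[OF \<alpha>])
    next
      show "formally_summable g d' (d * g) C.P" by (rule C.P_formally_summable)
      show "series_eq g (formal_sum d' d (hom_part d' d b))
          (series_mult_x d' d (\<lambda>w. formal_sum d' (d * g) C.P w * C.Pr))" by (rule C.tail_factors)
    next
      \<comment> \<open>the whole open ball serves as the neighbourhood of 0\<close>
      show "\<exists>\<epsilon>>0. \<forall>N\<ge>1. \<forall>X\<in>nc_nbhd g \<epsilon> N.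
          (\<forall>v\<in>tensor_space (d * g) (orth_compl (d * g) C.S) N. tail_converges g d' (d * g) C.P X v) \<and>
          (\<forall>u\<in>carrier_vec (d * N). vec_sums (d' * N)
            (\<lambda>\<alpha>. nc_poly_eval g d' d (hom_part d' d b (\<alpha> + 2)) X *\<^sub>v u)
            (tail_apply g d' (d * g) C.P X ((C.Pr \<otimes>\<^sub>k 1\<^sub>m N) *\<^sub>v (x_eval g d X *\<^sub>v u))))"
      proof (intro exI[of _ 1] conjI allI impI ballI)
        fix N X assume NX: "1 \<le> N" "X \<in> int_ball g N"
        show "tail_converges g d' (d * g) C.P X v" if "v \<in> tensor_space (d * g) (orth_compl (d * g) C.S) N" for v
          by (rule C.tail_converges[OF NX tc[OF that]])
        show "vec_sums (d' * N) (\<lambda>\<alpha>. nc_poly_eval g d' d (hom_part d' d b (\<alpha> + 2)) X *\<^sub>v u)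
            (tail_apply g d' (d * g) C.P X ((C.Pr \<otimes>\<^sub>k 1\<^sub>m N) *\<^sub>v (x_eval g d X *\<^sub>v u)))"
          if "u \<in> carrier_vec (d * N)" for u
          by (rule C.hom_tail_sums[OF NX that])
      qed simp
    next
      fix N X assume NX: "1 \<le> N" "X \<in> int_ball g N"
      then have Xc: "X \<in> carrier_mat (g * N) N" by (simp add: nc_nbhd_def nc_mats_def)
      show "op_norm (d * g * N)
          (\<lambda>v. let v' = proj_mat (d * g * N) (tensor_space (d * g) (orth_compl (d * g) C.S) N) *\<^sub>v v
               in (C.Q [] \<otimes>\<^sub>k 1\<^sub>m N) *\<^sub>v v' + tail_apply g d' (d * g) C.P X v') \<le> 1"
        by (rule C.linear_plus_tail_contraction[OF NX])
      fix v assume v: "v \<in> tensor_space (d * g) (orth_compl (d * g) C.S) N"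
      show "tail_converges g d' (d * g) C.P X v" by (rule C.tail_converges[OF NX tc[OF v]])
      fix u assume u: "u \<in> tensor_space (d * g) C.S N"
      show "((C.Q [] \<otimes>\<^sub>k 1\<^sub>m N) *\<^sub>v u) \<bullet>c ((C.Q [] \<otimes>\<^sub>k 1\<^sub>m N) *\<^sub>v v) = 0"
        by (rule C.orthogonal_linear_linear[OF u v])
      show "((C.Q [] \<otimes>\<^sub>k 1\<^sub>m N) *\<^sub>v u) \<bullet>c (nc_poly_eval g d' (d * g) (C.P \<alpha>) X *\<^sub>v v) = 0"
        if "2 \<le> \<alpha>" for \<alpha>
        using that by (intro C.orthogonal_linear_Qpart[OF u tc[OF v] Xc]) simp
      show "((C.Q [] \<otimes>\<^sub>k 1\<^sub>m N) *\<^sub>v u) \<bullet>c tail_apply g d' (d * g) C.P X v = 0"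
        by (rule C.orthogonal_linear_tail[OF u NX tc[OF v]])
    qed
  next
    case (2 M S)
    have "M \<in> carrier_mat d' (d * g)" using 2 by (elim conjE)
    moreover have "series_eq g (hom_part d' d b 1) (series_mult_x d' d (const_series d' (d * g) M))"
      using 2 by (elim conjE)
    ultimately have M: "M = C.Q []" by (rule C.linear_part_unique)
    have "is_subspace (d * g) S" using 2 by (elim conjE)
    moreover have "\<forall>v\<in>S. vec_norm (M *\<^sub>v v) = vec_norm v" using 2 by (elim conjE)
    moreover have "mat_norm (M * proj_mat (d * g) (orth_compl (d * g) S)) < 1" using 2 by (elim conjE)
    ultimately have "S = C.S" unfolding M is_subspace_iff by (intro C.iso_subspace_unique) auto
    then show ?case using M by simp
  qed
qed

end
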